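(* Let $N\ge2$, $M\ge1$, $k\ge0$ and let $\Gamma$ be a positive semidefinite operator on $\mathcal H_M$. Then for every unit vector $u\in\mathbb C^N$, $$\mathrm{Tr}_{\mathcal H_M}(\Gamma)\,\mathcal T^k\big(|\otimes^M u\rangle\langle\otimes^M u|\big)\;\succ\;\mathcal T^k(\Gamma).$$ Moreover, if $M\ge2$ and $k>0$, the two ordered eigenvalue sequences are not identical (the majorization is strict) unless $\Gamma=\mathrm{Tr}_{\mathcal H_M}(\Gamma)\,|\otimes^M w\rangle\langle\otimes^M w|$ for some unit vector $w\in\mathbb C^N$.
   Context: For $n\ge 0$, $\mathcal H_n=P_n(\mathbb C^N)^{\otimes n}$ is the totally symmetric subspace, $P_n$ the orthogonal projection with $P_n\, u_1\otimes\cdots\otimes u_n=\frac1{n!}\sum_{\sigma\in S_n}u_{\sigma(1)}\otimes\cdots\otimes u_{\sigma(n)}$. An operator $\Gamma$ on $\mathcal H_M$ is extended to $(\mathbb C^N)^{\otimes M}$ by $\Gamma=P_M\Gamma P_M$. For $k\ge0$, $\mathcal T^k(\Gamma)=\frac{(M+k)!}{M!}P_{M+k}\big(I_{\mathbb C^N}^{\otimes k}\otimes\Gamma\big)P_{M+k}$, an operator on $\mathcal H_{M+k}$. For Hermitian operators $X,Y$ on the same finite-dimensional space with eigenvalues $x_1\ge\cdots\ge x_\mu$ and $y_1\ge\cdots\ge y_\mu$ (with multiplicity), $X\succ Y$ means $\sum_{j=1}^q x_j\ge\sum_{j=1}^q y_j$ for all $1\le q\le\mu$, with equality for $q=\mu$.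 *)

theory Defs
  imports "Jordan_Normal_Form.Schur_Decomposition" "Jordan_Normal_Form.Char_Poly"
    "HOL-Computational_Algebra.Fundamental_Theorem_Algebra"
    "HOL-Library.Multiset" "HOL-Combinatorics.Permutations"
begin

text \<open>(C^N)^{\<otimes>n} is modelled as complex^(N^n): the basis index i < N^n encodes the tuple
  of digits (dig N n i 0, ..., dig N n i (n-1)) in base N, the first tensor factor being the
  most significant digit.\<close>

definition dig :: "nat \<Rightarrow> nat \<Rightarrow> nat \<Rightarrow> nat \<Rightarrow> nat" where
  "dig N n i t = i div N ^ (n - 1 - t) mod N"

text \<open>Symmetrizer P_n = (1/n!) sum over sigma of the permutation operators, where
  P_sigma (e_{d 0} \<otimes> ... \<otimes> e_{d (n-1)}) = e_{d (sigma 0)} \<otimes> ... \<otimes> e_{d (sigma (n-1))}.\<close>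
definition sym_proj :: "nat \<Rightarrow> nat \<Rightarrow> complex mat" where
  "sym_proj N n = mat (N ^ n) (N ^ n) (\<lambda>(i, j).
     of_nat (card {\<sigma>. \<sigma> permutes {..<n} \<and> (\<forall>t<n. dig N n i t = dig N n j (\<sigma> t))})
     / of_nat (fact n))"

definition id_tensor :: "nat \<Rightarrow> nat \<Rightarrow> nat \<Rightarrow> complex mat \<Rightarrow> complex mat" where
  "id_tensor N M k \<Gamma> = mat (N ^ (k + M)) (N ^ (k + M)) (\<lambda>(i, j).
     if i div N ^ M = j div N ^ M then \<Gamma> $$ (i mod N ^ M, j mod N ^ M) else 0)"

definition lift_op :: "nat \<Rightarrow> nat \<Rightarrow> nat \<Rightarrow> complex mat \<Rightarrow> complex mat" where
  "lift_op N M k \<Gamma> = (of_nat (fact (M + k)) / of_nat (fact M)) \<cdot>\<^sub>m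
     (sym_proj N (M + k) * id_tensor N M k \<Gamma> * sym_proj N (M + k))"

definition mtrace :: "complex mat \<Rightarrow> complex" where
  "mtrace A = (\<Sum>i<dim_row A. A $$ (i, i))"

definition tensor_pow :: "nat \<Rightarrow> nat \<Rightarrow> complex vec \<Rightarrow> complex vec" where
  "tensor_pow N M u = vec (N ^ M) (\<lambda>i. \<Prod>t<M. u $ dig N M i t)"

definition ket_bra :: "complex vec \<Rightarrow> complex mat" where
  "ket_bra v = mat (dim_vec v) (dim_vec v) (\<lambda>(i, j). v $ i * cnj (v $ j))"

definition unit_cvec :: "nat \<Rightarrow> complex vec \<Rightarrow> bool" where
  "unit_cvec N u \<longleftrightarrow> u \<in> carrier_vec N \<and> (\<Sum>i<N. (cmod (u $ i))\<^sup>2) = 1"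

definition psd :: "nat \<Rightarrow> complex mat \<Rightarrow> bool" where
  "psd n A \<longleftrightarrow> A \<in> carrier_mat n n \<and> mat_adjoint A = A \<and>
     (\<forall>v \<in> carrier_vec n. 0 \<le> Re (conjugate v \<bullet> (A *\<^sub>v v)))"

definition eigs_desc :: "complex mat \<Rightarrow> real list" where
  "eigs_desc A = rev (sorted_list_of_multiset (image_mset Re (proots (char_poly A))))"

definition majorizes :: "real list \<Rightarrow> real list \<Rightarrow> bool" where
  "majorizes x y \<longleftrightarrow> length x = length y \<and>
     (\<forall>q\<in>{1..length x}. sum_list (take q y) \<le> sum_list (take q x)) \<and>
     sum_list x = sum_list y"

end

theory Submission
  imports Defs "HOL-Combinatorics.Multiset_Permutations"
begin

text \<open>
  Decompose \<open>\<Gamma>\<close> into rank one pieces \<open>|\<phi>\<rangle>\<langle>\<phi>|\<close>; by Ky Fan's variational principle it suffices to bound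
  \<open>\<Sum>\<^sub>i \<langle>v\<^sub>i, T\<^sup>k(|\<phi>\<rangle>\<langle>\<phi>|) v\<^sub>i\<rangle>\<close> over orthonormal systems \<open>v\<close> of \<open>H\<^sub>M\<^sub>+\<^sub>k\<close>. This operator is a multiple of \<open>C\<^sup>* C\<close>, where
  \<open>C : H\<^sub>M\<^sub>+\<^sub>k \<rightarrow> H\<^sub>k\<close> contracts with \<open>\<phi>\<close>, so it has the same nonzero eigenvalues as \<open>C C\<^sup>*\<close>. Normal ordering
  writes \<open>C C\<^sup>*\<close> as a positive combination of the operators \<open>T\<^sup>k\<^sup>-\<^sup>m(\<gamma>\<^sub>m)\<close> on \<open>H\<^sub>k\<close>, with \<open>\<gamma>\<^sub>m\<close> the \<open>m\<close>-particle
  reduced density matrix of \<open>\<phi>\<close>, whose trace is fixed. Induction on the total number of particles bounds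
  each of them by its coherent counterpart, and the coherent bounds add up exactly, because the
  coherent operators on \<open>H\<^sub>k\<close> are simultaneously diagonal with eigenvalues in the same order
  (Vandermonde's identity). The same computation for a complete basis gives equality of the traces.

  Strictness is visible in the top eigenvalue alone: equality there forces equality in the
  Cauchy-Schwarz inequality, so the top eigenvector \<open>v\<close> splits as \<open>\<phi> \<otimes> c\<close>, and a symmetric tensor that
  splits off at least one factor is a product state.
\<close>

section \<open>Finite orthonormal systems\<close>

text \<open>Passing from \<open>C\<^sup>* C\<close> to \<open>C C\<^sup>*\<close> trades M + k
  particles for k, and this is what makes the induction descend. Only M = 0 does not descend, but
  there contraction is multiplication by a scalar. The induction diagonalizes nothing: it compares
  sums of squared norms of contractions over orthonormal systems, so it runs on functions of
  multisets, and matrices enter only afterwards. The slices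
  \<open>\<lambda>A. f (mset a + A)\<close> stand for the reduced density matrices; they need be
  neither orthogonal nor normalized, only their squared norms have to add up. A second obstacle is
  that \<open>eigs_desc\<close> lists the eigenvalues on the whole tensor space and not on the
  symmetric subspace. The additional ones are zeros and stay at the end of the list because the
  operators are positive semidefinite. But an eigenvector for the eigenvalue zero may fail to be
  symmetric, so the upper bound works with the positive eigenvalues alone, and partial sums are
  compared at \<open>min q (sdim N n)\<close>.\<close>

text \<open>The map \<pi> lets one set of lemmas serve two models: coordinate vectors with \<pi> =
  id, and symmetric tensors with \<pi> = mset, where each multiset is weighted by the number of its
  words. Values outside the image of I are invisible, so the form is only semidefinite and
  identities of vectors hold pointwise on that image.\<close>

definition ip :: "('a \<Rightarrow> 'b) \<Rightarrow> 'a set \<Rightarrow> ('b \<Rightarrow> complex) \<Rightarrow> ('b \<Rightarrow> complex) \<Rightarrow> complex" where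
  "ip \<pi> I f g = (\<Sum>x\<in>I. cnj (f (\<pi> x)) * g (\<pi> x))"

definition nsq :: "('a \<Rightarrow> 'b) \<Rightarrow> 'a set \<Rightarrow> ('b \<Rightarrow> complex) \<Rightarrow> real" where
  "nsq \<pi> I f = (\<Sum>x\<in>I. (cmod (f (\<pi> x)))\<^sup>2)"

definition orthonormal :: "('a \<Rightarrow> 'b) \<Rightarrow> 'a set \<Rightarrow> nat \<Rightarrow> (nat \<Rightarrow> 'b \<Rightarrow> complex) \<Rightarrow> bool" where
  "orthonormal \<pi> I r v \<longleftrightarrow> (\<forall>i<r. \<forall>j<r. ip \<pi> I (v i) (v j) = (if i = j then 1 else 0))"

lemma orthonormalD:
  "orthonormal \<pi> I r v \<Longrightarrow> i < r \<Longrightarrow> j < r \<Longrightarrow> ip \<pi> I (v i) (v j) = (if i = j then 1 else 0)"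
  by (simp add: orthonormal_def)

lemma orthonormal_mono: "orthonormal \<pi> I r v \<Longrightarrow> s \<le> r \<Longrightarrow> orthonormal \<pi> I s v"
  by (auto simp: orthonormal_def)

lemma ip_self: "ip \<pi> I f f = of_real (nsq \<pi> I f)"
  unfolding ip_def nsq_def of_real_sum
  by (rule sum.cong) (simp_all add: complex_norm_square mult.commute del: of_real_power)

lemma nsq_nonneg [simp]: "0 \<le> nsq \<pi> I f"
  by (simp add: nsq_def sum_nonneg)

lemma nsq_eq_0_iff: "finite I \<Longrightarrow> nsq \<pi> I f = 0 \<longleftrightarrow> (\<forall>x\<in>I. f (\<pi> x) = 0)"
  by (simp add: nsq_def sum_nonneg_eq_0_iff)

lemma ip_cnj: "cnj (ip \<pi> I f g) = ip \<pi> I g f"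
  by (simp add: ip_def mult.commute)

lemma cmod_ip_commute: "cmod (ip \<pi> I f g) = cmod (ip \<pi> I g f)"
  by (metis complex_mod_cnj ip_cnj)

lemma ip_sum_right: "ip \<pi> I f (\<lambda>x. \<Sum>j\<in>J. c j * g j x) = (\<Sum>j\<in>J. c j * ip \<pi> I f (g j))"
  unfolding ip_def sum_distrib_left
  by (subst sum.swap) (simp add: algebra_simps)

lemma ip_sum_left: "ip \<pi> I (\<lambda>x. \<Sum>j\<in>J. c j * g j x) f = (\<Sum>j\<in>J. cnj (c j) * ip \<pi> I (g j) f)"
  by (subst ip_cnj[symmetric], subst ip_sum_right) (simp add: ip_cnj)

lemma ip_diff_right: "ip \<pi> I f (\<lambda>x. g x - h x) = ip \<pi> I f g - ip \<pi> I f h"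
  by (simp add: ip_def algebra_simps sum_subtractf)

lemma ip_diff_left: "ip \<pi> I (\<lambda>x. g x - h x) f = ip \<pi> I g f - ip \<pi> I h f"
  by (simp add: ip_def algebra_simps sum_subtractf)

lemma ip_scale_right: "ip \<pi> I f (\<lambda>x. c * g x) = c * ip \<pi> I f g"
  by (simp add: ip_def sum_distrib_left algebra_simps)

lemma ip_scale_left: "ip \<pi> I (\<lambda>x. c * g x) f = cnj c * ip \<pi> I g f"
  by (simp add: ip_def sum_distrib_left algebra_simps)

lemma orthonormal_nsq: "orthonormal \<pi> I r v \<Longrightarrow> i < r \<Longrightarrow> nsq \<pi> I (v i) = 1"
  using orthonormalD[of \<pi> I r v i i] ip_self[of \<pi> I "v i"] by simp

lemma nsq_scale: "nsq \<pi> I (\<lambda>x. c * f x) = (cmod c)\<^sup>2 * nsq \<pi> I f"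
  by (simp add: nsq_def sum_distrib_left norm_mult power_mult_distrib)

section \<open>Orthogonal projection, Bessel's inequality and Gram-Schmidt\<close>

definition residual :: "('a \<Rightarrow> 'b) \<Rightarrow> 'a set \<Rightarrow> nat \<Rightarrow> (nat \<Rightarrow> 'b \<Rightarrow> complex) \<Rightarrow> ('b \<Rightarrow> complex) \<Rightarrow> 'b \<Rightarrow> complex" where
  "residual \<pi> I r v f = (\<lambda>x. f x - (\<Sum>j<r. ip \<pi> I (v j) f * v j x))"

lemma ip_residual:
  assumes "orthonormal \<pi> I r v" "i < r"
  shows "ip \<pi> I (v i) (residual \<pi> I r v f) = 0"
proof -
  have "(\<Sum>j<r. ip \<pi> I (v j) f * ip \<pi> I (v i) (v j)) = (\<Sum>j<r. if i = j then ip \<pi> I (v j) f else 0)"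
    by (rule sum.cong) (use assms in \<open>auto simp: orthonormal_def\<close>)
  then show ?thesis
    using assms by (simp add: residual_def ip_diff_right ip_sum_right)
qed

lemma ip_residual_self:
  assumes "orthonormal \<pi> I r v"
  shows "ip \<pi> I (residual \<pi> I r v f) f = of_real (nsq \<pi> I (residual \<pi> I r v f))"
proof -
  let ?h = "residual \<pi> I r v f"
  have "ip \<pi> I ?h ?h = ip \<pi> I ?h f - (\<Sum>j<r. ip \<pi> I (v j) f * ip \<pi> I ?h (v j))"
    by (subst (2) residual_def) (simp add: ip_diff_right ip_sum_right)
  also have "(\<Sum>j<r. ip \<pi> I (v j) f * ip \<pi> I ?h (v j)) = 0"
    by (rule sum.neutral) (metis assms complex_cnj_zero ip_cnj ip_residual lessThan_iff mult_zero_right)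
  finally show ?thesis by (simp add: ip_self)
qed

lemma nsq_residual:
  assumes "orthonormal \<pi> I r v"
  shows "nsq \<pi> I (residual \<pi> I r v f) = nsq \<pi> I f - (\<Sum>i<r. (cmod (ip \<pi> I (v i) f))\<^sup>2)"
proof -
  have "complex_of_real (nsq \<pi> I (residual \<pi> I r v f)) = ip \<pi> I (residual \<pi> I r v f) f"
    by (simp add: ip_residual_self assms)
  also have "\<dots> = ip \<pi> I f f - (\<Sum>j<r. cnj (ip \<pi> I (v j) f) * ip \<pi> I (v j) f)"
    by (simp add: residual_def ip_diff_left ip_sum_left)
  also have "\<dots> = of_real (nsq \<pi> I f - (\<Sum>i<r. (cmod (ip \<pi> I (v i) f))\<^sup>2))"
    by (simp add: ip_self complex_norm_square mult.commute del: of_real_power)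
  finally show ?thesis using of_real_eq_iff by blast
qed

lemma Bessel:
  assumes "orthonormal \<pi> I r v"
  shows "(\<Sum>i<r. (cmod (ip \<pi> I (v i) f))\<^sup>2) \<le> nsq \<pi> I f"
  using nsq_residual[OF assms, of f] nsq_nonneg[of \<pi> I "residual \<pi> I r v f"] by linarith

text \<open>Gram-Schmidt. That g i lies in the span of the new system is expressed as equality in
  Bessel's inequality, which spares any notion of span or dimension. A vector with zero residual
  adds no member, hence only s' \<le> s + r.\<close>

lemma orthonormal_extend:
  assumes "orthonormal \<pi> I s w"
  shows "\<exists>s' w'. s \<le> s' \<and> s' \<le> s + r \<and> (\<forall>i<s. w' i = w i) \<and> orthonormal \<pi> I s' w' \<and>
           (\<forall>i<r. nsq \<pi> I (g i) = (\<Sum>j<s'. (cmod (ip \<pi> I (w' j) (g i)))\<^sup>2))"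
proof (induction r)
  case 0
  then show ?case using assms by auto
next
  case (Suc r)
  then obtain t w' where t: "s \<le> t" "t \<le> s + r" "\<forall>i<s. w' i = w i" "orthonormal \<pi> I t w'"
    and pars: "\<And>i. i < r \<Longrightarrow> nsq \<pi> I (g i) = (\<Sum>j<t. (cmod (ip \<pi> I (w' j) (g i)))\<^sup>2)"
    by blast
  define h where "h = residual \<pi> I t w' (g r)"
  show ?case
  proof (cases "nsq \<pi> I h = 0")
    case True
    then have "nsq \<pi> I (g r) = (\<Sum>j<t. (cmod (ip \<pi> I (w' j) (g r)))\<^sup>2)"
      using nsq_residual[OF t(4), of "g r"] by (simp add: h_def)
    then show ?thesis using t pars by (intro exI[of _ t] exI[of _ w']) (auto simp: less_Suc_eq)
  next
    case False
    define c where "c = 1 / sqrt (nsq \<pi> I h)"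
    define w'' where "w'' = w'(t := \<lambda>x. of_real c * h x)"
    have pos: "0 < nsq \<pi> I h" using False nsq_nonneg[of \<pi> I h] by linarith
    have c2: "c * (c * nsq \<pi> I h) = 1" using pos by (simp add: c_def field_simps)
    have hw: "ip \<pi> I (w' i) h = 0" "ip \<pi> I h (w' i) = 0" if "i < t" for i
      using ip_residual[OF t(4) that, of "g r"] ip_cnj[of \<pi> I "w' i" h] by (simp_all add: h_def)
    have "complex_of_real c * (of_real c * of_real (nsq \<pi> I h)) = 1"
      using c2 by (simp flip: of_real_mult)
    then have on: "orthonormal \<pi> I (Suc t) w''"
      using t(4) hw by (auto simp: orthonormal_def w''_def less_Suc_eq ip_scale_left ip_scale_right ip_self)
    have new: "nsq \<pi> I (g i) = (\<Sum>j<Suc t. (cmod (ip \<pi> I (w'' j) (g i)))\<^sup>2)" if "i < Suc r" for i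
    proof -
      have eq: "(\<Sum>j<Suc t. (cmod (ip \<pi> I (w'' j) (g i)))\<^sup>2)
         = (\<Sum>j<t. (cmod (ip \<pi> I (w' j) (g i)))\<^sup>2) + (cmod (ip \<pi> I (w'' t) (g i)))\<^sup>2"
        by (simp add: w''_def)
      show ?thesis
      proof (cases "i = r")
        case True
        have "cmod (ip \<pi> I (w'' t) (g r)) = \<bar>c * nsq \<pi> I h\<bar>"
          using ip_residual_self[OF t(4), of "g r"]
          by (simp add: w''_def ip_scale_left h_def norm_mult abs_mult)
        then have "(cmod (ip \<pi> I (w'' t) (g r)))\<^sup>2 = (c * nsq \<pi> I h)\<^sup>2" by simp
        also have "\<dots> = (c * (c * nsq \<pi> I h)) * nsq \<pi> I h" by (simp only: power2_eq_square mult_ac)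
        also have "\<dots> = nsq \<pi> I h" by (simp only: c2 mult_1_left)
        finally have "(cmod (ip \<pi> I (w'' t) (g r)))\<^sup>2 = nsq \<pi> I h" .
        then show ?thesis
          using eq nsq_residual[OF t(4), of "g r"] True by (simp add: h_def)
      next
        case False
        then have "i < r" using that by simp
        \<comment> \<open>Equality for an earlier vector survives the enlargement: its sum can only
          grow, and Bessel bounds it by the norm.\<close>
        have "0 \<le> (cmod (ip \<pi> I (w'' t) (g i)))\<^sup>2" by simp
        then show ?thesis using eq Bessel[OF on, of "g i"] pars[OF \<open>i < r\<close>] by linarith
      qed
    qed
    have "\<forall>i<s. w'' i = w i" using t(1,3) by (simp add: w''_def)
    then show ?thesis
      using t(1,2) on new by (intro exI[of _ "Suc t"] exI[of _ w'']) auto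
  qed
qed

lemma orthonormal_complete:
  assumes "orthonormal \<pi> I r v" "finite I"
    and "nsq \<pi> I f = (\<Sum>j<r. (cmod (ip \<pi> I (v j) f))\<^sup>2)" "x \<in> I"
  shows "f (\<pi> x) = (\<Sum>j<r. ip \<pi> I (v j) f * v j (\<pi> x))"
proof -
  have "nsq \<pi> I (residual \<pi> I r v f) = 0" using nsq_residual[OF assms(1), of f] assms(3) by linarith
  then show ?thesis using assms(2,4) by (auto simp: nsq_eq_0_iff residual_def)
qed

text \<open>If \<open>E\<close> is adjoint to \<open>C\<close>, then the Ky Fan sums of \<open>C\<^sup>* C\<close> are bounded by
  those of \<open>C C\<^sup>*\<close>: project onto an orthonormal basis of the span of the \<open>C v i\<close>.\<close>

lemma sum_nsq_adjoint_le:
  fixes C :: "('b \<Rightarrow> complex) \<Rightarrow> 'd \<Rightarrow> complex"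
  assumes adj: "\<And>w v. ip \<pi>' I' w (C v) = ip \<pi> I (E w) v"
    and v: "orthonormal \<pi> I r v"
    and bound: "\<And>s w. s \<le> r \<Longrightarrow> orthonormal \<pi>' I' s w \<Longrightarrow> (\<Sum>j<s. nsq \<pi> I (E (w j))) \<le> c"
  shows "(\<Sum>i<r. nsq \<pi>' I' (C (v i))) \<le> c"
proof -
  have "orthonormal \<pi>' I' 0 (\<lambda>_ _. 0)" by (simp add: orthonormal_def)
  from orthonormal_extend[OF this, of r "\<lambda>i. C (v i)"]
  obtain s w where s: "s \<le> r" "orthonormal \<pi>' I' s w"
    and pars: "\<And>i. i < r \<Longrightarrow> nsq \<pi>' I' (C (v i)) = (\<Sum>j<s. (cmod (ip \<pi>' I' (w j) (C (v i))))\<^sup>2)"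
    by auto
  have "(\<Sum>i<r. nsq \<pi>' I' (C (v i))) = (\<Sum>i<r. \<Sum>j<s. (cmod (ip \<pi> I (v i) (E (w j))))\<^sup>2)"
    by (simp add: pars adj cmod_ip_commute[of \<pi> I "E _"])
  also have "\<dots> = (\<Sum>j<s. \<Sum>i<r. (cmod (ip \<pi> I (v i) (E (w j))))\<^sup>2)"
    by (rule sum.swap)
  also have "\<dots> \<le> (\<Sum>j<s. nsq \<pi> I (E (w j)))"
    by (intro sum_mono Bessel v)
  also have "\<dots> \<le> c" by (rule bound[OF s])
  finally show ?thesis .
qed

text \<open>The traces of \<open>C\<^sup>* C\<close> and \<open>C C\<^sup>*\<close> agree: with
  complete systems on both sides, completeness being stated as Parseval's identity, the Bessel step
  becomes an equality.\<close>

lemma sum_nsq_adjoint_eq: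
  fixes C :: "('b \<Rightarrow> complex) \<Rightarrow> 'd \<Rightarrow> complex"
  assumes adj: "\<And>w v. ip \<pi>' I' w (C v) = ip \<pi> I (E w) v"
    and v: "\<And>f. nsq \<pi> I f = (\<Sum>i<r. (cmod (ip \<pi> I (v i) f))\<^sup>2)"
    and w: "\<And>f. nsq \<pi>' I' f = (\<Sum>j<s. (cmod (ip \<pi>' I' (w j) f))\<^sup>2)"
  shows "(\<Sum>i<r. nsq \<pi>' I' (C (v i))) = (\<Sum>j<s. nsq \<pi> I (E (w j)))"
proof -
  have "(\<Sum>i<r. nsq \<pi>' I' (C (v i))) = (\<Sum>i<r. \<Sum>j<s. (cmod (ip \<pi> I (v i) (E (w j))))\<^sup>2)"
    by (simp add: w adj cmod_ip_commute[of \<pi> I "E _"])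
  also have "\<dots> = (\<Sum>j<s. \<Sum>i<r. (cmod (ip \<pi> I (v i) (E (w j))))\<^sup>2)"
    by (rule sum.swap)
  finally show ?thesis by (simp add: v)
qed

lemma unit_delta:
  fixes d :: nat
  assumes "x < d"
  shows "nsq id {..<d} (\<lambda>y. if y = x then 1 else 0) = 1"
    and "ip id {..<d} w (\<lambda>y. if y = x then 1 else 0) = cnj (w x)"
proof -
  have "(\<Sum>y<d. (cmod (if y = x then 1 else 0))\<^sup>2) = (\<Sum>y<d. if y = x then 1 else (0::real))"
    by (rule sum.cong) auto
  then show "nsq id {..<d} (\<lambda>y. if y = x then 1 else 0) = 1" using assms by (simp add: nsq_def sum.delta)
  show "ip id {..<d} w (\<lambda>y. if y = x then 1 else 0) = cnj (w x)"
    using assms by (simp add: ip_def if_distrib[of "\<lambda>z. _ * z"] cong: if_cong)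
qed

text \<open>Extend by the d coordinate vectors. Their Parseval identities sum to d when counted by
  coordinates and to the length of the system when counted by members, so the extended system has
  exactly d members; expanding the coordinate vectors then expands every f.\<close>

lemma orthonormal_basis_extend:
  assumes "orthonormal id {..<d} s w"
  shows "\<exists>w'. (\<forall>i<s. w' i = w i) \<and> orthonormal id {..<d} d w' \<and> s \<le> d \<and>
           (\<forall>f. \<forall>x<d. f x = (\<Sum>j<d. ip id {..<d} (w' j) f * w' j x))"
proof -
  define \<delta> :: "nat \<Rightarrow> nat \<Rightarrow> complex" where "\<delta> = (\<lambda>x y. if y = x then 1 else 0)"
  from orthonormal_extend[OF assms, of d \<delta>]
  obtain t w' where t: "s \<le> t" "\<forall>i<s. w' i = w i" "orthonormal id {..<d} t w'"
    and pars: "\<And>i. i < d \<Longrightarrow> nsq id {..<d} (\<delta> i) = (\<Sum>j<t. (cmod (ip id {..<d} (w' j) (\<delta> i)))\<^sup>2)"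
    by blast
  have "real d = (\<Sum>x<d. \<Sum>j<t. (cmod (w' j x))\<^sup>2)"
    using pars by (simp add: \<delta>_def unit_delta)
  also have "\<dots> = (\<Sum>j<t. nsq id {..<d} (w' j))"
    by (subst sum.swap) (simp add: nsq_def)
  also have "\<dots> = (\<Sum>j<t. 1)"
    by (rule sum.cong) (use orthonormal_nsq[OF t(3)] in simp_all)
  finally have td: "t = d" by simp
  have expand: "f x = (\<Sum>j<d. ip id {..<d} (w' j) f * w' j x)" if "x < d" for f x
  proof -
    have dx: "\<delta> y x = (\<Sum>j<d. cnj (w' j y) * w' j x)" if "y < d" for y
      using orthonormal_complete[OF t(3) _ pars[OF that], of x] \<open>x < d\<close> that
      by (simp add: td \<delta>_def unit_delta)
    have "f x = (\<Sum>y<d. f y * \<delta> y x)"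
      using that by (simp add: \<delta>_def if_distrib[of "\<lambda>z. _ * z"] cong: if_cong)
    also have "\<dots> = (\<Sum>y<d. f y * (\<Sum>j<d. cnj (w' j y) * w' j x))"
      using dx by simp
    also have "\<dots> = (\<Sum>j<d. ip id {..<d} (w' j) f * w' j x)"
      unfolding ip_def sum_distrib_left sum_distrib_right
      by (subst sum.swap) (simp add: algebra_simps)
    finally show ?thesis .
  qed
  show ?thesis using t expand td by (intro exI[of _ w']) auto
qed

section \<open>Symmetric tensors as functions of multisets\<close>

text \<open>A symmetric tensor in \<open>(\<complex>\<^sup>N)\<^sup>\<otimes>\<^sup>n\<close> is represented by a function of the multiset of its \<open>n\<close> indices.
  Its inner product still runs over all words, so that \<open>ip mset (words N n)\<close> is the tensor inner
  product; functions are unconstrained on multisets of other sizes.\<close>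

definition words :: "nat \<Rightarrow> nat \<Rightarrow> nat list set" where
  "words N n = {xs. set xs \<subseteq> {..<N} \<and> length xs = n}"

lemma finite_words [simp]: "finite (words N n)"
  by (simp add: words_def finite_lists_length_eq)

lemma card_words: "card (words N n) = N ^ n"
  by (simp add: words_def card_lists_length_eq)

lemma words_0 [simp]: "words N 0 = {[]}"
  by (auto simp: words_def)

lemma words_size: "xs \<in> words N n \<Longrightarrow> size (mset xs) = n"
  by (simp add: words_def)

lemma sum_words_Suc:
  "(\<Sum>xs\<in>words N (Suc n). F xs) = (\<Sum>x<N. \<Sum>xs\<in>words N n. F (x # xs))"
proof -
  have "words N (Suc n) = (\<lambda>(x, xs). x # xs) ` ({..<N} \<times> words N n)"
    by (auto simp: words_def length_Suc_conv)
  moreover have "inj_on (\<lambda>(x, xs). x # xs) ({..<N} \<times> words N n)"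
    by (auto simp: inj_on_def)
  ultimately show ?thesis
    by (simp add: sum.reindex sum.cartesian_product case_prod_unfold)
qed

lemma sum_words_add:
  "(\<Sum>xs\<in>words N (m + n). F xs) = (\<Sum>a\<in>words N m. \<Sum>b\<in>words N n. F (a @ b))"
  by (induction m arbitrary: F) (simp_all add: sum_words_Suc)

text \<open>The sum of \<open>H A B\<close> over all ways of distributing the positions of a word with multiset \<open>X\<close>
  over two subwords with multisets \<open>A\<close> and \<open>B\<close>.\<close>

definition splits :: "'a multiset \<Rightarrow> ('a multiset \<Rightarrow> 'a multiset \<Rightarrow> complex) \<Rightarrow> complex" where
  "splits X = fold_mset (\<lambda>x F H. F (\<lambda>A B. H (add_mset x A) B) + F (\<lambda>A B. H A (add_mset x B)))
     (\<lambda>H. H {#} {#}) X"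

lemma splits_empty [simp]: "splits {#} H = H {#} {#}"
  by (simp add: splits_def)

lemma splits_add_mset [simp]:
  "splits (add_mset x X) H =
     splits X (\<lambda>A B. H (add_mset x A) B) + splits X (\<lambda>A B. H A (add_mset x B))"
proof -
  interpret comp_fun_commute "\<lambda>x F (H :: 'a multiset \<Rightarrow> 'a multiset \<Rightarrow> complex).
      F (\<lambda>A B. H (add_mset x A) B) + F (\<lambda>A B. H A (add_mset x B)) :: complex"
    by standard (auto simp: fun_eq_iff add_mset_commute algebra_simps)
  show ?thesis by (simp add: splits_def)
qed

text \<open>Every term of the sum has A + B = X, so a factor that depends on A + B alone is
  constant. Read backwards, this moves a function of the whole word under the sum, where it can be
  compared with a second distribution of the same positions.\<close>

lemma splits_mult: "splits X (\<lambda>A B. c (A + B) * H A B) = c X * splits X H"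
proof (induction X arbitrary: c H)
  case (add x X)
  show ?case
    using add[of "\<lambda>Y. c (add_mset x Y)" "\<lambda>A B. H (add_mset x A) B"]
      add[of "\<lambda>Y. c (add_mset x Y)" "\<lambda>A B. H A (add_mset x B)"]
    by (simp add: algebra_simps)
qed simp

lemma cnj_splits: "cnj (splits X H) = splits X (\<lambda>A B. cnj (H A B))"
  by (induction X arbitrary: H) simp_all

lemma splits_sum: "(\<Sum>i\<in>I. splits X (H i)) = splits X (\<lambda>A B. \<Sum>i\<in>I. H i A B)"
  by (induction X arbitrary: H) (simp_all add: sum.distrib)

lemma splits_union:
  "splits (X + Y) H = splits X (\<lambda>A1 B1. splits Y (\<lambda>A2 B2. H (A1 + A2) (B1 + B2)))"
  by (induction X arbitrary: H) simp_all

text \<open>A word together with p of its positions amounts to the set of positions and two free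
  subwords, hence the binomial coefficient. The induction peels off the first letter and recombines
  by Pascal's rule.\<close>

lemma sum_splits:
  "(\<Sum>xs\<in>words N n. splits (mset xs) H) =
     (\<Sum>p\<le>n. of_nat (n choose p) * (\<Sum>a\<in>words N p. \<Sum>b\<in>words N (n - p). H (mset a) (mset b)))"
proof (induction n arbitrary: H)
  case 0
  then show ?case by simp
next
  case (Suc n)
  define T where "T p q = (\<Sum>a\<in>words N p. \<Sum>b\<in>words N q. H (mset a) (mset b))" for p q
  have T1: "(\<Sum>x<N. \<Sum>a\<in>words N p. \<Sum>b\<in>words N q. H (add_mset x (mset a)) (mset b)) = T (Suc p) q" for p q
    by (simp add: T_def sum_words_Suc)
  have T2: "(\<Sum>x<N. \<Sum>a\<in>words N p. \<Sum>b\<in>words N q. H (mset a) (add_mset x (mset b))) = T p (Suc q)" for p q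
    by (simp add: T_def sum_words_Suc sum.swap[of _ _ "{..<N}"])
  have "(\<Sum>xs\<in>words N (Suc n). splits (mset xs) H) =
      (\<Sum>x<N. \<Sum>p\<le>n. of_nat (n choose p) * (\<Sum>a\<in>words N p. \<Sum>b\<in>words N (n - p). H (add_mset x (mset a)) (mset b)))
    + (\<Sum>x<N. \<Sum>p\<le>n. of_nat (n choose p) * (\<Sum>a\<in>words N p. \<Sum>b\<in>words N (n - p). H (mset a) (add_mset x (mset b))))"
    by (simp add: sum_words_Suc sum.distrib Suc.IH)
  also have "\<dots> = (\<Sum>p\<le>n. of_nat (n choose p) * T (Suc p) (n - p)) + (\<Sum>p\<le>n. of_nat (n choose p) * T p (Suc (n - p)))"
    by (simp add: sum.swap[of _ _ "{..<N}"] T1[symmetric] T2[symmetric] sum_distrib_left)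
  also have "(\<Sum>p\<le>n. of_nat (n choose p) * T p (Suc (n - p))) = (\<Sum>p\<le>Suc n. of_nat (n choose p) * T p (Suc n - p))"
    by (simp add: Suc_diff_le)
  also have "\<dots> = T 0 (Suc n) + (\<Sum>p\<le>n. of_nat (n choose Suc p) * T (Suc p) (n - p))"
    by (subst sum.atMost_Suc_shift) simp
  also have "(\<Sum>p\<le>n. of_nat (n choose p) * T (Suc p) (n - p)) + \<dots> =
      T 0 (Suc n) + (\<Sum>p\<le>n. of_nat (Suc n choose Suc p) * T (Suc p) (n - p))"
    by (simp add: algebra_simps sum.distrib)
  also have "\<dots> = (\<Sum>p\<le>Suc n. of_nat (Suc n choose p) * T p (Suc n - p))"
    by (subst sum.atMost_Suc_shift) simp
  finally show ?case by (simp only: T_def)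
qed

lemma sum_splits_size:
  "(\<Sum>xs\<in>words N n. splits (mset xs) (\<lambda>A B. if size A = M then H A B else 0)) =
     of_nat (n choose M) * (\<Sum>a\<in>words N M. \<Sum>b\<in>words N (n - M). H (mset a) (mset b))"
proof -
  have "(\<Sum>a\<in>words N p. \<Sum>b\<in>words N q. if size (mset a) = M then H (mset a) (mset b) else 0)
     = (if p = M then \<Sum>a\<in>words N M. \<Sum>b\<in>words N q. H (mset a) (mset b) else 0)" for p q
    by (auto simp: words_size simp del: size_mset intro!: sum.neutral sum.cong)
  then show ?thesis
    by (simp add: sum_splits if_distrib[of "\<lambda>z. _ * z"] del: size_mset cong: if_cong)
qed

text \<open>This is \<open>(M + k) choose M\<close> times the symmetrization of f \<otimes> g on M +
  k factors: it sums over the positions given to f where the symmetrizer averages. Without the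
  normalization, normal ordering has integer coefficients.\<close>

definition sprod :: "nat \<Rightarrow> ('a multiset \<Rightarrow> complex) \<Rightarrow> ('a multiset \<Rightarrow> complex) \<Rightarrow> 'a multiset \<Rightarrow> complex" where
  "sprod M f g X = splits X (\<lambda>A B. if size A = M then f A * g B else 0)"

text \<open>The operator C of the overview: the annihilation of m particles in the state f, up to
  normalization.\<close>

definition contract :: "nat \<Rightarrow> nat \<Rightarrow> (nat multiset \<Rightarrow> complex) \<Rightarrow> (nat multiset \<Rightarrow> complex) \<Rightarrow> nat multiset \<Rightarrow> complex" where
  "contract N m f v B = (\<Sum>a\<in>words N m. cnj (f (mset a)) * v (mset a + B))"

lemma ip_sprod:
  "ip mset (words N (M + k)) (sprod M f g) v =
     of_nat ((M + k) choose M) * (\<Sum>a\<in>words N M. \<Sum>b\<in>words N k. cnj (f (mset a)) * cnj (g (mset b)) * v (mset a + mset b))"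
proof -
  have "ip mset (words N (M + k)) (sprod M f g) v =
     (\<Sum>xs\<in>words N (M + k). splits (mset xs) (\<lambda>A B. v (A + B) * (if size A = M then cnj (f A) * cnj (g B) else 0)))"
    by (simp add: ip_def sprod_def cnj_splits splits_mult[of _ v] mult.commute if_distrib[of cnj] cong: if_cong)
  also have "\<dots> = (\<Sum>xs\<in>words N (M + k). splits (mset xs) (\<lambda>A B. if size A = M then cnj (f A) * cnj (g B) * v (A + B) else 0))"
    by (simp add: if_distrib[of "\<lambda>z. _ * z"] mult_ac cong: if_cong)
  also have "\<dots> = of_nat ((M + k) choose M) * (\<Sum>a\<in>words N M. \<Sum>b\<in>words N k. cnj (f (mset a)) * cnj (g (mset b)) * v (mset a + mset b))"
    by (subst sum_splits_size) simp
  finally show ?thesis .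
qed

lemma ip_contract_adjoint:
  "ip mset (words N k) w (contract N M f v) =
     ip mset (words N (M + k)) (\<lambda>X. of_real (1 / real ((M + k) choose M)) * sprod M f w X) v"
proof -
  have "(M + k) choose M \<noteq> 0" by simp
  then have "ip mset (words N (M + k)) (\<lambda>X. of_real (1 / real ((M + k) choose M)) * sprod M f w X) v =
      (\<Sum>a\<in>words N M. \<Sum>b\<in>words N k. cnj (f (mset a)) * cnj (w (mset b)) * v (mset a + mset b))"
    unfolding ip_scale_left ip_sprod by simp
  also have "\<dots> = ip mset (words N k) w (contract N M f v)"
    unfolding ip_def contract_def sum_distrib_left
    by (subst sum.swap) (simp add: algebra_simps)
  finally show ?thesis ..
qed

text \<open>Normal ordering: comparing two distributions of the same positions, \<open>p\<close> of the factors of \<open>f\<close> meet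
  factors of \<open>f\<close> and the other \<open>M - p\<close> meet factors of \<open>g\<close>.\<close>

lemma nsq_sprod:
  "nsq mset (words N (M + k)) (sprod M f g) = real ((M + k) choose M) *
     (\<Sum>p\<le>M. real (M choose p) * real (k choose (M - p)) *
        (\<Sum>a\<in>words N p. nsq mset (words N (k - (M - p))) (contract N (M - p) (\<lambda>A. f (mset a + A)) g)))"
proof -
  define H where "H = (\<lambda>A B. if size A = M then f A * g B else 0)"
  \<comment> \<open>In the left factor the block read by f is cut into A1, B1 and the block read by
    g into A2, B2. The right factor regroups the same positions: f reads A1 and A2, g reads B1 and
    B2.\<close>
  define K where "K A1 B1 A2 B2 = cnj (f (A1 + B1)) * (cnj (g (A2 + B2)) * H (A1 + A2) (B1 + B2))" for A1 B1 A2 B2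
  have split: "cnj (f X) * cnj (g Y) * splits (X + Y) H = splits X (\<lambda>A1 B1. splits Y (\<lambda>A2 B2. K A1 B1 A2 B2))" for X Y
  proof -
    have "splits X (\<lambda>A1 B1. splits Y (\<lambda>A2 B2. K A1 B1 A2 B2)) =
        splits X (\<lambda>A1 B1. cnj (f (A1 + B1)) * splits Y (\<lambda>A2 B2. cnj (g (A2 + B2)) * H (A1 + A2) (B1 + B2)))"
      unfolding K_def splits_mult[of Y "\<lambda>_. cnj (f _)"] ..
    also have "\<dots> = cnj (f X) * splits X (\<lambda>A1 B1. splits Y (\<lambda>A2 B2. cnj (g (A2 + B2)) * H (A1 + A2) (B1 + B2)))"
      by (rule splits_mult)
    also have "\<dots> = cnj (f X) * splits X (\<lambda>A1 B1. cnj (g Y) * splits Y (\<lambda>A2 B2. H (A1 + A2) (B1 + B2)))"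
      by (simp only: splits_mult[of Y "\<lambda>X. cnj (g X)"])
    also have "\<dots> = cnj (f X) * (cnj (g Y) * splits X (\<lambda>A1 B1. splits Y (\<lambda>A2 B2. H (A1 + A2) (B1 + B2))))"
      by (simp only: splits_mult[of X "\<lambda>_. cnj (g Y)"])
    finally show ?thesis by (simp add: splits_union mult.assoc)
  qed
  have inner: "(\<Sum>a2\<in>words N (M - p). \<Sum>r\<le>k. of_nat (k choose r) *
        (\<Sum>b1\<in>words N r. \<Sum>b2\<in>words N (k - r). K (mset a1) (mset a2) (mset b1) (mset b2)))
      = of_nat (k choose (M - p)) * of_real (nsq mset (words N (k - (M - p))) (contract N (M - p) (\<lambda>A. f (mset a1 + A)) g))"
    if p: "p \<le> M" and a1: "a1 \<in> words N p" for p a1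
  proof -
    define m where "m = M - p"
    \<comment> \<open>The f of the right factor reads p + r letters, so the size test in H leaves
      only r = M - p.\<close>
    have K0: "K (mset a1) A2 (mset b1) B2 = (if r = m then cnj (f (mset a1 + A2)) * cnj (g (mset b1 + B2)) * f (mset a1 + mset b1) * g (A2 + B2) else 0)"
      if "b1 \<in> words N r" for A2 B2 b1 r
      using p words_size[OF a1] words_size[OF that] by (auto simp: K_def H_def m_def)
    define Z where "Z r a2 = (\<Sum>b1\<in>words N r. \<Sum>b2\<in>words N (k - r).
        cnj (f (mset a1 + mset a2)) * cnj (g (mset b1 + mset b2)) * f (mset a1 + mset b1) * g (mset a2 + mset b2))" for r a2
    have "(\<Sum>a2\<in>words N m. \<Sum>r\<le>k. of_nat (k choose r) *
        (\<Sum>b1\<in>words N r. \<Sum>b2\<in>words N (k - r). K (mset a1) (mset a2) (mset b1) (mset b2)))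
       = (\<Sum>a2\<in>words N m. \<Sum>r\<le>k. if r = m then of_nat (k choose r) * Z r a2 else 0)"
      by (intro sum.cong refl) (auto simp: K0 Z_def)
    \<comment> \<open>If m > k, no r survives, in agreement with k choose m = 0.\<close>
    also have "\<dots> = (\<Sum>a2\<in>words N m. of_nat (k choose m) * Z m a2)"
      by (rule sum.cong) (auto simp: sum.delta)
    also have "\<dots> = of_nat (k choose m) * (\<Sum>a2\<in>words N m. Z m a2)"
      by (simp add: sum_distrib_left)
    also have "(\<Sum>a2\<in>words N m. Z m a2) = ip mset (words N (k - m)) (contract N m (\<lambda>A. f (mset a1 + A)) g) (contract N m (\<lambda>A. f (mset a1 + A)) g)"
    proof -
      have "ip mset (words N (k - m)) (contract N m (\<lambda>A. f (mset a1 + A)) g) (contract N m (\<lambda>A. f (mset a1 + A)) g)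
         = (\<Sum>b2\<in>words N (k - m). \<Sum>b1\<in>words N m. \<Sum>a2\<in>words N m.
             cnj (f (mset a1 + mset a2)) * cnj (g (mset b1 + mset b2)) * f (mset a1 + mset b1) * g (mset a2 + mset b2))"
        unfolding ip_def contract_def cnj_sum sum_product by (simp add: mult_ac)
      also have "\<dots> = (\<Sum>b2\<in>words N (k - m). \<Sum>a2\<in>words N m. \<Sum>b1\<in>words N m.
             cnj (f (mset a1 + mset a2)) * cnj (g (mset b1 + mset b2)) * f (mset a1 + mset b1) * g (mset a2 + mset b2))"
        by (intro sum.cong refl sum.swap)
      also have "\<dots> = (\<Sum>a2\<in>words N m. \<Sum>b2\<in>words N (k - m). \<Sum>b1\<in>words N m.
             cnj (f (mset a1 + mset a2)) * cnj (g (mset b1 + mset b2)) * f (mset a1 + mset b1) * g (mset a2 + mset b2))"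
        by (rule sum.swap)
      also have "\<dots> = (\<Sum>a2\<in>words N m. Z m a2)"
        unfolding Z_def by (intro sum.cong refl sum.swap)
      finally show ?thesis ..
    qed
    finally show ?thesis by (simp add: m_def ip_self)
  qed
  have "of_real (nsq mset (words N (M + k)) (sprod M f g)) = ip mset (words N (M + k)) (sprod M f g) (sprod M f g)"
    by (simp add: ip_self)
  also have "\<dots> = of_nat ((M + k) choose M) * (\<Sum>a\<in>words N M. \<Sum>b\<in>words N k. splits (mset a) (\<lambda>A1 B1. splits (mset b) (\<lambda>A2 B2. K A1 B1 A2 B2)))"
    unfolding ip_sprod split[symmetric] by (simp add: sprod_def H_def)
  also have "(\<Sum>a\<in>words N M. \<Sum>b\<in>words N k. splits (mset a) (\<lambda>A1 B1. splits (mset b) (\<lambda>A2 B2. K A1 B1 A2 B2)))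
     = (\<Sum>a\<in>words N M. splits (mset a) (\<lambda>A1 B1. \<Sum>r\<le>k. of_nat (k choose r) *
          (\<Sum>b1\<in>words N r. \<Sum>b2\<in>words N (k - r). K A1 B1 (mset b1) (mset b2))))"
    by (simp only: splits_sum sum_splits)
  also have "\<dots> = (\<Sum>p\<le>M. of_nat (M choose p) * (\<Sum>a1\<in>words N p. \<Sum>a2\<in>words N (M - p). \<Sum>r\<le>k. of_nat (k choose r) *
          (\<Sum>b1\<in>words N r. \<Sum>b2\<in>words N (k - r). K (mset a1) (mset a2) (mset b1) (mset b2))))"
    by (rule sum_splits)
  also have "\<dots> = (\<Sum>p\<le>M. of_nat (M choose p) * (\<Sum>a1\<in>words N p.
      of_nat (k choose (M - p)) * of_real (nsq mset (words N (k - (M - p))) (contract N (M - p) (\<lambda>A. f (mset a1 + A)) g))))"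
    by (intro sum.cong refl arg_cong2[where f = "(*)"]) (simp only: inner atMost_iff)
  also have "of_nat ((M + k) choose M) * \<dots> = of_real (real ((M + k) choose M) *
     (\<Sum>p\<le>M. real (M choose p) * real (k choose (M - p)) *
        (\<Sum>a\<in>words N p. nsq mset (words N (k - (M - p))) (contract N (M - p) (\<lambda>A. f (mset a + A)) g))))"
    by (simp add: sum_distrib_left mult.assoc)
  finally show ?thesis using of_real_eq_iff by blast
qed

text \<open>Tracing out p particles preserves the trace; the slices are the rank one terms of the
  reduced density matrix of the other M - p.\<close>

lemma sum_nsq_slice:
  assumes "p \<le> M"
  shows "(\<Sum>a\<in>words N p. nsq mset (words N (M - p)) (\<lambda>A. f (mset a + A))) = nsq mset (words N M) f"
  using sum_words_add[of "\<lambda>xs. (cmod (f (mset xs)))\<^sup>2" N p "M - p"] assms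
  by (simp add: nsq_def)

section \<open>The Ky Fan bound on symmetric subspaces\<close>

definition msets :: "nat \<Rightarrow> nat \<Rightarrow> nat multiset set" where
  "msets N n = mset ` words N n"

definition sdim :: "nat \<Rightarrow> nat \<Rightarrow> nat" where
  "sdim N n = card (msets N n)"

abbreviation arr :: "'a multiset \<Rightarrow> nat" where
  "arr X \<equiv> card (permutations_of_multiset X)"

lemma finite_msets [simp]: "finite (msets N n)"
  by (simp add: msets_def)

lemma in_msets_iff: "X \<in> msets N n \<longleftrightarrow> set_mset X \<subseteq> {..<N} \<and> size X = n"
proof
  assume X: "set_mset X \<subseteq> {..<N} \<and> size X = n"
  obtain xs where "mset xs = X" using ex_mset by blast
  then show "X \<in> msets N n" using X by (auto simp: msets_def words_def)
qed (auto simp: msets_def words_def)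

lemma arr_pos: "0 < arr X"
  by (simp add: card_gt_0_iff)

lemma sum_words_mset:
  fixes F :: "nat multiset \<Rightarrow> 'a::{comm_semiring_1}"
  shows "(\<Sum>xs\<in>words N n. F (mset xs)) = (\<Sum>X\<in>msets N n. of_nat (arr X) * F X)"
proof -
  have "{xs \<in> words N n. mset xs = X} = permutations_of_multiset X" if "X \<in> msets N n" for X
    using that by (auto simp: permutations_of_multiset_def msets_def words_def
        dest: mset_eq_setD mset_eq_length)
  then have "(\<Sum>xs\<in>{xs \<in> words N n. mset xs = X}. F (mset xs)) = of_nat (arr X) * F X"
    if "X \<in> msets N n" for X
    using that by (simp add: permutations_of_multiset_def)
  then show ?thesis
    by (subst sum.image_gen[OF finite_words, of _ _ _ mset]) (simp add: msets_def)
qed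

lemma sdim_mono:
  assumes "1 \<le> N" "i \<le> j"
  shows "sdim N i \<le> sdim N j"
proof -
  have "(\<lambda>X. X + replicate_mset (j - i) 0) ` msets N i \<subseteq> msets N j"
    using assms by (auto simp: in_msets_iff split: if_splits)
  moreover have "inj_on (\<lambda>X. X + replicate_mset (j - i) (0::nat)) (msets N i)"
    by (auto simp: inj_on_def)
  ultimately show ?thesis
    unfolding sdim_def by (metis card_image card_mono finite_msets)
qed

text \<open>The number of tensor factors different from the distinguished one in the \<open>j\<close>-th
  occupation number state, when these states are listed by increasing such number. It does not
  depend on the total number of factors, which makes the eigenvalues of all the coherent
  operators on one symmetric subspace simultaneously sorted.\<close>

definition lev :: "nat \<Rightarrow> nat \<Rightarrow> nat" where
  "lev N j = (LEAST n. j < sdim N n)"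

lemma lev_le: "j < sdim N n \<Longrightarrow> lev N j \<le> n"
  unfolding lev_def by (rule Least_le)

text \<open>The bound j < sdim N n makes the least number in \<open>lev\<close> exist. For N = 1
  every dimension is 1, and \<open>lev N j\<close> is meaningful only for j = 0.\<close>

lemma lev_gt:
  assumes "1 \<le> N" "j < sdim N n" "sdim N k \<le> j"
  shows "k < lev N j"
proof (rule ccontr)
  assume "\<not> k < lev N j"
  then have "sdim N (lev N j) \<le> sdim N k" using sdim_mono assms(1) by simp
  moreover have "j < sdim N (lev N j)" unfolding lev_def using assms(2) by (rule LeastI)
  ultimately show False using assms(3) by simp
qed

text \<open>Removing n - i zeros from a multiset that has them leaves an arbitrary multiset of size
  i. The count does not involve n, which is why \<open>lev\<close> does not either.\<close>

lemma card_msets_level: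
  assumes "1 \<le> N" "i \<le> n"
  shows "card {X \<in> msets N n. n - count X 0 \<le> i} = sdim N i"
proof -
  have "{X \<in> msets N n. n - count X 0 \<le> i} = (\<lambda>X. X + replicate_mset (n - i) 0) ` msets N i"
  proof (intro equalityI subsetI)
    fix X assume "X \<in> {X \<in> msets N n. n - count X 0 \<le> i}"
    then have X: "X \<in> msets N n" "n - i \<le> count X 0" by auto
    then have "X = (X - replicate_mset (n - i) 0) + replicate_mset (n - i) 0"
      by (simp add: count_le_replicate_mset_subset_eq subset_mset.diff_add)
    moreover have "X - replicate_mset (n - i) 0 \<in> msets N i"
      using X assms by (auto simp: in_msets_iff count_le_replicate_mset_subset_eq size_Diff_submset dest: in_diffD)
    ultimately show "X \<in> (\<lambda>X. X + replicate_mset (n - i) 0) ` msets N i" by blast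
  qed (use assms in \<open>auto simp: in_msets_iff split: if_splits\<close>)
  moreover have "inj_on (\<lambda>X. X + replicate_mset (n - i) (0::nat)) (msets N i)"
    by (auto simp: inj_on_def)
  ultimately show ?thesis by (simp add: card_image sdim_def)
qed

lemma down_closed_eq_lessThan:
  fixes A :: "nat set"
  assumes "finite A" "\<And>i j. j \<in> A \<Longrightarrow> i \<le> j \<Longrightarrow> i \<in> A"
  shows "j \<in> A \<longleftrightarrow> j < card A"
proof
  assume "j \<in> A"
  then have "{..j} \<subseteq> A" using assms(2) by blast
  then have "card {..j} \<le> card A" by (rule card_mono[OF assms(1)])
  then show "j < card A" by simp
next
  assume "j < card A"
  show "j \<in> A"
  proof (rule ccontr)
    assume "j \<notin> A"
    then have "A \<subseteq> {..<j}" using assms(2)[of _ j] by (auto simp: not_less[symmetric])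
    then show False using card_mono[of "{..<j}" A] \<open>j < card A\<close> by simp
  qed
qed

text \<open>Sort the multisets by their number of nonzero letters. Since \<open>sdim N i\<close> of
  them have at most i such letters, the j-th one does iff j < sdim N i, and the least such i is
  \<open>lev N j\<close>.\<close>

lemma ex_level_enum:
  assumes "1 \<le> N"
  shows "\<exists>\<beta>. bij_betw \<beta> {..<sdim N n} (msets N n) \<and> (\<forall>j<sdim N n. n - count (\<beta> j) 0 = lev N j)"
proof -
  define key where "key X = n - count X (0::nat)" for X
  obtain xs where xs: "set xs = msets N n" "distinct xs"
    using finite_distinct_list[OF finite_msets] by blast
  define ys where "ys = sort_key key xs"
  have ys: "set ys = msets N n" "distinct ys" "sorted (map key ys)"
    by (simp_all add: ys_def xs)
  have len: "length ys = sdim N n"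
    using distinct_card[OF ys(2)] ys(1) by (simp add: sdim_def)
  have bij: "bij_betw ((!) ys) {..<sdim N n} (msets N n)"
    using bij_betw_nth[OF ys(2)] len ys(1) by simp
  have iff: "key (ys ! j) \<le> i \<longleftrightarrow> j < sdim N i" if j: "j < sdim N n" and i: "i \<le> n" for i j
  proof -
    define A where "A = {j \<in> {..<sdim N n}. key (ys ! j) \<le> i}"
    have "bij_betw ((!) ys) A {X \<in> msets N n. key X \<le> i}"
      unfolding A_def using bij by (rule bij_betw_Collect) simp
    then have "card A = sdim N i"
      using card_msets_level[OF assms i] bij_betw_same_card by (simp add: key_def) fastforce
    moreover have "i' \<in> A" if "j' \<in> A" "i' \<le> j'" for i' j'
      using sorted_nth_mono[OF ys(3), of i' j'] that len by (auto simp: A_def)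
    ultimately show ?thesis
      using down_closed_eq_lessThan[of A j] j by (simp add: A_def)
  qed
  have "lev N j = key (ys ! j)" if j: "j < sdim N n" for j
    unfolding lev_def
  proof (rule Least_equality)
    show "j < sdim N (key (ys ! j))" using iff[OF j, of "key (ys ! j)"] by (simp add: key_def)
  next
    fix i assume "j < sdim N i"
    then show "key (ys ! j) \<le> i" using iff[OF j, of i] by (cases "i \<le> n") (auto simp: key_def)
  qed
  then show ?thesis using bij by (intro exI[of _ "(!) ys"]) (auto simp: key_def)
qed

definition level_enum :: "nat \<Rightarrow> nat \<Rightarrow> nat \<Rightarrow> nat multiset" where
  "level_enum N n = (SOME \<beta>. bij_betw \<beta> {..<sdim N n} (msets N n) \<and> (\<forall>j<sdim N n. n - count (\<beta> j) 0 = lev N j))"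

lemma level_enum:
  assumes "1 \<le> N"
  shows "bij_betw (level_enum N n) {..<sdim N n} (msets N n)"
    and "j < sdim N n \<Longrightarrow> count (level_enum N n j) 0 = n - lev N j"
proof -
  have *: "bij_betw (level_enum N n) {..<sdim N n} (msets N n) \<and>
    (\<forall>j<sdim N n. n - count (level_enum N n j) 0 = lev N j)"
    unfolding level_enum_def by (rule someI_ex[OF ex_level_enum[OF assms]])
  then show "bij_betw (level_enum N n) {..<sdim N n} (msets N n)" by simp
  assume j: "j < sdim N n"
  then have "level_enum N n j \<in> msets N n" using * bij_betwE by fastforce
  then have "count (level_enum N n j) 0 \<le> n"
    by (metis count_le_size in_msets_iff)
  then show "count (level_enum N n j) 0 = n - lev N j" using * j by fastforce
qed

text \<open>The j-th occupation number state. It is constant on the \<open>arr\<close> many words of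
  its multiset, hence the square root in the normalization.\<close>

definition occ :: "nat \<Rightarrow> nat \<Rightarrow> nat \<Rightarrow> nat multiset \<Rightarrow> complex" where
  "occ N n j X = (if X = level_enum N n j then of_real (1 / sqrt (real (arr X))) else 0)"

lemma ip_occ:
  assumes "1 \<le> N" "j < sdim N n"
  shows "ip mset (words N n) (occ N n j) f =
    of_real (sqrt (real (arr (level_enum N n j)))) * f (level_enum N n j)"
proof -
  let ?X = "level_enum N n j"
  have X: "?X \<in> msets N n" using level_enum(1)[OF assms(1)] assms(2) bij_betwE by fastforce
  have "ip mset (words N n) (occ N n j) f = (\<Sum>X\<in>msets N n. of_nat (arr X) * (cnj (occ N n j X) * f X))"
    unfolding ip_def by (rule sum_words_mset)
  also have "\<dots> = (\<Sum>X\<in>msets N n. if X = ?X then of_nat (arr ?X) * (of_real (1 / sqrt (real (arr ?X))) * f ?X) else 0)"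
    by (rule sum.cong) (auto simp: occ_def)
  also have "\<dots> = of_nat (arr ?X) * (of_real (1 / sqrt (real (arr ?X))) * f ?X)"
    using X by simp
  also have "\<dots> = of_real (real (arr ?X) / sqrt (real (arr ?X))) * f ?X" by simp
  also have "real (arr ?X) / sqrt (real (arr ?X)) = sqrt (real (arr ?X))"
    by (rule real_div_sqrt) simp
  finally show ?thesis .
qed

lemma occ_Parseval:
  assumes "1 \<le> N"
  shows "nsq mset (words N n) f = (\<Sum>j<sdim N n. (cmod (ip mset (words N n) (occ N n j) f))\<^sup>2)"
proof -
  have "nsq mset (words N n) f = (\<Sum>X\<in>msets N n. real (arr X) * (cmod (f X))\<^sup>2)"
    unfolding nsq_def by (rule sum_words_mset)
  also have "\<dots> = (\<Sum>j<sdim N n. real (arr (level_enum N n j)) * (cmod (f (level_enum N n j)))\<^sup>2)"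
    by (rule sum.reindex_bij_betw[symmetric, OF level_enum(1)[OF assms]])
  finally show ?thesis
    by (simp add: ip_occ[OF assms] norm_mult power_mult_distrib)
qed

lemma orthonormal_occ:
  assumes "1 \<le> N"
  shows "orthonormal mset (words N n) (sdim N n) (occ N n)"
proof -
  have "level_enum N n i = level_enum N n j \<longleftrightarrow> i = j" if "i < sdim N n" "j < sdim N n" for i j
    using level_enum(1)[OF assms] that by (auto simp: bij_betw_def inj_on_def)
  moreover have "complex_of_real (sqrt (real (arr X))) * of_real (1 / sqrt (real (arr X))) = 1" for X :: "nat multiset"
    using arr_pos[of X] by (simp flip: of_real_mult)
  ultimately show ?thesis
    by (auto simp: orthonormal_def ip_occ[OF assms] occ_def simp del: of_real_divide)
qed

text \<open>Double counting of the r unit norms: Parseval in the basis \<open>occ\<close>, then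
  Bessel for v.\<close>

lemma orthonormal_le_sdim:
  assumes "1 \<le> N" "orthonormal mset (words N n) r v"
  shows "r \<le> sdim N n"
proof -
  have "real r = (\<Sum>i<r. nsq mset (words N n) (v i))"
    by (simp add: orthonormal_nsq[OF assms(2)])
  also have "\<dots> = (\<Sum>i<r. \<Sum>j<sdim N n. (cmod (ip mset (words N n) (v i) (occ N n j)))\<^sup>2)"
    unfolding occ_Parseval[OF assms(1)] by (simp add: cmod_ip_commute)
  also have "\<dots> = (\<Sum>j<sdim N n. \<Sum>i<r. (cmod (ip mset (words N n) (v i) (occ N n j)))\<^sup>2)"
    by (rule sum.swap)
  also have "\<dots> \<le> (\<Sum>j<sdim N n. nsq mset (words N n) (occ N n j))"
    by (intro sum_mono Bessel assms)
  also have "\<dots> = real (sdim N n)"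
    by (simp add: orthonormal_nsq[OF orthonormal_occ[OF assms(1)]])
  finally show ?thesis by simp
qed

section \<open>Ky Fan sums of contractions, by induction on the number of particles\<close>

text \<open>At level h the summand is the probability that M of n particles, drawn without
  replacement, are all in the distinguished mode. For r up to \<open>sdim N n\<close> these are the
  r largest eigenvalues of \<open>C\<^sup>* C\<close> when f is a normalized coherent state.\<close>

definition kyfan :: "nat \<Rightarrow> nat \<Rightarrow> nat \<Rightarrow> nat \<Rightarrow> real" where
  "kyfan N n M r = (\<Sum>j<r. real ((n - lev N j) choose M) / real (n choose M))"

lemma kyfan_mono: "s \<le> r \<Longrightarrow> kyfan N n M s \<le> kyfan N n M r"
  unfolding kyfan_def by (rule sum_mono2) auto

text \<open>Vandermonde's identity is applied level by level to M + (k - h). The bound on s keeps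
  each level h at most k, so this truncated difference agrees with M + k - h.\<close>

lemma kyfan_rec:
  assumes "s \<le> sdim N k"
  shows "(\<Sum>p\<le>M. real (M choose p) * real (k choose (M - p)) * kyfan N k (M - p) s) =
    real ((M + k) choose M) * kyfan N (M + k) M s"
proof -
  \<comment> \<open>Where the denominator is zero the numerator is zero too, so the cancellation
    survives division by zero.\<close>
  have eq: "real (k choose m) * (real ((k - h) choose m) / real (k choose m)) = real ((k - h) choose m)" for h m
  proof (cases "k choose m = 0")
    case True
    then have "(k - h) choose m = 0" by (simp add: binomial_eq_0_iff)
    then show ?thesis by simp
  qed simp
  have "(\<Sum>p\<le>M. real (M choose p) * real (k choose (M - p)) * kyfan N k (M - p) s)
     = (\<Sum>p\<le>M. \<Sum>j<s. real (M choose p) * real ((k - lev N j) choose (M - p)))"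
    unfolding kyfan_def sum_distrib_left by (simp only: mult.assoc eq)
  also have "\<dots> = (\<Sum>j<s. \<Sum>p\<le>M. real (M choose p) * real ((k - lev N j) choose (M - p)))"
    by (rule sum.swap)
  also have "\<dots> = (\<Sum>j<s. real ((M + (k - lev N j)) choose M))"
    by (simp only: vandermonde[symmetric] of_nat_sum of_nat_mult)
  also have "\<dots> = (\<Sum>j<s. real ((M + k - lev N j) choose M))"
    using lev_le[of _ N k] assms by (intro sum.cong) auto
  also have "\<dots> = real ((M + k) choose M) * kyfan N (M + k) M s"
    by (simp add: kyfan_def sum_distrib_left)
  finally show ?thesis .
qed

lemma nsq_contract_0: "nsq mset (words N k) (contract N 0 f v) = nsq mset (words N 0) f * nsq mset (words N k) v"
  by (simp add: contract_def nsq_def norm_mult power_mult_distrib sum_distrib_left)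

lemma sum_nsq_adjoint:
  "(\<Sum>j<s. nsq mset (words N (M + k)) (\<lambda>X. of_real (1 / real ((M + k) choose M)) * sprod M f (w j) X)) =
   (\<Sum>p\<le>M. real (M choose p) * real (k choose (M - p)) * (\<Sum>a\<in>words N p. \<Sum>j<s.
      nsq mset (words N (k - (M - p))) (contract N (M - p) (\<lambda>A. f (mset a + A)) (w j)))) / real ((M + k) choose M)"
proof -
  have "real ((M + k) choose M) \<noteq> 0" by simp
  then have "(\<Sum>j<s. nsq mset (words N (M + k)) (\<lambda>X. of_real (1 / real ((M + k) choose M)) * sprod M f (w j) X))
    = (\<Sum>j<s. \<Sum>p\<le>M. real (M choose p) * real (k choose (M - p)) * (\<Sum>a\<in>words N p.
      nsq mset (words N (k - (M - p))) (contract N (M - p) (\<lambda>A. f (mset a + A)) (w j)))) / real ((M + k) choose M)"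
    by (simp only: nsq_scale nsq_sprod sum_divide_distrib[symmetric] norm_of_real)
      (simp add: power2_eq_square sum_distrib_left[symmetric] sum_divide_distrib[symmetric])
  also have "(\<Sum>j<s. \<Sum>p\<le>M. real (M choose p) * real (k choose (M - p)) * (\<Sum>a\<in>words N p.
      nsq mset (words N (k - (M - p))) (contract N (M - p) (\<lambda>A. f (mset a + A)) (w j))))
    = (\<Sum>p\<le>M. real (M choose p) * real (k choose (M - p)) * (\<Sum>j<s. \<Sum>a\<in>words N p.
      nsq mset (words N (k - (M - p))) (contract N (M - p) (\<lambda>A. f (mset a + A)) (w j))))"
    by (subst sum.swap) (simp add: sum_distrib_left)
  also have "\<dots> = (\<Sum>p\<le>M. real (M choose p) * real (k choose (M - p)) * (\<Sum>a\<in>words N p. \<Sum>j<s.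
      nsq mset (words N (k - (M - p))) (contract N (M - p) (\<lambda>A. f (mset a + A)) (w j))))"
    by (intro sum.cong refl arg_cong2[where f = "(*)"] sum.swap)
  finally show ?thesis .
qed

text \<open>f is arbitrary and not normalized because the induction hypothesis is applied to its
  slices, whose squared norms add up to that of f. The images of the v i may be dependent, so the
  system on k particles has only s \<le> r members, and \<open>kyfan_mono\<close> closes the
  gap.\<close>

lemma kyfan_upper:
  assumes "1 \<le> N" "M \<le> n" "orthonormal mset (words N n) r v"
  shows "(\<Sum>i<r. nsq mset (words N (n - M)) (contract N M f (v i))) \<le> nsq mset (words N M) f * kyfan N n M r"
  using assms(2,3)
proof (induction n arbitrary: M f r v rule: less_induct)
  case (less n)
  show ?case
  \<comment> \<open>For M = 0 there are still n particles after the contraction, so the induction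
    hypothesis is out of reach.\<close>
  proof (cases "M = 0")
    case True
    then show ?thesis
      by (simp add: nsq_contract_0 orthonormal_nsq[OF less.prems(2)] kyfan_def)
  next
    case False
    define k where "k = n - M"
    have n: "n = M + k" and kn: "k < n" using less.prems False by (auto simp: k_def)
    show ?thesis unfolding k_def[symmetric]
    proof (rule sum_nsq_adjoint_le[OF _ less.prems(2)])
      show "ip mset (words N k) w (contract N M f v) =
         ip mset (words N n) (\<lambda>X. of_real (1 / real ((M + k) choose M)) * sprod M f w X) v" for w v
        unfolding n by (rule ip_contract_adjoint)
    next
      fix s w assume s: "s \<le> r" and w: "orthonormal mset (words N k) s w"
      have sd: "s \<le> sdim N k" using orthonormal_le_sdim[OF assms(1) w] .
      have "(\<Sum>p\<le>M. real (M choose p) * real (k choose (M - p)) * (\<Sum>a\<in>words N p. \<Sum>j<s.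
              nsq mset (words N (k - (M - p))) (contract N (M - p) (\<lambda>A. f (mset a + A)) (w j))))
          \<le> (\<Sum>p\<le>M. real (M choose p) * real (k choose (M - p)) * (nsq mset (words N M) f * kyfan N k (M - p) s))"
      proof (rule sum_mono)
        fix p assume "p \<in> {..M}"
        then have p: "p \<le> M" by simp
        show "real (M choose p) * real (k choose (M - p)) * (\<Sum>a\<in>words N p. \<Sum>j<s.
              nsq mset (words N (k - (M - p))) (contract N (M - p) (\<lambda>A. f (mset a + A)) (w j)))
          \<le> real (M choose p) * real (k choose (M - p)) * (nsq mset (words N M) f * kyfan N k (M - p) s)"
        proof (cases "M - p \<le> k")
          case True
          have "(\<Sum>a\<in>words N p. \<Sum>j<s. nsq mset (words N (k - (M - p))) (contract N (M - p) (\<lambda>A. f (mset a + A)) (w j)))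
              \<le> (\<Sum>a\<in>words N p. nsq mset (words N (M - p)) (\<lambda>A. f (mset a + A)) * kyfan N k (M - p) s)"
            by (intro sum_mono less.IH kn True w)
          also have "\<dots> = nsq mset (words N M) f * kyfan N k (M - p) s"
            by (simp add: sum_distrib_right[symmetric] sum_nsq_slice p)
          finally show ?thesis by (intro mult_left_mono) auto
        next
          case False
          then show ?thesis by (simp add: binomial_eq_0)
        qed
      qed
      also have "\<dots> = nsq mset (words N M) f * (\<Sum>p\<le>M. real (M choose p) * real (k choose (M - p)) * kyfan N k (M - p) s)"
        by (simp add: sum_distrib_left mult_ac)
      also have "\<dots> = nsq mset (words N M) f * kyfan N (M + k) M s * real ((M + k) choose M)"
        by (simp add: kyfan_rec[OF sd])
      finally have "(\<Sum>j<s. nsq mset (words N n) (\<lambda>X. of_real (1 / real ((M + k) choose M)) * sprod M f (w j) X))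
          \<le> nsq mset (words N M) f * kyfan N (M + k) M s"
        unfolding n sum_nsq_adjoint by (subst pos_divide_le_eq) simp_all
      also have "\<dots> \<le> nsq mset (words N M) f * kyfan N n M r"
        unfolding n by (intro mult_left_mono kyfan_mono s) simp
      finally show "(\<Sum>j<s. nsq mset (words N n) (\<lambda>X. of_real (1 / real ((M + k) choose M)) * sprod M f (w j) X))
          \<le> nsq mset (words N M) f * kyfan N n M r" .
    qed
  qed
qed

text \<open>On M + k particles a level above k leaves fewer than M in the distinguished mode, so its
  term is zero. This matches the index ranges for k and for M + k particles in the trace
  identity.\<close>

lemma kyfan_sdim:
  assumes "1 \<le> N" "0 < M"
  shows "kyfan N (M + k) M (sdim N k) = kyfan N (M + k) M (sdim N (M + k))"
  unfolding kyfan_def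
proof (rule sum.mono_neutral_left)
  show "{..<sdim N k} \<subseteq> {..<sdim N (M + k)}" using sdim_mono[OF assms(1), of k "M + k"] by auto
  show "\<forall>j\<in>{..<sdim N (M + k)} - {..<sdim N k}. real ((M + k - lev N j) choose M) / real ((M + k) choose M) = 0"
  proof
    fix j assume "j \<in> {..<sdim N (M + k)} - {..<sdim N k}"
    then have "k < lev N j" using lev_gt[OF assms(1)] by auto
    then have "M + k - lev N j < M" using assms(2) by simp
    then show "real ((M + k - lev N j) choose M) / real ((M + k) choose M) = 0"
      by (simp add: binomial_eq_0)
  qed
qed simp

text \<open>The argument for \<open>kyfan_upper\<close> with complete systems, where each inequality
  becomes an equality. The traces in the majorization agree because the right-hand side sees f only
  through its norm.\<close>

lemma kyfan_trace:
  assumes "1 \<le> N" "M \<le> n"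
  shows "(\<Sum>i<sdim N n. nsq mset (words N (n - M)) (contract N M f (occ N n i))) =
     nsq mset (words N M) f * kyfan N n M (sdim N n)"
  using assms(2)
proof (induction n arbitrary: M f rule: less_induct)
  case (less n)
  show ?case
  proof (cases "M = 0")
    case True
    then show ?thesis
      by (simp add: nsq_contract_0 orthonormal_nsq[OF orthonormal_occ[OF assms(1)]] kyfan_def)
  next
    case False
    define k where "k = n - M"
    have n: "n = M + k" and kn: "k < n" using less.prems False by (auto simp: k_def)
    have "(\<Sum>i<sdim N n. nsq mset (words N k) (contract N M f (occ N n i))) =
       (\<Sum>j<sdim N k. nsq mset (words N n) (\<lambda>X. of_real (1 / real ((M + k) choose M)) * sprod M f (occ N k j) X))"
      by (rule sum_nsq_adjoint_eq[OF _ occ_Parseval occ_Parseval, OF _ assms(1) assms(1)])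
        (unfold n, rule ip_contract_adjoint)
    also have "\<dots> = (\<Sum>p\<le>M. real (M choose p) * real (k choose (M - p)) * (\<Sum>a\<in>words N p. \<Sum>j<sdim N k.
              nsq mset (words N (k - (M - p))) (contract N (M - p) (\<lambda>A. f (mset a + A)) (occ N k j)))) / real ((M + k) choose M)"
      unfolding n by (rule sum_nsq_adjoint)
    also have "(\<Sum>p\<le>M. real (M choose p) * real (k choose (M - p)) * (\<Sum>a\<in>words N p. \<Sum>j<sdim N k.
              nsq mset (words N (k - (M - p))) (contract N (M - p) (\<lambda>A. f (mset a + A)) (occ N k j))))
        = (\<Sum>p\<le>M. real (M choose p) * real (k choose (M - p)) * (nsq mset (words N M) f * kyfan N k (M - p) (sdim N k)))"
    proof (rule sum.cong[OF refl])
      fix p assume "p \<in> {..M}"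
      then have p: "p \<le> M" by simp
      show "real (M choose p) * real (k choose (M - p)) * (\<Sum>a\<in>words N p. \<Sum>j<sdim N k.
            nsq mset (words N (k - (M - p))) (contract N (M - p) (\<lambda>A. f (mset a + A)) (occ N k j)))
        = real (M choose p) * real (k choose (M - p)) * (nsq mset (words N M) f * kyfan N k (M - p) (sdim N k))"
      proof (cases "M - p \<le> k")
        case True
        then have "(\<Sum>a\<in>words N p. \<Sum>j<sdim N k. nsq mset (words N (k - (M - p))) (contract N (M - p) (\<lambda>A. f (mset a + A)) (occ N k j)))
            = (\<Sum>a\<in>words N p. nsq mset (words N (M - p)) (\<lambda>A. f (mset a + A)) * kyfan N k (M - p) (sdim N k))"
          by (intro sum.cong refl less.IH kn)
        also have "\<dots> = nsq mset (words N M) f * kyfan N k (M - p) (sdim N k)"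
          by (simp only: sum_distrib_right[symmetric] sum_nsq_slice[OF p])
        finally show ?thesis by simp
      next
        case False
        then show ?thesis by (simp add: binomial_eq_0)
      qed
    qed
    also have "\<dots> = nsq mset (words N M) f * (\<Sum>p\<le>M. real (M choose p) * real (k choose (M - p)) * kyfan N k (M - p) (sdim N k))"
      by (simp add: sum_distrib_left mult_ac)
    also have "\<dots> = nsq mset (words N M) f * kyfan N n M (sdim N n) * real ((M + k) choose M)"
      using kyfan_sdim[OF assms(1), of M k] False by (simp add: kyfan_rec n)
    finally show ?thesis by (simp add: k_def)
  qed
qed

text \<open>Both sides count words with M marked occurrences of x: mark them in a word, or choose
  the marked positions first and fill the others with an arrangement of Y.\<close>

lemma arr_add_replicate:
  "arr (Y + replicate_mset M x) * ((count Y x + M) choose M) = ((size Y + M) choose M) * arr Y"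
proof (induction M)
  case (Suc M)
  let ?A = "Y + replicate_mset (Suc M) x"
  let ?B = "Y + replicate_mset M x"
  have "arr ?B * (size Y + Suc M) = arr ?A * (count Y x + Suc M)"
    using card_permutations_of_multiset_remove_aux[of x ?A] by simp
  moreover have "Suc M * ((c + Suc M) choose Suc M) = (c + Suc M) * ((c + M) choose M)" for c
    using Suc_times_binomial[of M "c + M"] by simp
  ultimately have *: "arr ?B * (size Y + Suc M) = arr ?A * (count Y x + Suc M)"
    and **: "Suc M * ((c + Suc M) choose Suc M) = (c + Suc M) * ((c + M) choose M)" for c
    by blast+
  have "Suc M * (arr ?A * ((count Y x + Suc M) choose Suc M)) = arr ?A * (Suc M * ((count Y x + Suc M) choose Suc M))"
    by (simp only: mult_ac)
  also have "\<dots> = arr ?A * (count Y x + Suc M) * ((count Y x + M) choose M)"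
    by (simp only: ** mult.assoc)
  also have "\<dots> = arr ?B * (size Y + Suc M) * ((count Y x + M) choose M)"
    by (simp only: *)
  also have "\<dots> = (size Y + Suc M) * (arr ?B * ((count Y x + M) choose M))"
    by (simp only: mult_ac)
  also have "\<dots> = (size Y + Suc M) * ((size Y + M) choose M) * arr Y"
    by (simp only: Suc.IH mult.assoc)
  also have "\<dots> = Suc M * (((size Y + Suc M) choose Suc M) * arr Y)"
    by (simp only: **[symmetric] mult.assoc)
  finally have "Suc M * (arr ?A * ((count Y x + Suc M) choose Suc M)) = Suc M * (((size Y + Suc M) choose Suc M) * arr Y)" .
  then show ?case by (simp only: mult_cancel1) simp
qed simp

definition peak :: "nat \<Rightarrow> nat multiset \<Rightarrow> complex" where
  "peak M X = (if X = replicate_mset M 0 then 1 else 0)"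

lemma sum_words_peak:
  assumes "1 \<le> N"
  shows "(\<Sum>a\<in>words N M. if mset a = replicate_mset M 0 then F (mset a) else 0) = F (replicate_mset M 0)"
proof -
  have "mset a = replicate_mset M 0 \<longleftrightarrow> a = replicate M 0" if "a \<in> words N M" for a
    by (metis mset_replicate replicate_eqI set_mset_mset size_mset size_replicate_mset set_mset_replicate_mset_subset
        singletonD empty_iff)
  then have "(\<Sum>a\<in>words N M. if mset a = replicate_mset M 0 then F (mset a) else 0)
     = (\<Sum>a\<in>words N M. if a = replicate M 0 then F (mset a) else 0)"
    by (intro sum.cong) auto
  also have "replicate M 0 \<in> words N M" using assms by (auto simp: words_def)
  then have "(\<Sum>a\<in>words N M. if a = replicate M 0 then F (mset a) else 0) = F (replicate_mset M 0)"
    by (simp add: sum.delta)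
  finally show ?thesis .
qed

text \<open>Contraction with the M-th power of \<open>e\<^sub>0\<close> removes M zeros, so at most
  one multiset Y survives, with squared norm arr Y / arr X, where X is the multiset of the given
  state. \<open>arr_add_replicate\<close> evaluates this ratio.\<close>

lemma nsq_contract_peak:
  assumes "1 \<le> N" "M \<le> n" "j < sdim N n"
  shows "nsq mset (words N (n - M)) (contract N M (peak M) (occ N n j)) =
    real ((n - lev N j) choose M) / real (n choose M)"
proof -
  let ?X = "level_enum N n j"
  let ?R = "replicate_mset M (0::nat)"
  have X: "?X \<in> msets N n" using level_enum(1)[OF assms(1)] assms(3) bij_betwE by fastforce
  then have size: "size ?X = n" by (simp add: in_msets_iff)
  have count: "count ?X 0 = n - lev N j" by (rule level_enum(2)[OF assms(1,3)])
  have contract: "contract N M (peak M) v B = v (?R + B)" for v B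
    using sum_words_peak[OF assms(1), of M "\<lambda>A. v (A + B)"]
    by (simp add: contract_def peak_def if_distrib[of cnj] if_distrib[of "\<lambda>z. z * _"] cong: if_cong)
  have "nsq mset (words N (n - M)) (contract N M (peak M) (occ N n j))
     = (\<Sum>Y\<in>msets N (n - M). real (arr Y) * (cmod (occ N n j (?R + Y)))\<^sup>2)"
    unfolding nsq_def contract by (rule sum_words_mset)
  also have "\<dots> = (\<Sum>Y\<in>msets N (n - M). if ?R + Y = ?X then real (arr Y) / real (arr ?X) else 0)"
    by (rule sum.cong) (auto simp: occ_def norm_divide power_divide)
  also have "\<dots> = real ((n - lev N j) choose M) / real (n choose M)"
  proof (cases "M \<le> count ?X 0")
    case True
    define Y where "Y = ?X - ?R"
    have Y: "?X = ?R + Y"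
      using True by (simp add: Y_def count_le_replicate_mset_subset_eq)
    then have Yin: "Y \<in> msets N (n - M)"
      using X size by (auto simp: in_msets_iff)
    have "(\<Sum>Y'\<in>msets N (n - M). if ?R + Y' = ?X then real (arr Y') / real (arr ?X) else 0)
       = (\<Sum>Y'\<in>msets N (n - M). if Y' = Y then real (arr Y') / real (arr ?X) else 0)"
      by (rule sum.cong) (auto simp: Y)
    also have "\<dots> = real (arr Y) / real (arr ?X)" using Yin by simp
    also have "\<dots> = real ((n - lev N j) choose M) / real (n choose M)"
    proof -
      have sY: "size Y + M = n" using size Y assms(2) by simp
      have cY: "count Y 0 + M = n - lev N j" using count Y by simp
      have X2: "?X = Y + ?R" using Y by (simp add: add.commute)
      have "arr ?X * ((n - lev N j) choose M) = (n choose M) * arr Y"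
        unfolding X2 by (rule arr_add_replicate[of Y M 0, unfolded sY cY])
      then have "real (arr ?X) * real ((n - lev N j) choose M) = real (n choose M) * real (arr Y)"
        by (metis of_nat_mult)
      moreover have "real (n choose M) > 0" "real (arr ?X) > 0"
        using assms(2) arr_pos[of ?X] by simp_all
      ultimately show ?thesis by (simp add: field_simps)
    qed
    finally show ?thesis .
  next
    case False
    then have "?R + Y \<noteq> ?X" for Y by (metis count_replicate_mset count_union le_add1)
    then show ?thesis using False count by (simp add: binomial_eq_0)
  qed
  finally show ?thesis .
qed

lemma nsq_peak:
  assumes "1 \<le> N"
  shows "nsq mset (words N M) (peak M) = 1"
proof -
  have "nsq mset (words N M) (peak M) = (\<Sum>a\<in>words N M. if mset a = replicate_mset M 0 then 1 else 0)"
    unfolding nsq_def peak_def by (rule sum.cong) auto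
  also have "\<dots> = 1" using sum_words_peak[OF assms, of M "\<lambda>_. 1"] .
  finally show ?thesis .
qed

section \<open>Coherent states\<close>

text \<open>The action of \<open>U\<^sup>\<otimes>\<^sup>n\<close> on symmetric tensors.\<close>

definition rot :: "nat \<Rightarrow> (nat \<Rightarrow> nat \<Rightarrow> complex) \<Rightarrow> (nat multiset \<Rightarrow> complex) \<Rightarrow> nat multiset \<Rightarrow> complex" where
  "rot N U f X = fold_mset (\<lambda>y F f. \<Sum>x<N. U x y * F (\<lambda>A. f (add_mset x A))) (\<lambda>f. f {#}) X f"

lemma rot_empty [simp]: "rot N U f {#} = f {#}"
  by (simp add: rot_def)

lemma rot_add_mset [simp]:
  "rot N U f (add_mset y X) = (\<Sum>x<N. U x y * rot N U (\<lambda>A. f (add_mset x A)) X)"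
proof -
  interpret comp_fun_commute "\<lambda>y F (f :: nat multiset \<Rightarrow> complex). \<Sum>x<N. U x y * F (\<lambda>A. f (add_mset x A))"
  proof (standard, rule ext, rule ext)
    fix y z and F :: "(nat multiset \<Rightarrow> complex) \<Rightarrow> complex" and f :: "nat multiset \<Rightarrow> complex"
    show "((\<lambda>F f. \<Sum>x<N. U x y * F (\<lambda>A. f (add_mset x A))) \<circ> (\<lambda>F f. \<Sum>x<N. U x z * F (\<lambda>A. f (add_mset x A)))) F f
        = ((\<lambda>F f. \<Sum>x<N. U x z * F (\<lambda>A. f (add_mset x A))) \<circ> (\<lambda>F f. \<Sum>x<N. U x y * F (\<lambda>A. f (add_mset x A)))) F f"
      unfolding o_def sum_distrib_left
      by (subst sum.swap) (simp add: add_mset_commute mult.left_commute)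
  qed
  show ?thesis by (simp add: rot_def)
qed

lemma rot_sum:
  "rot N U (\<lambda>A. \<Sum>i\<in>I. c i * f i A) X = (\<Sum>i\<in>I. c i * rot N U (f i) X)"
proof (induction X arbitrary: f)
  case (add y X)
  show ?case
    unfolding rot_add_mset add sum_distrib_left
    by (subst sum.swap) (simp add: mult.left_commute)
qed simp

lemma rot_scale: "rot N U (\<lambda>A. c * f A) X = c * rot N U f X"
  using rot_sum[of N U "\<lambda>_. c" "\<lambda>_. f" "{()}"] by simp

text \<open>Unitarity in a single tensor slot; the induction steps of \<open>ip_rot\<close> and
  \<open>contract_rot\<close> both reduce to it.\<close>

lemma sum_unitary:
  assumes "orthonormal id {..<N} N U"
  shows "(\<Sum>y<N. (\<Sum>x<N. cnj (U x y) * (\<Sum>x'<N. U x' y * G x x'))) = (\<Sum>x<N. G x x)"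
proof -
  have "(\<Sum>y<N. (\<Sum>x<N. cnj (U x y) * (\<Sum>x'<N. U x' y * G x x'))) =
        (\<Sum>y<N. \<Sum>x<N. \<Sum>x'<N. cnj (U x y) * U x' y * G x x')"
    by (simp add: sum_distrib_left mult.assoc)
  also have "\<dots> = (\<Sum>x<N. \<Sum>y<N. \<Sum>x'<N. cnj (U x y) * U x' y * G x x')"
    by (rule sum.swap)
  also have "\<dots> = (\<Sum>x<N. \<Sum>x'<N. ip id {..<N} (U x) (U x') * G x x')"
    unfolding ip_def sum_distrib_right
    by (subst sum.swap) simp
  also have "\<dots> = (\<Sum>x<N. \<Sum>x'<N. if x = x' then G x x' else 0)"
    by (intro sum.cong refl) (auto simp: orthonormalD[OF assms])
  finally show ?thesis by simp
qed

lemma ip_words_Suc: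
  "ip mset (words N (Suc n)) f g =
     (\<Sum>x<N. ip mset (words N n) (\<lambda>A. f (add_mset x A)) (\<lambda>A. g (add_mset x A)))"
  by (simp add: ip_def sum_words_Suc)

lemma ip_rot:
  assumes "orthonormal id {..<N} N U"
  shows "ip mset (words N n) (rot N U f) (rot N U g) = ip mset (words N n) f g"
proof (induction n arbitrary: f g)
  case 0
  show ?case by (simp add: ip_def)
next
  case (Suc n)
  show ?case
    unfolding ip_words_Suc rot_add_mset ip_sum_left ip_sum_right Suc.IH
    by (rule sum_unitary[OF assms])
qed

lemma contract_Suc:
  "contract N (Suc m) f v B = (\<Sum>x<N. contract N m (\<lambda>A. f (add_mset x A)) (\<lambda>A. v (add_mset x A)) B)"
  by (simp add: contract_def sum_words_Suc)

lemma contract_eq_ip: "contract N m f v B = ip mset (words N m) f (\<lambda>A. v (A + B))"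
  by (simp add: contract_def ip_def)

text \<open>In the contracted slots the rotations cancel by unitarity; in the others U
  remains.\<close>

lemma contract_rot:
  assumes "orthonormal id {..<N} N U"
  shows "contract N m (rot N U f) (rot N U v) B = rot N U (contract N m f v) B"
proof (induction m arbitrary: f v)
  case 0
  show ?case using rot_scale[of N U "cnj (f {#})" v B] by (simp add: contract_def)
next
  case (Suc m)
  have "contract N (Suc m) (rot N U f) (rot N U v) B =
      (\<Sum>y<N. \<Sum>x<N. cnj (U x y) * (\<Sum>x'<N. U x' y *
         contract N m (rot N U (\<lambda>A. f (add_mset x A))) (rot N U (\<lambda>A. v (add_mset x' A))) B))"
    unfolding contract_Suc rot_add_mset unfolding contract_eq_ip ip_sum_left ip_sum_right by simp
  also have "\<dots> = (\<Sum>x<N. contract N m (rot N U (\<lambda>A. f (add_mset x A))) (rot N U (\<lambda>A. v (add_mset x A))) B)"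
    by (rule sum_unitary[OF assms])
  also have "\<dots> = (\<Sum>x<N. rot N U (contract N m (\<lambda>A. f (add_mset x A)) (\<lambda>A. v (add_mset x A))) B)"
    by (simp only: Suc.IH)
  also have "\<dots> = rot N U (contract N (Suc m) f v) B"
    using rot_sum[of N U "\<lambda>_. 1" "\<lambda>x. contract N m (\<lambda>A. f (add_mset x A)) (\<lambda>A. v (add_mset x A))" "{..<N}" B]
    by (simp add: contract_Suc[abs_def])
  finally show ?case .
qed

definition prodf :: "('a \<Rightarrow> complex) \<Rightarrow> 'a multiset \<Rightarrow> complex" where
  "prodf u X = (\<Prod>x\<in>#X. u x)"

text \<open>A slice of \<open>peak\<close> at x is zero unless x = 0, so each slot contributes only
  row 0 of U. In the convention of \<open>rot\<close> the rows of U are the images of the basis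
  vectors.\<close>

lemma rot_peak:
  assumes "1 \<le> N" "size X = M"
  shows "rot N U (peak M) X = prodf (U 0) X"
  using assms(2)
proof (induction X arbitrary: M)
  case empty
  then show ?case by (simp add: peak_def prodf_def)
next
  case (add y X)
  then obtain m where M: "M = Suc m" "size X = m" by auto
  have zero: "rot N U (\<lambda>A. 0) X = 0"
    using rot_sum[of N U "\<lambda>_. 0" "\<lambda>_ _. 0" "{}" X] by simp
  have "(\<lambda>A. peak (Suc m) (add_mset x A)) = (if x = 0 then peak m else (\<lambda>_. 0))" for x
  proof (cases "x = 0")
    case False
    have "add_mset x A \<noteq> replicate_mset (Suc m) 0" for A
      using False by (metis in_replicate_mset union_single_eq_member)
    then show ?thesis using False by (auto simp: peak_def fun_eq_iff)
  qed (auto simp: peak_def fun_eq_iff)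
  then have "rot N U (peak M) (add_mset y X) = (\<Sum>x<N. if x = 0 then U 0 y * rot N U (peak m) X else 0)"
    unfolding M rot_add_mset by (intro sum.cong) (auto simp: zero)
  also have "\<dots> = U 0 y * rot N U (peak m) X" using assms(1) by simp
  finally show ?case by (simp add: add.IH[OF M(2)] prodf_def)
qed

lemma nsq_eq_ip: "nsq \<pi> I f = Re (ip \<pi> I f f)"
  by (simp add: ip_self)

lemma unitary_with_first_row:
  assumes "(\<Sum>i<N. (cmod (u i))\<^sup>2) = 1"
  obtains U where "orthonormal id {..<N} N U" "U 0 = u"
proof -
  have "orthonormal id {..<N} (Suc 0) (\<lambda>_. u)"
    using assms by (simp add: orthonormal_def ip_self nsq_def)
  from orthonormal_basis_extend[OF this] show ?thesis using that by auto
qed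

lemma nsq_prodf:
  assumes "1 \<le> N" "(\<Sum>i<N. (cmod (u i))\<^sup>2) = 1"
  shows "nsq mset (words N M) (prodf u) = 1"
proof -
  obtain U where U: "orthonormal id {..<N} N U" "U 0 = u"
    using unitary_with_first_row[OF assms(2)] .
  have "nsq mset (words N M) (prodf u) = nsq mset (words N M) (rot N U (peak M))"
    unfolding nsq_def by (intro sum.cong) (auto simp: rot_peak[OF assms(1)] U(2) words_def)
  then show ?thesis
    by (simp add: nsq_eq_ip ip_rot[OF U(1)]) (simp add: nsq_peak[OF assms(1)] ip_self)
qed

text \<open>Coherent states attain the upper bound: a unitary with first row u carries
  \<open>peak\<close> to the tensor power of u, and the occupation number states to an optimal
  system.\<close>

lemma coherent_frame:
  assumes "1 \<le> N" "(\<Sum>i<N. (cmod (u i))\<^sup>2) = 1" "M \<le> n" "r \<le> sdim N n"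
  shows "\<exists>v. orthonormal mset (words N n) r v \<and>
    (\<Sum>i<r. nsq mset (words N (n - M)) (contract N M (prodf u) (v i))) = kyfan N n M r"
proof -
  obtain U where U: "orthonormal id {..<N} N U" "U 0 = u"
    using unitary_with_first_row[OF assms(2)] .
  define v where "v i = rot N U (occ N n i)" for i
  have on: "orthonormal mset (words N n) r v"
    using orthonormal_mono[OF orthonormal_occ[OF assms(1)] assms(4)]
    by (simp add: orthonormal_def v_def ip_rot[OF U(1)])
  have "contract N M (prodf u) w B = contract N M (rot N U (peak M)) w B" for w B
    unfolding contract_def by (intro sum.cong) (auto simp: rot_peak[OF assms(1)] U(2) words_def)
  then have contract: "contract N M (prodf u) (v i) = rot N U (contract N M (peak M) (occ N n i))" for i
    by (simp add: fun_eq_iff v_def contract_rot[OF U(1)])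
  have "nsq mset (words N (n - M)) (contract N M (prodf u) (v i)) = real ((n - lev N i) choose M) / real (n choose M)"
    if "i < r" for i
    using nsq_contract_peak[OF assms(1,3), of i] that assms(4)
    by (simp add: contract nsq_eq_ip ip_rot[OF U(1)])
  then have "(\<Sum>i<r. nsq mset (words N (n - M)) (contract N M (prodf u) (v i))) = kyfan N n M r"
    by (simp add: kyfan_def)
  then show ?thesis using on by blast
qed

section \<open>Equality in Cauchy-Schwarz and product states\<close>

lemma prodf_scale: "prodf (\<lambda>x. c * w x) X = c ^ size X * prodf w X"
  by (induction X) (simp_all add: prodf_def)

text \<open>A and B draw on one multiset, so letters can change sides. Exchanging x in A with y0 in
  B0 shows that replacing y0 by x in the argument of \<phi> multiplies the value by w x. Replacing
  the letters of \<open>replicate_mset M y0\<close> one by one then makes \<phi> a product. The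
  exchange needs a letter in B0, that is, k > 0.\<close>

lemma product_of_splitting:
  assumes v: "\<And>A B. A \<in> msets N M \<Longrightarrow> B \<in> msets N k \<Longrightarrow> v (A + B) = c B * \<phi> A"
    and k: "0 < k" and B0: "B0 \<in> msets N k" "c B0 \<noteq> 0"
  shows "\<exists>w C. (\<Sum>x<N. (cmod (w x))\<^sup>2) = 1 \<and> (\<forall>A\<in>msets N M. \<phi> A = C * prodf w A)"
proof -
  obtain y0 B0' where y0: "B0 = add_mset y0 B0'"
    using B0 k by (metis in_msets_iff multiset_cases not_gr_zero size_empty)
  have B0': "add_mset x B0' \<in> msets N k" if "x < N" for x
    using B0(1) that by (auto simp: y0 in_msets_iff)
  define w where "w x = c (add_mset x B0') / c B0" for x
  have step: "\<phi> (add_mset x A) = w x * \<phi> (add_mset y0 A)" if "x < N" "y0 < N" "set_mset A \<subseteq> {..<N}" "Suc (size A) = M" for x A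
  proof -
    have "add_mset x A \<in> msets N M" "add_mset y0 A \<in> msets N M"
      using that by (auto simp: in_msets_iff)
    then have "c B0 * \<phi> (add_mset x A) = c (add_mset x B0') * \<phi> (add_mset y0 A)"
      using v[of "add_mset x A" B0] v[of "add_mset y0 A" "add_mset x B0'"] B0(1) B0'[OF that(1)]
      by (simp add: y0 add_mset_commute)
    then show ?thesis using B0(2) by (simp add: w_def field_simps)
  qed
  have y0N: "y0 < N" using B0(1) by (auto simp: y0 in_msets_iff)
  have main: "\<phi> (A + replicate_mset (M - size A) y0) = prodf w A * \<phi> (replicate_mset M y0)"
    if "set_mset A \<subseteq> {..<N}" "size A \<le> M" for A
    using that
  proof (induction A)
    case empty
    then show ?case by (simp add: prodf_def)
  next
    case (add x A)
    have eq: "M - size A = Suc (M - Suc (size A))" using add.prems by simp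
    have "\<phi> (add_mset x (A + replicate_mset (M - Suc (size A)) y0)) =
        w x * \<phi> (add_mset y0 (A + replicate_mset (M - Suc (size A)) y0))"
      using add.prems y0N by (intro step) (auto split: if_splits)
    then show ?case using add.IH add.prems by (simp add: eq prodf_def)
  qed
  define s where "s = (\<Sum>x<N. (cmod (w x))\<^sup>2)"
  \<comment> \<open>This entry keeps w nonzero, so that it can be normalized.\<close>
  have "w y0 = 1" using B0(2) by (simp add: w_def y0)
  moreover have "(cmod (w y0))\<^sup>2 \<le> s"
    unfolding s_def using y0N by (intro member_le_sum) auto
  ultimately have s: "0 < s" by simp
  define w' where "w' x = of_real (1 / sqrt s) * w x" for x
  have "(\<Sum>x<N. (cmod (w' x))\<^sup>2) = (\<Sum>x<N. (cmod (w x))\<^sup>2) / s"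
    using s by (simp add: w'_def norm_mult norm_divide power_mult_distrib power_divide sum_divide_distrib)
  then have unit: "(\<Sum>x<N. (cmod (w' x))\<^sup>2) = 1" using s by (simp add: s_def)
  have "w = (\<lambda>x. of_real (sqrt s) * w' x)"
    using s by (simp add: w'_def fun_eq_iff)
  then have "prodf w A = of_real (sqrt s) ^ size A * prodf w' A" for A
    using prodf_scale[of "of_real (sqrt s)" w' A] by simp
  then have "\<phi> A = (\<phi> (replicate_mset M y0) * of_real (sqrt s) ^ M) * prodf w' A" if "A \<in> msets N M" for A
    using main[of A] that by (simp add: in_msets_iff)
  then show ?thesis using unit by blast
qed

lemma sum_nsq_shift:
  "(\<Sum>b\<in>words N k. nsq mset (words N M) (\<lambda>A. v (A + mset b))) = nsq mset (words N (M + k)) v"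
  unfolding nsq_def sum_words_add by (subst sum.swap) simp

text \<open>The defect in Cauchy-Schwarz is the total squared distance of the slices of v from the
  line of \<phi>. Normalized, \<phi> is packed as a one-member orthonormal system with a dummy
  index, so that \<open>nsq_residual\<close> applies.\<close>

lemma nsq_contract_defect:
  assumes "0 < nsq mset (words N M) \<phi>"
  defines "\<phi>' \<equiv> \<lambda>(_::nat) A. of_real (1 / sqrt (nsq mset (words N M) \<phi>)) * \<phi> A"
  shows "orthonormal mset (words N M) 1 \<phi>'"
    and "(\<Sum>b\<in>words N k. nsq mset (words N M) (residual mset (words N M) 1 \<phi>' (\<lambda>A. v (A + mset b)))) =
      nsq mset (words N (M + k)) v - nsq mset (words N k) (contract N M \<phi> v) / nsq mset (words N M) \<phi>"
proof -
  let ?n = "nsq mset (words N M) \<phi>"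
  have "complex_of_real (1 / sqrt ?n) * (of_real (1 / sqrt ?n) * of_real ?n) = of_real (1 / sqrt ?n * (1 / sqrt ?n * ?n))"
    by (simp only: of_real_mult)
  also have "1 / sqrt ?n * (1 / sqrt ?n * ?n) = 1" using assms(1) by (simp add: field_simps)
  finally show on: "orthonormal mset (words N M) 1 \<phi>'"
    by (simp add: orthonormal_def \<phi>'_def ip_scale_left ip_scale_right ip_self del: of_real_divide)
  have cm: "(cmod (ip mset (words N M) (\<phi>' 0) g))\<^sup>2 = (cmod (ip mset (words N M) \<phi> g))\<^sup>2 / ?n" for g
    unfolding \<phi>'_def ip_scale_left using assms(1)
    by (simp add: norm_mult norm_divide power_divide)
  have "nsq mset (words N M) (residual mset (words N M) 1 \<phi>' (\<lambda>A. v (A + mset b))) =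
      nsq mset (words N M) (\<lambda>A. v (A + mset b)) - (cmod (contract N M \<phi> v (mset b)))\<^sup>2 / ?n" for b
    unfolding nsq_residual[OF on] by (simp add: cm contract_eq_ip)
  then show "(\<Sum>b\<in>words N k. nsq mset (words N M) (residual mset (words N M) 1 \<phi>' (\<lambda>A. v (A + mset b)))) =
      nsq mset (words N (M + k)) v - nsq mset (words N k) (contract N M \<phi> v) / ?n"
    by (simp add: sum_subtractf sum_nsq_shift sum_divide_distrib[symmetric]) (simp add: nsq_def)
qed

lemma nsq_contract_le:
  "nsq mset (words N k) (contract N M \<phi> v) \<le> nsq mset (words N M) \<phi> * nsq mset (words N (M + k)) v"
proof (cases "nsq mset (words N M) \<phi> = 0")
  case True
  then have "contract N M \<phi> v B = 0" for B by (simp add: nsq_eq_0_iff contract_def)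
  then show ?thesis by (simp add: nsq_def sum_nonneg)
next
  case False
  then have pos: "0 < nsq mset (words N M) \<phi>" using nsq_nonneg[of mset "words N M" \<phi>] by linarith
  have "0 \<le> nsq mset (words N (M + k)) v - nsq mset (words N k) (contract N M \<phi> v) / nsq mset (words N M) \<phi>"
    unfolding nsq_contract_defect(2)[OF pos, symmetric] by (simp add: sum_nonneg)
  then show ?thesis using pos by (simp add: field_simps)
qed

text \<open>Zero defect puts every slice of v on the line of \<phi>; c B is the coefficient of the
  slice at B.\<close>

lemma nsq_contract_eqD:
  assumes "0 < nsq mset (words N M) \<phi>"
    and "nsq mset (words N k) (contract N M \<phi> v) = nsq mset (words N M) \<phi> * nsq mset (words N (M + k)) v"
  shows "\<exists>c. \<forall>A\<in>msets N M. \<forall>B\<in>msets N k. v (A + B) = c B * \<phi> A"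
proof -
  define \<phi>' where "\<phi>' = (\<lambda>(_::nat) A. of_real (1 / sqrt (nsq mset (words N M) \<phi>)) * \<phi> A)"
  have "(\<Sum>b\<in>words N k. nsq mset (words N M) (residual mset (words N M) 1 \<phi>' (\<lambda>A. v (A + mset b)))) = 0"
    using nsq_contract_defect(2)[OF assms(1), of v k] assms by (simp add: \<phi>'_def)
  then have "\<forall>b\<in>words N k. \<forall>a\<in>words N M. residual mset (words N M) 1 \<phi>' (\<lambda>A. v (A + mset b)) (mset a) = 0"
    by (simp add: sum_nonneg_eq_0_iff nsq_eq_0_iff)
  then have "v (A + B) = ip mset (words N M) (\<phi>' 0) (\<lambda>A. v (A + B)) * of_real (1 / sqrt (nsq mset (words N M) \<phi>)) * \<phi> A"
    if "A \<in> msets N M" "B \<in> msets N k" for A B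
    using that by (auto simp: msets_def residual_def \<phi>'_def)
  then show ?thesis
    by (intro exI[of _ "\<lambda>B. ip mset (words N M) (\<phi>' 0) (\<lambda>A. v (A + B)) * of_real (1 / sqrt (nsq mset (words N M) \<phi>))"]) simp
qed

text \<open>Each summand obeys Cauchy-Schwarz, so equality of the sums forces equality for every i.
  One w serves all i because they share the vector v.\<close>

lemma coherent_of_maximal:
  fixes d :: nat
  assumes N: "1 \<le> N" and k: "0 < k" and v: "nsq mset (words N (M + k)) v = 1"
    and max: "(\<Sum>i<d. nsq mset (words N M) (\<phi> i)) \<le> (\<Sum>i<d. nsq mset (words N k) (contract N M (\<phi> i) v))"
  shows "\<exists>w. (\<Sum>x<N. (cmod (w x))\<^sup>2) = 1 \<and> (\<forall>i<d. \<exists>C. \<forall>A\<in>msets N M. \<phi> i A = C * prodf w A)"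
proof -
  have eq: "nsq mset (words N k) (contract N M (\<phi> i) v) = nsq mset (words N M) (\<phi> i) * nsq mset (words N (M + k)) v"
    if "i < d" for i
  proof -
    have "(\<Sum>i<d. nsq mset (words N M) (\<phi> i) - nsq mset (words N k) (contract N M (\<phi> i) v)) \<le> 0"
      using max by (simp add: sum_subtractf)
    moreover have nonneg: "0 \<le> nsq mset (words N M) (\<phi> i) - nsq mset (words N k) (contract N M (\<phi> i) v)" for i
      using nsq_contract_le[of N k M "\<phi> i" v] v by simp
    ultimately have "(\<Sum>i<d. nsq mset (words N M) (\<phi> i) - nsq mset (words N k) (contract N M (\<phi> i) v)) = 0"
      by (meson antisym sum_nonneg)
    then have "\<forall>i\<in>{..<d}. nsq mset (words N M) (\<phi> i) - nsq mset (words N k) (contract N M (\<phi> i) v) = 0"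
      using nonneg by (subst sum_nonneg_eq_0_iff[symmetric]) simp_all
    then show ?thesis using that v by simp
  qed
  have zero: "\<phi> i A = 0" if "nsq mset (words N M) (\<phi> i) = 0" "A \<in> msets N M" for i A
    using that by (auto simp: nsq_eq_0_iff msets_def)
  show ?thesis
  proof (cases "\<exists>i<d. nsq mset (words N M) (\<phi> i) \<noteq> 0")
    case False
    have "(\<Sum>x<N. (cmod (if x = 0 then 1 else 0))\<^sup>2) = (\<Sum>x<N. if x = 0 then 1 else (0::real))"
      by (rule sum.cong) auto
    also have "\<dots> = 1" using N by simp
    finally show ?thesis
      using False zero by (intro exI[of _ "\<lambda>x. if x = 0 then 1 else 0"]) (auto intro!: exI[of _ 0])
  next
    case True
    then obtain i0 where i0: "i0 < d" "0 < nsq mset (words N M) (\<phi> i0)"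
      by (metis nsq_nonneg order_le_less)
    \<comment> \<open>Cut a point where v does not vanish into A0 and B0. The slice of v at B0 is a
      nonzero multiple of every \<phi> i of positive norm, which makes all of these
      proportional.\<close>
    have "nsq mset (words N (M + k)) v \<noteq> 0" using v by simp
    then obtain X where X: "X \<in> msets N (M + k)" "v X \<noteq> 0"
      by (auto simp: nsq_eq_0_iff msets_def)
    then obtain xs where xs: "xs \<in> words N (M + k)" "X = mset xs" by (auto simp: msets_def)
    define A0 where "A0 = mset (take M xs)"
    define B0 where "B0 = mset (drop M xs)"
    have X0: "X = A0 + B0" using xs by (simp add: A0_def B0_def flip: mset_append)
    have A0: "A0 \<in> msets N M" and B0: "B0 \<in> msets N k"
      using xs by (auto simp: A0_def B0_def in_msets_iff words_def dest: in_set_takeD in_set_dropD)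
    have fac: "\<exists>c. (\<forall>A\<in>msets N M. \<forall>B\<in>msets N k. v (A + B) = c B * \<phi> i A) \<and> c B0 \<noteq> 0"
      if i: "i < d" and pos: "0 < nsq mset (words N M) (\<phi> i)" for i
    proof -
      obtain c where c: "\<forall>A\<in>msets N M. \<forall>B\<in>msets N k. v (A + B) = c B * \<phi> i A"
        using nsq_contract_eqD[OF pos eq[OF i]] by blast
      then have "v X = c B0 * \<phi> i A0" using A0 B0 X0 by simp
      then show ?thesis using c X(2) by (intro exI[of _ c]) auto
    qed
    from fac[OF i0] obtain c where c: "\<forall>A\<in>msets N M. \<forall>B\<in>msets N k. v (A + B) = c B * \<phi> i0 A" "c B0 \<noteq> 0"
      by blast
    from product_of_splitting[of N M k v c "\<phi> i0" B0] c k B0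
    obtain w C where w: "(\<Sum>x<N. (cmod (w x))\<^sup>2) = 1" "\<forall>A\<in>msets N M. \<phi> i0 A = C * prodf w A"
      by blast
    have "\<exists>C. \<forall>A\<in>msets N M. \<phi> i A = C * prodf w A" if i: "i < d" for i
    proof (cases "nsq mset (words N M) (\<phi> i) = 0")
      case True
      then show ?thesis using zero by (auto intro!: exI[of _ 0])
    next
      case False
      then have "0 < nsq mset (words N M) (\<phi> i)" by (metis nsq_nonneg order_le_less)
      from fac[OF i this] obtain c' where c': "\<forall>A\<in>msets N M. \<forall>B\<in>msets N k. v (A + B) = c' B * \<phi> i A" "c' B0 \<noteq> 0"
        by blast
      have "\<phi> i A = (c B0 / c' B0 * C) * prodf w A" if "A \<in> msets N M" for A
      proof -
        have "c' B0 * \<phi> i A = c B0 * (C * prodf w A)" using c c' w(2) B0 that by metis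
        then show ?thesis using c'(2) by (simp add: field_simps)
      qed
      then show ?thesis by blast
    qed
    then show ?thesis using w(1) by blast
  qed
qed

section \<open>Hermitian matrices and ordered eigenvalues\<close>

definition act :: "nat \<Rightarrow> (nat \<Rightarrow> nat \<Rightarrow> complex) \<Rightarrow> (nat \<Rightarrow> complex) \<Rightarrow> nat \<Rightarrow> complex" where
  "act d a f x = (\<Sum>y<d. a x y * f y)"

definition hermitian :: "nat \<Rightarrow> (nat \<Rightarrow> nat \<Rightarrow> complex) \<Rightarrow> bool" where
  "hermitian d a \<longleftrightarrow> (\<forall>x<d. \<forall>y<d. a y x = cnj (a x y))"

abbreviation ipn :: "nat \<Rightarrow> (nat \<Rightarrow> complex) \<Rightarrow> (nat \<Rightarrow> complex) \<Rightarrow> complex" where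
  "ipn d \<equiv> ip id {..<d}"

lemma ip_act_hermitian:
  assumes "hermitian d a"
  shows "ipn d f (act d a g) = ipn d (act d a f) g"
proof -
  have "ipn d f (act d a g) = (\<Sum>x<d. \<Sum>y<d. cnj (f x) * a x y * g y)"
    by (simp add: ip_def act_def sum_distrib_left mult.assoc)
  also have "\<dots> = (\<Sum>y<d. \<Sum>x<d. cnj (f x) * a x y * g y)"
    by (rule sum.swap)
  also have "\<dots> = (\<Sum>y<d. \<Sum>x<d. cnj (a y x * f x) * g y)"
  proof (intro sum.cong refl)
    fix x y assume "y \<in> {..<d}" "x \<in> {..<d}"
    then have "a x y = cnj (a y x)" using assms unfolding hermitian_def by blast
    then show "cnj (f x) * a x y * g y = cnj (a y x * f x) * g y" by simp
  qed
  also have "\<dots> = ipn d (act d a f) g"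
    by (simp add: ip_def act_def sum_distrib_right)
  finally show ?thesis .
qed

lemma act_sum: "act d a (\<lambda>y. \<Sum>j\<in>J. c j * g j y) x = (\<Sum>j\<in>J. c j * act d a (g j) x)"
  unfolding act_def sum_distrib_left
  by (subst sum.swap) (simp add: mult.left_commute)

lemma ip_cong:
  "(\<And>x. x \<in> I \<Longrightarrow> f (\<pi> x) = f' (\<pi> x)) \<Longrightarrow> (\<And>x. x \<in> I \<Longrightarrow> g (\<pi> x) = g' (\<pi> x)) \<Longrightarrow> ip \<pi> I f g = ip \<pi> I f' g'"
  unfolding ip_def by (intro sum.cong) auto

lemma orthonormal_basis_expand:
  assumes "orthonormal id {..<d} d z" "x < d"
  shows "f x = (\<Sum>j<d. ipn d (z j) f * z j x)"
proof -
  obtain w where w: "\<forall>i<d. w i = z i" "\<forall>f. \<forall>x<d. f x = (\<Sum>j<d. ipn d (w j) f * w j x)"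
    using orthonormal_basis_extend[OF assms(1)] by blast
  then have "f x = (\<Sum>j<d. ipn d (w j) f * w j x)" using assms(2) by blast
  also have "\<dots> = (\<Sum>j<d. ipn d (z j) f * z j x)"
    by (intro sum.cong refl) (simp add: w(1))
  finally show ?thesis .
qed

lemma ex_eigenvector:
  assumes B: "B \<in> carrier_mat m m" and m: "0 < m"
  shows "\<exists>\<mu> c. (\<exists>j<m. c j \<noteq> 0) \<and> (\<forall>i<m. (\<Sum>j<m. (B :: complex mat) $$ (i, j) * c j) = \<mu> * c i)"
proof -
  obtain as where as: "char_poly B = (\<Prod>a\<leftarrow>as. [:- a, 1:])" "length as = m"
    using char_poly_factorized[OF B] by blast
  then obtain \<mu> where "\<mu> \<in> set as" using m by (cases as) auto
  then have "poly (char_poly B) \<mu> = 0" by (force simp: as(1) poly_prod_list prod_list_zero_iff)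
  then obtain v where "eigenvector B v \<mu>"
    using eigenvalue_root_char_poly[OF B] by (auto simp: eigenvalue_def)
  then have v: "v \<in> carrier_vec m" "v \<noteq> 0\<^sub>v m" "B *\<^sub>v v = \<mu> \<cdot>\<^sub>v v"
    using B by (auto simp: eigenvector_def)
  have "\<exists>j<m. v $ j \<noteq> 0"
  proof (rule ccontr)
    assume "\<not> ?thesis"
    then have "v = 0\<^sub>v m" using v(1) by (intro eq_vecI) auto
    then show False using v(2) by simp
  qed
  moreover have "(\<Sum>j<m. B $$ (i, j) * v $ j) = \<mu> * v $ i" if "i < m" for i
  proof -
    have "(B *\<^sub>v v) $ i = (\<Sum>j<m. B $$ (i, j) * v $ j)"
      using B v(1) that by (simp add: scalar_prod_def lessThan_atLeast0)
    then show ?thesis using v that by simp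
  qed
  ultimately show ?thesis by blast
qed

text \<open>The complement of the eigenvectors found so far is invariant, and the matrix B is the
  compression of a to it in an orthonormal basis. An eigenvector of B gives the coefficients of the
  next eigenvector.\<close>

lemma ex_orthonormal_eigenvectors:
  assumes a: "hermitian d a" and "s \<le> d"
  shows "\<exists>z \<mu>. orthonormal id {..<d} s z \<and> (\<forall>i<s. \<forall>x<d. act d a (z i) x = \<mu> i * z i x)"
  using assms(2)
proof (induction s)
  case 0
  show ?case by (auto simp: orthonormal_def)
next
  case (Suc s)
  then have "s \<le> d" by simp
  from Suc.IH[OF this] obtain z \<mu> where z: "orthonormal id {..<d} s z"
    and \<mu>: "\<forall>i<s. \<forall>x<d. act d a (z i) x = \<mu> i * z i x" by blast
  obtain w where w: "\<And>i. i < s \<Longrightarrow> w i = z i" "orthonormal id {..<d} d w"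
    and expand: "\<And>f x. x < d \<Longrightarrow> f x = (\<Sum>j<d. ipn d (w j) f * w j x)"
    using orthonormal_basis_extend[OF z] by blast
  define m where "m = d - s"
  have d: "d = s + m" and m: "0 < m" using Suc.prems by (auto simp: m_def)
  define B where "B = mat m m (\<lambda>(i, j). ipn d (w (s + i)) (act d a (w (s + j))))"
  obtain \<nu> c where c: "\<exists>j<m. c j \<noteq> 0" "\<And>i. i < m \<Longrightarrow> (\<Sum>j<m. B $$ (i, j) * c j) = \<nu> * c i"
    using ex_eigenvector[of B m] m by (auto simp: B_def)
  define y where "y = (\<lambda>x. \<Sum>j<m. c j * w (s + j) x)"
  have wy: "ipn d (w i) y = (if i < s then 0 else c (i - s))" if "i < d" for i
  proof -
    have "ipn d (w i) y = (\<Sum>j<m. if i = s + j then c j else 0)"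
      unfolding y_def ip_sum_right
    proof (rule sum.cong[OF refl])
      fix j assume "j \<in> {..<m}"
      then have "s + j < d" by (simp add: d)
      from orthonormalD[OF w(2) that this]
      show "c j * ipn d (w i) (w (s + j)) = (if i = s + j then c j else 0)" by simp
    qed
    also have "\<dots> = (if i < s then 0 else c (i - s))"
    proof (cases "i < s")
      case False
      have "(\<Sum>j<m. if i = s + j then c j else 0) = (\<Sum>j<m. if j = i - s then c j else 0)"
        using False by (intro sum.cong) auto
      then show ?thesis using False that d by auto
    qed (auto intro!: sum.neutral)
    finally show ?thesis .
  qed
  have wa: "ipn d (w i) (act d a y) = \<nu> * ipn d (w i) y" if i: "i < d" for i
  proof (cases "i < s")
    case True
    have "ipn d (w i) (act d a y) = ipn d (\<lambda>x. \<mu> i * w i x) y"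
      unfolding ip_act_hermitian[OF a] using True by (intro ip_cong) (auto simp: w(1) \<mu>)
    also have "\<dots> = 0" using wy[OF i] True by (simp add: ip_scale_left)
    finally show ?thesis using wy[OF i] True by simp
  next
    case False
    then obtain l where l: "i = s + l" "l < m" using i d by (metis add_less_cancel_left le_Suc_ex not_less)
    have "act d a y = (\<lambda>x. \<Sum>j<m. c j * act d a (w (s + j)) x)"
      by (simp add: fun_eq_iff y_def act_sum)
    then have "ipn d (w i) (act d a y) = (\<Sum>j<m. B $$ (l, j) * c j)"
      using l by (simp add: ip_sum_right B_def mult.commute)
    then show ?thesis using c(2)[OF l(2)] wy[OF i] l by simp
  qed
  have ay: "act d a y x = \<nu> * y x" if "x < d" for x
    using expand[OF that, of "act d a y"] expand[OF that, of y]
    by (simp add: wa sum_distrib_left mult.assoc)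
  have "nsq id {..<d} y \<noteq> 0"
  proof
    assume "nsq id {..<d} y = 0"
    then have "y x = 0" if "x < d" for x using that by (simp add: nsq_eq_0_iff)
    then have "ipn d (w i) y = 0" for i by (simp add: ip_def)
    moreover obtain j where "j < m" "c j \<noteq> 0" using c(1) by blast
    ultimately show False using wy[of "s + j"] d by simp
  qed
  then have pos: "0 < nsq id {..<d} y" using nsq_nonneg[of id "{..<d}" y] by linarith
  define r where "r = 1 / sqrt (nsq id {..<d} y)"
  have "r * (r * nsq id {..<d} y) = 1" using pos by (simp add: r_def field_simps)
  then have r: "complex_of_real r * (of_real r * of_real (nsq id {..<d} y)) = 1"
    by (simp flip: of_real_mult)
  define z' where "z' = z(s := \<lambda>x. of_real r * y x)"
  have zy: "ipn d (z i) y = 0" "ipn d y (z i) = 0" if "i < s" for i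
    using wy[of i] w(1)[OF that] that d ip_cnj[of id "{..<d}" "z i" y] by auto
  have "orthonormal id {..<d} (Suc s) z'"
    using z zy r by (auto simp: orthonormal_def z'_def less_Suc_eq ip_scale_left ip_scale_right ip_self)
  moreover have "act d a (z' i) x = (\<mu>(s := \<nu>)) i * z' i x" if "i < Suc s" "x < d" for i x
  proof (cases "i = s")
    case True
    then show ?thesis using ay[OF that(2)] act_sum[of d a "\<lambda>_. of_real r" "\<lambda>_. y" "{()}" x]
      by (simp add: z'_def)
  qed (use that \<mu> in \<open>auto simp: z'_def\<close>)
  ultimately show ?case by blast
qed

lemma hermitian_diagonalization:
  assumes a: "hermitian d a"
  shows "\<exists>z \<mu>. orthonormal id {..<d} d z \<and>
    (\<forall>x<d. \<forall>y<d. a x y = (\<Sum>i<d. of_real (\<mu> i) * z i x * cnj (z i y)))"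
proof -
  obtain z \<mu> where z: "orthonormal id {..<d} d z"
    and \<mu>: "\<And>i x. i < d \<Longrightarrow> x < d \<Longrightarrow> act d a (z i) x = \<mu> i * z i x"
    using ex_orthonormal_eigenvectors[OF a order_refl] by blast
  note expand = orthonormal_basis_expand[OF z]
  have real: "of_real (Re (\<mu> i)) = \<mu> i" if i: "i < d" for i
  proof -
    have "ipn d (z i) (act d a (z i)) = ipn d (z i) (\<lambda>x. \<mu> i * z i x)"
      using \<mu> i by (intro ip_cong) auto
    moreover have "ipn d (act d a (z i)) (z i) = ipn d (\<lambda>x. \<mu> i * z i x) (z i)"
      using \<mu> i by (intro ip_cong) auto
    ultimately have "\<mu> i = cnj (\<mu> i)"
      using ip_act_hermitian[OF a, of "z i" "z i"] orthonormalD[OF z i i]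
      by (simp add: ip_scale_left ip_scale_right)
    then show ?thesis by (metis Reals_cnj_iff of_real_Re)
  qed
  have "a x y = (\<Sum>i<d. \<mu> i * z i x * cnj (z i y))" if x: "x < d" and y: "y < d" for x y
  proof -
    define \<delta> where "\<delta> = (\<lambda>x. if x = y then 1 else (0::complex))"
    have "a x y = act d a \<delta> x"
      using y by (simp add: act_def \<delta>_def if_distrib[of "\<lambda>z. _ * z"] cong: if_cong)
    also have "\<dots> = act d a (\<lambda>x. \<Sum>j<d. cnj (z j y) * z j x) x"
      using expand[of _ \<delta>] y by (simp add: act_def \<delta>_def unit_delta)
    also have "\<dots> = (\<Sum>i<d. \<mu> i * z i x * cnj (z i y))"
      unfolding act_sum using \<mu> x by (intro sum.cong) auto
    finally show ?thesis .
  qed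
  then have "\<forall>x<d. \<forall>y<d. a x y = (\<Sum>i<d. of_real (Re (\<mu> i)) * z i x * cnj (z i y))"
    by (simp add: real)
  then show ?thesis using z by (intro exI[of _ z] exI[of _ "\<lambda>i. Re (\<mu> i)"] conjI)
qed

lemma orthonormal_columns:
  assumes z: "orthonormal id {..<d} d z" and "x < d" "y < d"
  shows "(\<Sum>i<d. z i x * cnj (z i y)) = (if x = y then 1 else 0)"
proof -
  have "(if x = y then 1 else 0) = (\<Sum>j<d. ipn d (z j) (\<lambda>x. if x = y then 1 else 0) * z j x)"
    using orthonormal_basis_expand[OF z \<open>x < d\<close>, of "\<lambda>x. if x = y then 1 else 0"] by simp
  then show ?thesis using assms by (simp add: unit_delta mult.commute)
qed

lemma eigs_desc_diagonalization:
  assumes A: "A \<in> carrier_mat d d" and z: "orthonormal id {..<d} d z"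
    and kernel: "\<forall>x<d. \<forall>y<d. A $$ (x, y) = (\<Sum>i<d. of_real (\<mu> i) * z i x * cnj (z i y))"
  shows "eigs_desc A = rev (sort (map \<mu> [0..<d]))"
proof -
  define P where "P = mat d d (\<lambda>(x, i). z i x)"
  define Q where "Q = mat d d (\<lambda>(i, x). cnj (z i x))"
  define D where "D = mat d d (\<lambda>(i, j). if i = j then complex_of_real (\<mu> i) else 0)"
  have "similar_mat_wit A D P Q"
  proof (rule similar_mat_witI)
    show "P * Q = 1\<^sub>m d"
      using orthonormal_columns[OF z]
      by (intro eq_matI) (auto simp: P_def Q_def scalar_prod_def lessThan_atLeast0)
    show "Q * P = 1\<^sub>m d"
      using orthonormalD[OF z]
      by (intro eq_matI) (auto simp: P_def Q_def scalar_prod_def lessThan_atLeast0 ip_def)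
    have PD: "P * D = mat d d (\<lambda>(x, i). z i x * of_real (\<mu> i))"
      by (intro eq_matI) (auto simp: P_def D_def scalar_prod_def if_distrib[of "\<lambda>z. _ * z"] cong: if_cong)
    show "A = P * D * Q"
      unfolding PD using A kernel
      by (intro eq_matI) (auto simp: Q_def scalar_prod_def lessThan_atLeast0 mult_ac)
  qed (use A in \<open>auto simp: P_def Q_def D_def\<close>)
  then have "char_poly A = char_poly D" by (intro char_poly_similar) (auto simp: similar_mat_def)
  also have "\<dots> = (\<Prod>a\<leftarrow>diag_mat D. [:- a, 1:])"
    by (rule char_poly_upper_triangular[of _ d]) (auto simp: D_def upper_triangular_def)
  also have "diag_mat D = map (\<lambda>i. of_real (\<mu> i)) [0..<d]"
    by (auto simp: diag_mat_def D_def)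
  finally have cp: "char_poly A = (\<Prod>a\<leftarrow>map (\<lambda>i. complex_of_real (\<mu> i)) [0..<d]. [:- a, 1:])" .
  have pr: "proots (\<Prod>a\<leftarrow>as. [:- a, 1:]) = mset as" for as :: "complex list"
  proof (induction as)
    case (Cons a as)
    have "(\<Prod>a\<leftarrow>as. [:- a, 1:]) \<noteq> 0" by (auto simp: prod_list_zero_iff)
    then show ?case using Cons by (simp add: proots_mult del: mult_pCons_left)
  qed simp
  then have "image_mset Re (proots (char_poly A)) = mset (map \<mu> [0..<d])"
    unfolding cp pr by (simp add: image_mset.compositionality o_def)
  then show ?thesis by (simp only: eigs_desc_def sorted_list_of_multiset_mset)
qed

text \<open>The eigenvectors are permuted so that the i-th one belongs to the i-th entry of the
  sorted list.\<close>

lemma hermitian_spectral: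
  assumes A: "A \<in> carrier_mat d d" and herm: "hermitian d (\<lambda>x y. A $$ (x, y))"
  obtains z where "length (eigs_desc A) = d" "orthonormal id {..<d} d z"
    "\<forall>x<d. \<forall>y<d. A $$ (x, y) = (\<Sum>i<d. of_real (eigs_desc A ! i) * z i x * cnj (z i y))"
proof -
  obtain z \<mu> where z: "orthonormal id {..<d} d z"
    and kernel: "\<forall>x<d. \<forall>y<d. A $$ (x, y) = (\<Sum>i<d. of_real (\<mu> i) * z i x * cnj (z i y))"
    using hermitian_diagonalization[OF herm] by blast
  have eigs: "eigs_desc A = rev (sort (map \<mu> [0..<d]))"
    by (rule eigs_desc_diagonalization[OF A z kernel])
  then have "mset (eigs_desc A) = mset (map \<mu> [0..<d])" by simp
  then obtain p where p: "p permutes {..<d}" "permute_list p (map \<mu> [0..<d]) = eigs_desc A"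
    using mset_eq_permutation by (metis diff_zero length_map length_upt)
  have nth: "eigs_desc A ! i = \<mu> (p i)" if "i < d" for i
  proof -
    have "p i < d" using p(1) that permutes_in_image by fastforce
    then show ?thesis using that p by (simp add: p(2)[symmetric] permute_list_nth)
  qed
  have inj: "p i = p j \<longleftrightarrow> i = j" for i j using permutes_inj[OF p(1)] by (auto dest: injD)
  have lt: "p i < d" if "i < d" for i using p(1) that permutes_in_image by fastforce
  show ?thesis
  proof (rule that[of "\<lambda>i. z (p i)"])
    show "length (eigs_desc A) = d" by (simp add: eigs)
    show "orthonormal id {..<d} d (\<lambda>i. z (p i))"
      using orthonormalD[OF z] lt inj by (simp add: orthonormal_def)
    have "(\<Sum>i<d. of_real (\<mu> i) * z i x * cnj (z i y)) = (\<Sum>i<d. of_real (\<mu> (p i)) * z (p i) x * cnj (z (p i) y))" for x y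
      using sum.permute[OF p(1), of "\<lambda>i. of_real (\<mu> i) * z i x * cnj (z i y)"] by (simp add: o_def)
    then show "\<forall>x<d. \<forall>y<d. A $$ (x, y) = (\<Sum>i<d. of_real (eigs_desc A ! i) * z (p i) x * cnj (z (p i) y))"
      using kernel by (simp add: nth)
  qed
qed

lemma eigs_desc_antimono:
  assumes "i \<le> j" "j < length (eigs_desc A)"
  shows "eigs_desc A ! j \<le> eigs_desc A ! i"
  using assms sorted_wrt_nth_less[of "(\<ge>)" "eigs_desc A" i j]
  by (cases "i = j") (auto simp: eigs_desc_def sorted_wrt_rev)

section \<open>Ky Fan's variational principle\<close>

definition qform :: "nat \<Rightarrow> complex mat \<Rightarrow> (nat \<Rightarrow> complex) \<Rightarrow> complex" where
  "qform d A v = (\<Sum>x<d. \<Sum>y<d. cnj (v x) * A $$ (x, y) * v y)"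

lemma qform_spectral:
  assumes "\<forall>x<d. \<forall>y<d. A $$ (x, y) = (\<Sum>i<d. of_real (l i) * z i x * cnj (z i y))"
  shows "qform d A v = of_real (\<Sum>i<d. l i * (cmod (ipn d (z i) v))\<^sup>2)"
proof -
  have "qform d A v = (\<Sum>x<d. \<Sum>y<d. \<Sum>i<d. of_real (l i) * (cnj (v x) * z i x) * (cnj (z i y) * v y))"
    unfolding qform_def
    by (intro sum.cong refl) (simp add: assms sum_distrib_left sum_distrib_right mult_ac)
  also have "\<dots> = (\<Sum>x<d. \<Sum>i<d. \<Sum>y<d. of_real (l i) * (cnj (v x) * z i x) * (cnj (z i y) * v y))"
    by (intro sum.cong refl sum.swap)
  also have "\<dots> = (\<Sum>i<d. \<Sum>x<d. \<Sum>y<d. of_real (l i) * (cnj (v x) * z i x) * (cnj (z i y) * v y))"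
    by (rule sum.swap)
  also have "\<dots> = (\<Sum>i<d. of_real (l i) * (ipn d v (z i) * ipn d (z i) v))"
    unfolding ip_def sum_product by (simp add: sum_distrib_left mult.assoc)
  also have "\<dots> = (\<Sum>i<d. of_real (l i) * (ipn d (z i) v * cnj (ipn d (z i) v)))"
    by (simp add: ip_cnj mult.commute)
  finally show ?thesis by (simp add: complex_norm_square del: of_real_power)
qed

lemma qform_eigenvector:
  assumes "\<forall>x<d. \<forall>y<d. A $$ (x, y) = (\<Sum>i<d. of_real (l i) * z i x * cnj (z i y))"
    and z: "orthonormal id {..<d} d z" and "j < d"
  shows "qform d A (z j) = of_real (l j)"
proof -
  have "(\<Sum>i<d. l i * (cmod (ipn d (z i) (z j)))\<^sup>2) = (\<Sum>i<d. if i = j then l i else 0)"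
    by (rule sum.cong) (use assms(3) in \<open>auto simp: orthonormalD[OF z]\<close>)
  then show ?thesis using assms(3) by (simp add: qform_spectral[OF assms(1)])
qed

text \<open>Subtracting the threshold l r makes the values before r nonnegative and the later ones
  nonpositive, so weight 1 on the first r is best. What remains is l r times the sum of the weights,
  bounded because l r is nonnegative.\<close>

lemma sum_weights_le:
  fixes l c :: "nat \<Rightarrow> real"
  assumes "\<And>i j. i \<le> j \<Longrightarrow> j < d \<Longrightarrow> l j \<le> l i" "\<And>i. i < d \<Longrightarrow> 0 \<le> l i"
    and c: "\<And>i. i < d \<Longrightarrow> 0 \<le> c i" "\<And>i. i < d \<Longrightarrow> c i \<le> 1" "(\<Sum>i<d. c i) \<le> real r"
  shows "(\<Sum>i<d. l i * c i) \<le> (\<Sum>i<min r d. l i)"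
proof (cases "r < d")
  case False
  have "l i * c i \<le> l i" if "i < d" for i
    using mult_left_mono[OF c(2)[OF that] assms(2)[OF that]] by simp
  then have "(\<Sum>i<d. l i * c i) \<le> (\<Sum>i<d. l i)" by (intro sum_mono) auto
  then show ?thesis using False by (simp add: min_def)
next
  case True
  have "(\<Sum>i<d. (l i - l r) * c i) \<le> (\<Sum>i<d. if i < r then l i - l r else 0)"
  proof (rule sum_mono)
    fix i assume "i \<in> {..<d}"
    then have i: "i < d" by simp
    show "(l i - l r) * c i \<le> (if i < r then l i - l r else 0)"
    proof (cases "i < r")
      case True
      then show ?thesis using assms(1)[of i r] c(2)[OF i] \<open>r < d\<close> mult_left_mono[of "c i" 1 "l i - l r"] by simp
    next
      case False
      then have "l i - l r \<le> 0" using assms(1)[of r i] i by simp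
      then show ?thesis using False c(1)[OF i] by (simp add: mult_nonpos_nonneg)
    qed
  qed
  also have "\<dots> = (\<Sum>i<r. l i - l r)"
    using True by (intro sum.mono_neutral_cong_right) auto
  also have "\<dots> = (\<Sum>i<r. l i) - real r * l r" by (simp add: sum_subtractf)
  finally have "(\<Sum>i<d. l i * c i) \<le> (\<Sum>i<r. l i) - real r * l r + l r * (\<Sum>i<d. c i)"
    by (simp add: algebra_simps sum_subtractf sum_distrib_left)
  moreover have "l r * (\<Sum>i<d. c i) \<le> l r * real r"
    using c(3) assms(2)[OF True] by (rule mult_left_mono)
  ultimately show ?thesis using True by (simp add: min_def mult.commute)
qed

lemma sum_list_take_eigs:
  "length l = d \<Longrightarrow> sum_list (take q l) = (\<Sum>i<min q d. l ! i)"
  by (simp add: sum_list_sum_nth lessThan_atLeast0 min.commute)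

text \<open>The weight c j of the j-th eigenvalue is at most 1 by Bessel for v, and the weights sum
  to at most r by Bessel for z. Allowing r < q covers the case where q exceeds the dimension of the
  symmetric subspace.\<close>

lemma Ky_Fan_le:
  assumes A: "A \<in> carrier_mat d d" "hermitian d (\<lambda>x y. A $$ (x, y))"
    and nonneg: "\<And>i. i < d \<Longrightarrow> 0 \<le> eigs_desc A ! i"
    and v: "orthonormal id {..<d} r v" and "r \<le> q"
  shows "(\<Sum>i<r. Re (qform d A (v i))) \<le> sum_list (take q (eigs_desc A))"
proof -
  obtain z where len: "length (eigs_desc A) = d" and z: "orthonormal id {..<d} d z"
    and kernel: "\<forall>x<d. \<forall>y<d. A $$ (x, y) = (\<Sum>i<d. of_real (eigs_desc A ! i) * z i x * cnj (z i y))"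
    by (rule hermitian_spectral[OF A])
  let ?l = "(!) (eigs_desc A)"
  define c where "c j = (\<Sum>i<r. (cmod (ipn d (z j) (v i)))\<^sup>2)" for j
  have "(\<Sum>i<r. Re (qform d A (v i))) = (\<Sum>i<r. \<Sum>j<d. ?l j * (cmod (ipn d (z j) (v i)))\<^sup>2)"
    by (simp add: qform_spectral[OF kernel] del: of_real_sum)
  also have "\<dots> = (\<Sum>j<d. ?l j * c j)"
    unfolding c_def sum_distrib_left by (rule sum.swap)
  also have "\<dots> \<le> (\<Sum>j<min q d. ?l j)"
  proof (rule sum_weights_le)
    show "?l j \<le> ?l i" if "i \<le> j" "j < d" for i j using eigs_desc_antimono that len by simp
    show "0 \<le> c i" for i by (simp add: c_def sum_nonneg)
    show "c j \<le> 1" if "j < d" for j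
    proof -
      have "c j = (\<Sum>i<r. (cmod (ipn d (v i) (z j)))\<^sup>2)" by (simp add: c_def cmod_ip_commute)
      also have "\<dots> \<le> nsq id {..<d} (z j)" by (rule Bessel[OF v])
      finally show ?thesis using orthonormal_nsq[OF z that] by simp
    qed
    have "(\<Sum>j<d. c j) = (\<Sum>i<r. \<Sum>j<d. (cmod (ipn d (z j) (v i)))\<^sup>2)"
      unfolding c_def by (rule sum.swap)
    also have "\<dots> \<le> (\<Sum>i<r. nsq id {..<d} (v i))" by (intro sum_mono Bessel z)
    also have "\<dots> = real r" by (simp add: orthonormal_nsq[OF v])
    finally show "(\<Sum>j<d. c j) \<le> real q" using assms(5) by simp
  qed (rule nonneg)
  also have "\<dots> = sum_list (take q (eigs_desc A))" by (simp add: sum_list_take_eigs[OF len])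
  finally show ?thesis .
qed

section \<open>The tensor power model\<close>

definition dec :: "nat \<Rightarrow> nat \<Rightarrow> nat \<Rightarrow> nat list" where
  "dec N n i = map (dig N n i) [0..<n]"

lemma length_dec [simp]: "length (dec N n i) = n"
  by (simp add: dec_def)

lemma dec_nth: "t < n \<Longrightarrow> dec N n i ! t = dig N n i t"
  by (simp add: dec_def)

text \<open>With the most significant digit first, the k factors of the identity are read from the
  quotient and the M factors of \<Gamma> from the remainder, as in \<open>id_tensor\<close>.\<close>

lemma dec_append: "dec N (k + M) i = dec N k (i div N ^ M) @ dec N M (i mod N ^ M)"
proof (rule nth_equalityI)
  fix t assume "t < length (dec N (k + M) i)"
  then have t: "t < k + M" by simp
  show "dec N (k + M) i ! t = (dec N k (i div N ^ M) @ dec N M (i mod N ^ M)) ! t"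
  proof (cases "t < k")
    case True
    have e: "k + M - 1 - t = M + (k - 1 - t)" using True by simp
    have "dec N (k + M) i ! t = i div N ^ (k + M - 1 - t) mod N"
      using t by (simp add: dec_nth dig_def)
    also have "\<dots> = i div N ^ M div N ^ (k - 1 - t) mod N"
      by (simp only: e power_add div_mult2_eq)
    finally show ?thesis using True by (simp add: nth_append dec_nth dig_def)
  next
    case False
    define s where "s = t - k"
    have s: "t = k + s" "s < M" using False t by (auto simp: s_def)
    define e where "e = M - 1 - s"
    have M: "M = e + Suc s" using s by (simp add: e_def)
    have "i mod N ^ M div N ^ e mod N = i div N ^ e mod N"
    proof (cases "N = 0")
      case False
      have "i mod N ^ M = N ^ e * (i div N ^ e mod N ^ Suc s) + i mod N ^ e"
        unfolding M power_add by (rule mod_mult2_eq)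
      then have "i mod N ^ M div N ^ e = i div N ^ e mod N ^ Suc s"
        using False by simp
      then show ?thesis by (simp add: mod_mod_cancel)
    qed (simp add: M)
    moreover have "k + M - 1 - t = e" using s by (simp add: e_def)
    ultimately show ?thesis using s by (simp add: nth_append dec_nth dig_def e_def)
  qed
qed simp

lemma bij_dec:
  assumes "1 \<le> N"
  shows "bij_betw (dec N n) {..<N ^ n} (words N n)"
proof -
  have inj: "inj_on (dec N n) {..<N ^ n}"
  proof (induction n)
    case (Suc n)
    show ?case
    proof (rule inj_onI)
      fix i j assume ij: "i \<in> {..<N ^ Suc n}" "j \<in> {..<N ^ Suc n}" "dec N (Suc n) i = dec N (Suc n) j"
      have lt: "i div N ^ n < N" "j div N ^ n < N"
        using ij by (simp_all add: less_mult_imp_div_less)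
      have mods: "dec N 1 (i div N ^ n) = dec N 1 (j div N ^ n)" "dec N n (i mod N ^ n) = dec N n (j mod N ^ n)"
        using ij(3) dec_append[of N 1 n] by simp_all
      from mods(1) have "i div N ^ n = j div N ^ n"
        using lt by (simp add: dec_def dig_def)
      moreover have "i mod N ^ n = j mod N ^ n"
        using inj_onD[OF Suc.IH mods(2)] assms by simp
      ultimately show "i = j" by (metis div_mult_mod_eq)
    qed
  qed (simp add: inj_on_def)
  have "dec N n ` {..<N ^ n} \<subseteq> words N n"
    using assms by (auto simp: words_def dec_def dig_def)
  moreover have "card (dec N n ` {..<N ^ n}) = card (words N n)"
    by (simp add: card_image[OF inj] card_words)
  ultimately have "dec N n ` {..<N ^ n} = words N n"
    by (rule card_subset_eq[OF finite_words])
  then show ?thesis using inj by (simp add: bij_betw_def)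
qed

lemma sum_dec:
  assumes "1 \<le> N"
  shows "(\<Sum>i<N ^ n. F (dec N n i)) = (\<Sum>xs\<in>words N n. F xs)"
  by (rule sum.reindex_bij_betw[OF bij_dec[OF assms]])

lemma sum_div_mod:
  fixes n m :: nat
  shows "(\<Sum>i<n * m. G (i div m) (i mod m)) = (\<Sum>b<n. \<Sum>a<m. G b a)"
proof -
  have "(\<Sum>i\<in>{b * m..<b * m + m}. G (i div m) (i mod m)) = (\<Sum>a<m. G b a)" for b
  proof -
    have "(\<Sum>i\<in>{0 + b * m..<m + b * m}. G (i div m) (i mod m)) = (\<Sum>a\<in>{0..<m}. G ((a + b * m) div m) ((a + b * m) mod m))"
      by (rule sum.shift_bounds_nat_ivl)
    also have "\<dots> = (\<Sum>a\<in>{0..<m}. G b a)"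
      by (rule sum.cong) auto
    finally show ?thesis by (simp add: add.commute lessThan_atLeast0)
  qed
  then show ?thesis using sum.nat_group[of "\<lambda>i. G (i div m) (i mod m)" m n] by simp
qed

definition symvec :: "nat \<Rightarrow> nat \<Rightarrow> (nat multiset \<Rightarrow> complex) \<Rightarrow> nat \<Rightarrow> complex" where
  "symvec N n f i = f (mset (dec N n i))"

lemma ip_symvec:
  assumes "1 \<le> N"
  shows "ipn (N ^ n) (symvec N n f) (symvec N n g) = ip mset (words N n) f g"
  using sum_dec[OF assms, of "\<lambda>xs. cnj (f (mset xs)) * g (mset xs)" n]
  by (simp add: ip_def symvec_def)

lemma orthonormal_symvec:
  assumes "1 \<le> N"
  shows "orthonormal id {..<N ^ n} r (\<lambda>i. symvec N n (f i)) \<longleftrightarrow> orthonormal mset (words N n) r f"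
  by (simp add: orthonormal_def ip_symvec[OF assms])

lemma symvec_add: "symvec N (k + M) f i = f (mset (dec N M (i mod N ^ M)) + mset (dec N k (i div N ^ M)))"
  unfolding symvec_def dec_append mset_append by (simp only: add.commute)

section \<open>The symmetrizer on coordinate vectors\<close>

definition matching_perms :: "nat \<Rightarrow> nat \<Rightarrow> nat \<Rightarrow> nat \<Rightarrow> (nat \<Rightarrow> nat) set" where
  "matching_perms N n i j = {\<sigma>. \<sigma> permutes {..<n} \<and> (\<forall>t<n. dig N n i t = dig N n j (\<sigma> t))}"

lemma finite_matching_perms [simp]: "finite (matching_perms N n i j)"
  by (rule finite_subset[OF _ finite_permutations[of "{..<n}"]]) (auto simp: matching_perms_def)

lemma sym_proj_carrier [simp]: "sym_proj N n \<in> carrier_mat (N ^ n) (N ^ n)"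
  by (simp add: sym_proj_def)

lemma sym_proj_index:
  "i < N ^ n \<Longrightarrow> j < N ^ n \<Longrightarrow> sym_proj N n $$ (i, j) = of_nat (card (matching_perms N n i j)) / fact n"
  by (simp add: sym_proj_def matching_perms_def)

lemma matching_perms_mset:
  assumes "\<sigma> \<in> matching_perms N n i j"
  shows "mset (dec N n i) = mset (dec N n j)"
proof -
  have \<sigma>: "\<sigma> permutes {..<n}" "\<And>t. t < n \<Longrightarrow> dig N n i t = dig N n j (\<sigma> t)"
    using assms by (auto simp: matching_perms_def)
  have lt: "\<sigma> t < n" if "t < n" for t using permutes_in_image[OF \<sigma>(1), of t] that by simp
  have "dec N n i = permute_list \<sigma> (dec N n j)"
    using \<sigma> lt by (intro nth_equalityI) (auto simp: permute_list_nth dec_nth)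
  then show ?thesis using mset_permute_list \<sigma>(1) by (metis length_dec)
qed

lemma card_matching_perms_le:
  assumes "mset (dec N n i) = mset (dec N n i')"
  shows "card (matching_perms N n i' j) \<le> card (matching_perms N n i j)"
proof -
  obtain p where p: "p permutes {..<n}" "permute_list p (dec N n i') = dec N n i"
    using mset_eq_permutation[OF assms] by auto
  have lt: "p t < n" if "t < n" for t using permutes_in_image[OF p(1), of t] that by simp
  have dig: "dig N n i t = dig N n i' (p t)" if "t < n" for t
  proof -
    have "dec N n i ! t = permute_list p (dec N n i') ! t" by (simp add: p(2))
    then show ?thesis using that p(1) lt by (simp add: permute_list_nth dec_nth)
  qed
  have "(\<lambda>\<sigma>. \<sigma> \<circ> p) ` matching_perms N n i' j \<subseteq> matching_perms N n i j"
    using p(1) lt dig by (auto simp: matching_perms_def permutes_compose)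
  moreover have "inj_on (\<lambda>\<sigma>. \<sigma> \<circ> p) (matching_perms N n i' j)"
    by (rule inj_onI) (metis comp_assoc comp_id permutes_inv_o(1)[OF p(1)])
  ultimately show ?thesis by (intro card_inj_on_le) auto
qed

lemma card_matching_perms_swap_le:
  "card (matching_perms N n i j) \<le> card (matching_perms N n j i)"
proof -
  have "inv_into UNIV \<sigma> \<in> matching_perms N n j i" if "\<sigma> \<in> matching_perms N n i j" for \<sigma>
  proof -
    have \<sigma>: "\<sigma> permutes {..<n}" "\<And>t. t < n \<Longrightarrow> dig N n i t = dig N n j (\<sigma> t)"
      using that by (auto simp: matching_perms_def)
    have inv: "inv_into UNIV \<sigma> permutes {..<n}" by (rule permutes_inv[OF \<sigma>(1)])
    have "dig N n j t = dig N n i (inv_into UNIV \<sigma> t)" if "t < n" for t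
      using \<sigma>(2)[of "inv_into UNIV \<sigma> t"] permutes_in_image[OF inv, of t] that by (simp add: permutes_inverses(1)[OF \<sigma>(1)])
    then show ?thesis using inv by (simp add: matching_perms_def)
  qed
  moreover have "inj_on (inv_into UNIV) (matching_perms N n i j)"
    by (rule inj_onI) (metis (mono_tags, lifting) matching_perms_def mem_Collect_eq permutes_inv_inv)
  ultimately show ?thesis by (intro card_inj_on_le[of "inv_into UNIV"]) auto
qed

lemma sym_proj_commute:
  "i < N ^ n \<Longrightarrow> j < N ^ n \<Longrightarrow> sym_proj N n $$ (i, j) = sym_proj N n $$ (j, i)"
  by (simp add: sym_proj_index card_matching_perms_swap_le le_antisym)

lemma hermitian_sym_proj: "hermitian (N ^ n) (\<lambda>x y. sym_proj N n $$ (x, y))"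
  unfolding hermitian_def
proof (intro allI impI)
  fix x y assume "x < N ^ n" "y < N ^ n"
  then show "sym_proj N n $$ (y, x) = cnj (sym_proj N n $$ (x, y))"
    by (subst sym_proj_commute) (auto simp: sym_proj_index)
qed

text \<open>For fixed i each permutation fits exactly one j, the index with the correspondingly
  permuted digits. So the rows of \<open>sym_proj\<close> sum to 1.\<close>

lemma sum_card_matching_perms:
  assumes N: "1 \<le> N"
  shows "(\<Sum>j<N ^ n. card (matching_perms N n i j)) = fact n"
proof -
  have ex1: "\<exists>!j. j < N ^ n \<and> \<sigma> \<in> matching_perms N n i j" if \<sigma>: "\<sigma> permutes {..<n}" for \<sigma>
  proof -
    have inv: "inv_into UNIV \<sigma> permutes {..<n}" by (rule permutes_inv[OF \<sigma>])
    have iff: "\<sigma> \<in> matching_perms N n i j \<longleftrightarrow> dec N n j = permute_list (inv_into UNIV \<sigma>) (dec N n i)" for j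
    proof
      assume "\<sigma> \<in> matching_perms N n i j"
      then have "dig N n j t = dig N n i (inv_into UNIV \<sigma> t)" if "t < n" for t
        using permutes_in_image[OF inv, of t] that
        by (simp add: matching_perms_def permutes_inverses(1)[OF \<sigma>])
      then show "dec N n j = permute_list (inv_into UNIV \<sigma>) (dec N n i)"
        using inv permutes_in_image[OF inv]
        by (intro nth_equalityI) (auto simp: permute_list_nth dec_nth)
    next
      assume eq: "dec N n j = permute_list (inv_into UNIV \<sigma>) (dec N n i)"
      have "dig N n i t = dig N n j (\<sigma> t)" if "t < n" for t
      proof -
        have "\<sigma> t < n" using permutes_in_image[OF \<sigma>, of t] that by simp
        then have "dec N n j ! \<sigma> t = dec N n i ! inv_into UNIV \<sigma> (\<sigma> t)"
          unfolding eq using inv by (simp add: permute_list_nth)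
        then show ?thesis using that \<open>\<sigma> t < n\<close> by (simp add: permutes_inverses(2)[OF \<sigma>] dec_nth)
      qed
      then show "\<sigma> \<in> matching_perms N n i j" using \<sigma> by (simp add: matching_perms_def)
    qed
    have "set (dec N n i) \<subseteq> {..<N}" using N by (auto simp: dec_def dig_def)
    then have "permute_list (inv_into UNIV \<sigma>) (dec N n i) \<in> words N n"
      using inv by (simp add: words_def)
    then have "permute_list (inv_into UNIV \<sigma>) (dec N n i) \<in> dec N n ` {..<N ^ n}"
      using bij_dec[OF N, of n] by (simp add: bij_betw_def)
    then obtain j where "j < N ^ n" "dec N n j = permute_list (inv_into UNIV \<sigma>) (dec N n i)" by auto
    then show ?thesis
      unfolding iff using bij_dec[OF N, of n] by (intro ex1I[of _ j]) (auto simp: bij_betw_def inj_on_def)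
  qed
  have "(\<Sum>j<N ^ n. card (matching_perms N n i j)) = card (\<Union>j\<in>{..<N ^ n}. matching_perms N n i j)"
  proof (rule card_UN_disjoint[symmetric])
    show "\<forall>j\<in>{..<N ^ n}. \<forall>j'\<in>{..<N ^ n}. j \<noteq> j' \<longrightarrow> matching_perms N n i j \<inter> matching_perms N n i j' = {}"
    proof (intro ballI impI equals0I)
      fix j j' \<sigma>
      assume j: "j \<in> {..<N ^ n}" "j' \<in> {..<N ^ n}" "j \<noteq> j'"
        and \<sigma>: "\<sigma> \<in> matching_perms N n i j \<inter> matching_perms N n i j'"
      then have "\<sigma> permutes {..<n}" by (simp add: matching_perms_def)
      from ex1[OF this] show False using j \<sigma> by blast
    qed
  qed auto
  also have "(\<Union>j\<in>{..<N ^ n}. matching_perms N n i j) = {\<sigma>. \<sigma> permutes {..<n}}"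
  proof (intro equalityI subsetI)
    fix \<sigma> assume "\<sigma> \<in> {\<sigma>. \<sigma> permutes {..<n}}"
    then have "\<exists>!j. j < N ^ n \<and> \<sigma> \<in> matching_perms N n i j" using ex1 by simp
    then show "\<sigma> \<in> (\<Union>j\<in>{..<N ^ n}. matching_perms N n i j)" by blast
  qed (auto simp: matching_perms_def)
  also have "card \<dots> = fact n" by (rule card_permutations) auto
  finally show ?thesis .
qed

lemma act_sym_proj_symvec:
  assumes "1 \<le> N" "i < N ^ n"
  shows "act (N ^ n) (\<lambda>x y. sym_proj N n $$ (x, y)) (symvec N n f) i = symvec N n f i"
proof -
  have "sym_proj N n $$ (i, j) * symvec N n f j = of_nat (card (matching_perms N n i j)) * (symvec N n f i / fact n)"
    if "j < N ^ n" for j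
  proof (cases "matching_perms N n i j = {}")
    case False
    then obtain \<sigma> where "\<sigma> \<in> matching_perms N n i j" by blast
    then show ?thesis using matching_perms_mset that assms(2) by (simp add: sym_proj_index symvec_def)
  qed (use that assms(2) in \<open>simp add: sym_proj_index\<close>)
  then have "act (N ^ n) (\<lambda>x y. sym_proj N n $$ (x, y)) (symvec N n f) i =
      of_nat (\<Sum>j<N ^ n. card (matching_perms N n i j)) * (symvec N n f i / fact n)"
    by (simp add: act_def sum_distrib_right sum_divide_distrib)
  then show ?thesis by (simp add: sum_card_matching_perms[OF assms(1)])
qed

text \<open>Rows of \<open>sym_proj\<close> agree when their indices have the same multiset of
  digits, so every image is symmetric. Together with \<open>act_sym_proj_symvec\<close> and
  hermiticity this expresses that P is the orthogonal projection onto the symmetric tensors.\<close>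

lemma act_sym_proj_range:
  "\<exists>f. \<forall>i<N ^ n. act (N ^ n) (\<lambda>x y. sym_proj N n $$ (x, y)) g i = symvec N n f i"
proof -
  let ?P = "act (N ^ n) (\<lambda>x y. sym_proj N n $$ (x, y)) g"
  have inv: "?P i = ?P i'" if "i < N ^ n" "i' < N ^ n" "mset (dec N n i) = mset (dec N n i')" for i i'
    unfolding act_def
  proof (intro sum.cong refl)
    fix j assume "j \<in> {..<N ^ n}"
    moreover have "card (matching_perms N n i j) = card (matching_perms N n i' j)"
      using card_matching_perms_le that(3) by (metis le_antisym)
    ultimately show "sym_proj N n $$ (i, j) * g j = sym_proj N n $$ (i', j) * g j"
      using that by (simp add: sym_proj_index)
  qed
  \<comment> \<open>Any index with digit multiset X may represent it; on all other multisets the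
    value is arbitrary.\<close>
  define f where "f X = ?P (SOME i. i < N ^ n \<and> mset (dec N n i) = X)" for X
  have "?P i = symvec N n f i" if "i < N ^ n" for i
    unfolding symvec_def f_def
    using that by (intro inv) (metis (mono_tags, lifting) someI_ex)+
  then show ?thesis by blast
qed

lemma index_mult_mat_sum:
  assumes "A \<in> carrier_mat d d" "B \<in> carrier_mat d d" "x < d" "y < d"
  shows "(A * B) $$ (x, y) = (\<Sum>j<d. A $$ (x, j) * B $$ (j, y))"
  using assms by (simp add: scalar_prod_def lessThan_atLeast0)

lemma act_mult:
  assumes "A \<in> carrier_mat d d" "B \<in> carrier_mat d d" "x < d"
  shows "act d (\<lambda>x y. (A * B) $$ (x, y)) v x = act d (\<lambda>x y. A $$ (x, y)) (act d (\<lambda>x y. B $$ (x, y)) v) x"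
proof -
  have "act d (\<lambda>x y. (A * B) $$ (x, y)) v x = (\<Sum>y<d. \<Sum>j<d. A $$ (x, j) * B $$ (j, y) * v y)"
    unfolding act_def using assms
    by (intro sum.cong refl) (simp add: scalar_prod_def lessThan_atLeast0 sum_distrib_right)
  also have "\<dots> = (\<Sum>j<d. \<Sum>y<d. A $$ (x, j) * B $$ (j, y) * v y)" by (rule sum.swap)
  finally show ?thesis by (simp add: act_def sum_distrib_left mult.assoc)
qed

lemma qform_eq_ip: "qform d A v = ipn d v (act d (\<lambda>x y. A $$ (x, y)) v)"
  by (simp add: qform_def ip_def act_def sum_distrib_left mult.assoc)

lemma qform_cong: "(\<And>y. y < d \<Longrightarrow> f y = g y) \<Longrightarrow> qform d A f = qform d A g"
  by (auto simp: qform_def)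

lemma hermitian_sandwich:
  assumes P: "P \<in> carrier_mat d d" "hermitian d (\<lambda>x y. P $$ (x, y))"
    and T: "T \<in> carrier_mat d d" "hermitian d (\<lambda>x y. T $$ (x, y))"
  shows "hermitian d (\<lambda>x y. (P * T * P) $$ (x, y))"
  unfolding hermitian_def
proof (intro allI impI)
  fix x y assume x: "x < d" and y: "y < d"
  have entry: "(P * T * P) $$ (x, y) = (\<Sum>j<d. \<Sum>i<d. P $$ (x, i) * T $$ (i, j) * P $$ (j, y))"
    if "x < d" "y < d" for x y
  proof -
    have "(P * T * P) $$ (x, y) = (\<Sum>j<d. (P * T) $$ (x, j) * P $$ (j, y))"
      using P T that by (intro index_mult_mat_sum) auto
    also have "\<dots> = (\<Sum>j<d. (\<Sum>i<d. P $$ (x, i) * T $$ (i, j)) * P $$ (j, y))"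
    proof (rule sum.cong[OF refl])
      fix j assume "j \<in> {..<d}"
      then show "(P * T) $$ (x, j) * P $$ (j, y) = (\<Sum>i<d. P $$ (x, i) * T $$ (i, j)) * P $$ (j, y)"
        using index_mult_mat_sum[OF P(1) T(1) that(1), of j] by simp
    qed
    finally show ?thesis by (simp only: sum_distrib_right)
  qed
  have "cnj ((P * T * P) $$ (x, y)) = (\<Sum>j<d. \<Sum>i<d. cnj (P $$ (x, i)) * cnj (T $$ (i, j)) * cnj (P $$ (j, y)))"
    by (simp add: entry x y)
  also have "\<dots> = (\<Sum>j<d. \<Sum>i<d. P $$ (y, j) * T $$ (j, i) * P $$ (i, x))"
  proof (intro sum.cong refl)
    fix i j assume "j \<in> {..<d}" "i \<in> {..<d}"
    then have ij: "i < d" "j < d" by auto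
    have "P $$ (i, x) = cnj (P $$ (x, i))" "T $$ (j, i) = cnj (T $$ (i, j))" "P $$ (y, j) = cnj (P $$ (j, y))"
      using P(2) T(2) x y ij unfolding hermitian_def by blast+
    then show "cnj (P $$ (x, i)) * cnj (T $$ (i, j)) * cnj (P $$ (j, y)) = P $$ (y, j) * T $$ (j, i) * P $$ (i, x)"
      by simp
  qed
  also have "\<dots> = (P * T * P) $$ (y, x)"
    by (simp add: entry x y) (rule sum.swap)
  finally show "(P * T * P) $$ (y, x) = cnj ((P * T * P) $$ (x, y))" ..
qed

lemma qform_sandwich:
  assumes P: "P \<in> carrier_mat d d" "hermitian d (\<lambda>x y. P $$ (x, y))" and T: "T \<in> carrier_mat d d"
  shows "qform d (P * T * P) v = qform d T (act d (\<lambda>x y. P $$ (x, y)) v)"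
proof -
  let ?P = "act d (\<lambda>x y. P $$ (x, y))" and ?T = "act d (\<lambda>x y. T $$ (x, y))"
  have "act d (\<lambda>x y. (P * T * P) $$ (x, y)) v x = ?P (?T (?P v)) x" if "x < d" for x
  proof -
    have "act d (\<lambda>x y. (P * T * P) $$ (x, y)) v x = act d (\<lambda>x y. (P * T) $$ (x, y)) (?P v) x"
      using P T that by (intro act_mult) auto
    also have "\<dots> = ?P (?T (?P v)) x" using P T that by (intro act_mult) auto
    finally show ?thesis .
  qed
  then have "qform d (P * T * P) v = ipn d v (?P (?T (?P v)))"
    unfolding qform_eq_ip by (intro ip_cong) auto
  then show ?thesis by (simp add: ip_act_hermitian[OF P(2)] qform_eq_ip)
qed

text \<open>The weights are absorbed into the symmetric tensors \<phi> l, which are therefore not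
  normalized.\<close>

definition factored :: "nat \<Rightarrow> nat \<Rightarrow> nat \<Rightarrow> (nat \<Rightarrow> nat multiset \<Rightarrow> complex) \<Rightarrow> complex mat \<Rightarrow> bool" where
  "factored N M D \<phi> \<Gamma> \<longleftrightarrow> \<Gamma> \<in> carrier_mat (N ^ M) (N ^ M) \<and>
     (\<forall>x<N ^ M. \<forall>y<N ^ M. \<Gamma> $$ (x, y) = (\<Sum>l<D. symvec N M (\<phi> l) x * cnj (symvec N M (\<phi> l) y)))"

lemma factored_trace:
  assumes "1 \<le> N" "factored N M D \<phi> \<Gamma>"
  shows "mtrace \<Gamma> = of_real (\<Sum>l<D. nsq mset (words N M) (\<phi> l))"
proof -
  have "mtrace \<Gamma> = (\<Sum>x<N ^ M. \<Sum>l<D. symvec N M (\<phi> l) x * cnj (symvec N M (\<phi> l) x))"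
    using assms(2) by (auto simp: mtrace_def factored_def)
  also have "\<dots> = (\<Sum>l<D. ipn (N ^ M) (symvec N M (\<phi> l)) (symvec N M (\<phi> l)))"
    by (subst sum.swap) (simp add: ip_def mult.commute)
  finally show ?thesis unfolding ip_symvec[OF assms(1)] unfolding ip_self of_real_sum .
qed

lemma factored_hermitian: "factored N M D \<phi> \<Gamma> \<Longrightarrow> hermitian (N ^ M) (\<lambda>x y. \<Gamma> $$ (x, y))"
  by (auto simp: factored_def hermitian_def mult.commute)

lemma id_tensor_carrier [simp]: "id_tensor N M k \<Gamma> \<in> carrier_mat (N ^ (k + M)) (N ^ (k + M))"
  by (simp add: id_tensor_def)

lemma hermitian_id_tensor:
  assumes N: "1 \<le> N" and "hermitian (N ^ M) (\<lambda>x y. \<Gamma> $$ (x, y))"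
  shows "hermitian (N ^ (k + M)) (\<lambda>x y. id_tensor N M k \<Gamma> $$ (x, y))"
proof -
  have lt: "x mod N ^ M < N ^ M" for x using N by simp
  have *: "cnj (\<Gamma> $$ (x mod N ^ M, y mod N ^ M)) = \<Gamma> $$ (y mod N ^ M, x mod N ^ M)" for x y
    using assms(2) lt[of x] lt[of y] unfolding hermitian_def by (metis complex_cnj_cnj)
  show ?thesis unfolding hermitian_def
  proof (intro allI impI)
    fix x y assume "x < N ^ (k + M)" "y < N ^ (k + M)"
    then show "id_tensor N M k \<Gamma> $$ (y, x) = cnj (id_tensor N M k \<Gamma> $$ (x, y))"
      by (simp add: id_tensor_def *)
  qed
qed

text \<open>For a fixed high part b of the index, \<Gamma> acts on the slice of f at b, and each
  rank one term contributes the squared modulus of the contraction at b.\<close>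

lemma qform_id_tensor:
  assumes N: "1 \<le> N" and \<Gamma>: "factored N M D \<phi> \<Gamma>"
  shows "qform (N ^ (k + M)) (id_tensor N M k \<Gamma>) (symvec N (k + M) f) =
    of_real (\<Sum>l<D. nsq mset (words N k) (contract N M (\<phi> l) f))"
proof -
  define F where "F b a = f (mset (dec N M a) + mset (dec N k b))" for b a
  have v: "symvec N (k + M) f i = F (i div N ^ M) (i mod N ^ M)" for i
    by (simp add: symvec_add F_def)
  have d: "N ^ (k + M) = N ^ k * N ^ M" by (simp add: power_add)
  have pos: "0 < N ^ M" using N by simp
  have \<Gamma>': "\<Gamma> $$ (x, y) = (\<Sum>l<D. symvec N M (\<phi> l) x * cnj (symvec N M (\<phi> l) y))" if "x < N ^ M" "y < N ^ M" for x y
    using \<Gamma> that by (simp add: factored_def)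
  have "qform (N ^ (k + M)) (id_tensor N M k \<Gamma>) (symvec N (k + M) f) =
     (\<Sum>i<N ^ k * N ^ M. \<Sum>j<N ^ k * N ^ M. cnj (F (i div N ^ M) (i mod N ^ M)) *
        (if i div N ^ M = j div N ^ M then \<Gamma> $$ (i mod N ^ M, j mod N ^ M) else 0) * F (j div N ^ M) (j mod N ^ M))"
    unfolding qform_def d[symmetric] by (intro sum.cong refl) (simp add: v id_tensor_def)
  also have "\<dots> = (\<Sum>i<N ^ k * N ^ M. \<Sum>b'<N ^ k. \<Sum>a'<N ^ M. cnj (F (i div N ^ M) (i mod N ^ M)) *
        (if i div N ^ M = b' then \<Gamma> $$ (i mod N ^ M, a') else 0) * F b' a')"
    by (intro sum.cong refl sum_div_mod)
  also have "\<dots> = (\<Sum>b<N ^ k. \<Sum>a<N ^ M. \<Sum>b'<N ^ k. \<Sum>a'<N ^ M. cnj (F b a) *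
        (if b = b' then \<Gamma> $$ (a, a') else 0) * F b' a')"
    by (rule sum_div_mod)
  also have "\<dots> = (\<Sum>b<N ^ k. \<Sum>a<N ^ M. \<Sum>b'<N ^ k. if b' = b then \<Sum>a'<N ^ M. cnj (F b a) * \<Gamma> $$ (a, a') * F b a' else 0)"
    by (rule sum.cong[OF refl], rule sum.cong[OF refl], rule sum.cong[OF refl]) auto
  also have "\<dots> = (\<Sum>b<N ^ k. \<Sum>a<N ^ M. \<Sum>a'<N ^ M. cnj (F b a) * \<Gamma> $$ (a, a') * F b a')"
    by (rule sum.cong[OF refl], rule sum.cong[OF refl]) simp
  also have "\<dots> = (\<Sum>b<N ^ k. \<Sum>a<N ^ M. \<Sum>a'<N ^ M. \<Sum>l<D.
        (cnj (F b a) * symvec N M (\<phi> l) a) * (cnj (symvec N M (\<phi> l) a') * F b a'))"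
    by (intro sum.cong refl) (simp add: \<Gamma>' sum_distrib_left sum_distrib_right mult_ac)
  also have "\<dots> = (\<Sum>b<N ^ k. \<Sum>l<D. (\<Sum>a<N ^ M. cnj (F b a) * symvec N M (\<phi> l) a) * (\<Sum>a'<N ^ M. cnj (symvec N M (\<phi> l) a') * F b a'))"
  proof (rule sum.cong[OF refl])
    fix b
    let ?t = "\<lambda>a a' l. (cnj (F b a) * symvec N M (\<phi> l) a) * (cnj (symvec N M (\<phi> l) a') * F b a')"
    have "(\<Sum>a<N ^ M. \<Sum>a'<N ^ M. \<Sum>l<D. ?t a a' l) = (\<Sum>a<N ^ M. \<Sum>l<D. \<Sum>a'<N ^ M. ?t a a' l)"
      by (intro sum.cong refl sum.swap)
    also have "\<dots> = (\<Sum>l<D. \<Sum>a<N ^ M. \<Sum>a'<N ^ M. ?t a a' l)" by (rule sum.swap)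
    finally show "(\<Sum>a<N ^ M. \<Sum>a'<N ^ M. \<Sum>l<D. ?t a a' l) =
        (\<Sum>l<D. (\<Sum>a<N ^ M. cnj (F b a) * symvec N M (\<phi> l) a) * (\<Sum>a'<N ^ M. cnj (symvec N M (\<phi> l) a') * F b a'))"
      by (simp add: sum_product)
  qed
  also have "\<dots> = (\<Sum>b<N ^ k. \<Sum>l<D. of_real ((cmod (contract N M (\<phi> l) f (mset (dec N k b))))\<^sup>2))"
  proof (intro sum.cong refl)
    fix b l
    have "(\<Sum>a'<N ^ M. cnj (symvec N M (\<phi> l) a') * F b a') = contract N M (\<phi> l) f (mset (dec N k b))"
      unfolding contract_def symvec_def F_def
      by (rule sum_dec[OF N, of "\<lambda>a. cnj (\<phi> l (mset a)) * f (mset a + mset (dec N k b))"])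
    moreover have "(\<Sum>a<N ^ M. cnj (F b a) * symvec N M (\<phi> l) a) = cnj (\<Sum>a'<N ^ M. cnj (symvec N M (\<phi> l) a') * F b a')"
      by (simp add: mult.commute)
    ultimately show "(\<Sum>a<N ^ M. cnj (F b a) * symvec N M (\<phi> l) a) * (\<Sum>a'<N ^ M. cnj (symvec N M (\<phi> l) a') * F b a')
        = of_real ((cmod (contract N M (\<phi> l) f (mset (dec N k b))))\<^sup>2)"
      unfolding complex_norm_square by (simp only: mult.commute)
  qed
  also have "\<dots> = (\<Sum>l<D. \<Sum>b<N ^ k. of_real ((cmod (contract N M (\<phi> l) f (mset (dec N k b))))\<^sup>2))"
    by (rule sum.swap)
  also have "\<dots> = of_real (\<Sum>l<D. nsq mset (words N k) (contract N M (\<phi> l) f))"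
    unfolding of_real_sum nsq_def by (intro sum.cong refl) (rule sum_dec[OF N, of "\<lambda>b. of_real ((cmod (contract N M _ f (mset b)))\<^sup>2)"])
  finally show ?thesis .
qed

section \<open>Majorization of lifted operators\<close>

lemma act_sandwich:
  assumes "P \<in> carrier_mat d d" "T \<in> carrier_mat d d" "x < d"
  shows "act d (\<lambda>x y. (P * T * P) $$ (x, y)) v x =
    act d (\<lambda>x y. P $$ (x, y)) (act d (\<lambda>x y. T $$ (x, y)) (act d (\<lambda>x y. P $$ (x, y)) v)) x"
proof -
  have "act d (\<lambda>x y. (P * T * P) $$ (x, y)) v x = act d (\<lambda>x y. (P * T) $$ (x, y)) (act d (\<lambda>x y. P $$ (x, y)) v) x"
    using assms by (intro act_mult) auto
  also have "\<dots> = act d (\<lambda>x y. P $$ (x, y)) (act d (\<lambda>x y. T $$ (x, y)) (act d (\<lambda>x y. P $$ (x, y)) v)) x"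
    using assms by (intro act_mult) auto
  finally show ?thesis .
qed

lemma act_eigenvector:
  assumes kernel: "\<forall>x<d. \<forall>y<d. A $$ (x, y) = (\<Sum>i<d. of_real (l i) * z i x * cnj (z i y))"
    and z: "orthonormal id {..<d} d z" and "j < d" "x < d"
  shows "act d (\<lambda>x y. A $$ (x, y)) (z j) x = of_real (l j) * z j x"
proof -
  have "act d (\<lambda>x y. A $$ (x, y)) (z j) x = (\<Sum>y<d. \<Sum>i<d. of_real (l i) * z i x * (cnj (z i y) * z j y))"
    using assms(4) kernel by (simp add: act_def sum_distrib_right mult.assoc)
  also have "\<dots> = (\<Sum>i<d. of_real (l i) * z i x * ipn d (z i) (z j))"
    unfolding ip_def sum_distrib_left by (subst sum.swap) simp
  also have "\<dots> = (\<Sum>i<d. if i = j then of_real (l i) * z i x else 0)"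
    by (intro sum.cong refl) (simp add: orthonormalD[OF z] assms(3))
  finally show ?thesis using assms(3) by simp
qed

lemma qform_smult: "A \<in> carrier_mat d d \<Longrightarrow> qform d (c \<cdot>\<^sub>m A) v = c * qform d A v"
  by (auto simp: qform_def sum_distrib_left mult_ac intro!: sum.cong)

lemma act_smult:
  "A \<in> carrier_mat d d \<Longrightarrow> x < d \<Longrightarrow> act d (\<lambda>x y. (c \<cdot>\<^sub>m A) $$ (x, y)) v x = c * act d (\<lambda>x y. A $$ (x, y)) v x"
  by (auto simp: act_def sum_distrib_left mult_ac intro!: sum.cong)

lemma hermitian_smult:
  assumes "A \<in> carrier_mat d d" "hermitian d (\<lambda>x y. A $$ (x, y))"
  shows "hermitian d (\<lambda>x y. (of_real c \<cdot>\<^sub>m A) $$ (x, y))"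
  unfolding hermitian_def
proof (intro allI impI)
  fix x y assume xy: "x < d" "y < d"
  then have "A $$ (y, x) = cnj (A $$ (x, y))" using assms(2) unfolding hermitian_def by blast
  then show "(of_real c \<cdot>\<^sub>m A) $$ (y, x) = cnj ((of_real c \<cdot>\<^sub>m A) $$ (x, y))"
    using assms(1) xy by simp
qed

lemma symvec_scale: "symvec N n (\<lambda>X. c * f X) x = c * symvec N n f x"
  by (simp add: symvec_def)

lemma contract_scale_left: "contract N M (\<lambda>X. c * f X) v B = cnj c * contract N M f v B"
  by (simp add: contract_def sum_distrib_left mult.assoc)

lemma orthonormal_cong:
  "(\<And>i x. i < r \<Longrightarrow> x \<in> I \<Longrightarrow> v i (\<pi> x) = w i (\<pi> x)) \<Longrightarrow> orthonormal \<pi> I r v \<longleftrightarrow> orthonormal \<pi> I r w"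
  unfolding orthonormal_def ip_def by simp

lemma sdim_pos:
  assumes "1 \<le> N"
  shows "0 < sdim N n"
proof -
  have "replicate_mset n 0 \<in> msets N n" using assms by (auto simp: in_msets_iff split: if_splits)
  then show ?thesis by (auto simp: sdim_def card_gt_0_iff)
qed

lemma kyfan_1:
  assumes "1 \<le> N" "M \<le> n"
  shows "kyfan N n M 1 = 1"
proof -
  have "lev N 0 = 0" using lev_le[OF sdim_pos[OF assms(1), of 0]] by simp
  then show ?thesis using assms(2) by (simp add: kyfan_def)
qed

text \<open>Used for both sides of the majorization: for \<Gamma> with its scaled eigenvectors as
  \<phi>, and for the coherent competitor with D = 1.\<close>

locale lifted =
  fixes N M k D :: nat and \<phi> :: "nat \<Rightarrow> nat multiset \<Rightarrow> complex" and \<Gamma> :: "complex mat"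
  assumes N: "1 \<le> N" and fac: "factored N M D \<phi> \<Gamma>"
begin

abbreviation (input) "n \<equiv> k + M"
abbreviation (input) "d \<equiv> N ^ (k + M)"
abbreviation (input) "L \<equiv> lift_op N M k \<Gamma>"
text \<open>The prefactor of the lift, common to both sides, as opposed to the contraction called C
  in the overview.\<close>

definition "C = (fact (k + M) / fact M :: real)"
definition "tr = (\<Sum>l<D. nsq mset (words N M) (\<phi> l))"

abbreviation (input) "S \<equiv> sym_proj N n * id_tensor N M k \<Gamma> * sym_proj N n"

lemma C_pos: "0 < C" by (simp add: C_def)

lemma tr_nonneg: "0 \<le> tr" by (simp add: tr_def sum_nonneg)

lemma lift_eq: "L = of_real C \<cdot>\<^sub>m S"
  by (simp add: lift_op_def C_def add.commute[of M k])

lemma S_carrier: "S \<in> carrier_mat d d"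
  by (intro mult_carrier_mat[of _ d d] sym_proj_carrier id_tensor_carrier)

lemma lift_carrier: "L \<in> carrier_mat d d"
  unfolding lift_eq using S_carrier by (rule smult_carrier_mat)

lemma lift_hermitian: "hermitian d (\<lambda>x y. L $$ (x, y))"
proof -
  have "hermitian d (\<lambda>x y. S $$ (x, y))"
    by (intro hermitian_sandwich sym_proj_carrier id_tensor_carrier hermitian_sym_proj
        hermitian_id_tensor N factored_hermitian[OF fac])
  then show ?thesis unfolding lift_eq by (rule hermitian_smult[OF S_carrier])
qed

lemma qform_lift:
  assumes "\<forall>i<d. act d (\<lambda>x y. sym_proj N n $$ (x, y)) v i = symvec N n f i"
  shows "qform d L v = of_real (C * (\<Sum>l<D. nsq mset (words N k) (contract N M (\<phi> l) f)))"
proof -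
  have "qform d S v = qform d (id_tensor N M k \<Gamma>) (symvec N n f)"
    unfolding qform_sandwich[OF sym_proj_carrier hermitian_sym_proj id_tensor_carrier]
    by (rule qform_cong) (use assms in simp)
  then show ?thesis
    unfolding lift_eq qform_smult[OF S_carrier] by (simp add: qform_id_tensor[OF N fac])
qed

lemma qform_lift_symvec:
  "qform d L (symvec N n f) = of_real (C * (\<Sum>l<D. nsq mset (words N k) (contract N M (\<phi> l) f)))"
  by (rule qform_lift) (simp add: act_sym_proj_symvec[OF N])

lemma qform_lift_nonneg: "0 \<le> Re (qform d L v)"
proof -
  obtain f where f: "\<forall>i<d. act d (\<lambda>x y. sym_proj N n $$ (x, y)) v i = symvec N n f i"
    using act_sym_proj_range by blast
  show ?thesis unfolding qform_lift[OF f] using C_pos by (simp add: sum_nonneg)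
qed

lemma act_lift_range: "\<exists>f. \<forall>x<d. act d (\<lambda>x y. L $$ (x, y)) v x = symvec N n f x"
proof -
  let ?P = "act d (\<lambda>x y. sym_proj N n $$ (x, y))"
  let ?g = "act d (\<lambda>x y. id_tensor N M k \<Gamma> $$ (x, y)) (?P v)"
  obtain f where "\<forall>i<d. ?P ?g i = symvec N n f i" using act_sym_proj_range by blast
  then have "act d (\<lambda>x y. L $$ (x, y)) v x = symvec N n (\<lambda>X. of_real C * f X) x" if "x < d" for x
    unfolding lift_eq act_smult[OF S_carrier that]
    using that by (simp add: act_sandwich[OF sym_proj_carrier id_tensor_carrier] symvec_scale)
  then show ?thesis by blast
qed

lemma length_eigs: "length (eigs_desc L) = d"
  by (rule hermitian_spectral[OF lift_carrier lift_hermitian])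

lemma eigs_nonneg: "i < d \<Longrightarrow> 0 \<le> eigs_desc L ! i"
proof -
  assume i: "i < d"
  obtain z where z: "orthonormal id {..<d} d z"
    and kernel: "\<forall>x<d. \<forall>y<d. L $$ (x, y) = (\<Sum>i<d. of_real (eigs_desc L ! i) * z i x * cnj (z i y))"
    by (rule hermitian_spectral[OF lift_carrier lift_hermitian])
  show ?thesis using qform_lift_nonneg[of "z i"] qform_eigenvector[OF kernel z i] by simp
qed

text \<open>For a positive eigenvalue, z i is a multiple of its image under L, and the range of L
  consists of symmetric tensors. Eigenvectors for zero may lie outside the symmetric
  subspace.\<close>

lemma ex_symmetric_eigenframe:
  "\<exists>f. (\<forall>r. r \<le> d \<longrightarrow> (\<forall>i<r. 0 < eigs_desc L ! i) \<longrightarrow> orthonormal mset (words N n) r f) \<and>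
     (\<forall>i<d. 0 < eigs_desc L ! i \<longrightarrow>
        eigs_desc L ! i = C * (\<Sum>l<D. nsq mset (words N k) (contract N M (\<phi> l) (f i))))"
proof -
  obtain z where z: "orthonormal id {..<d} d z"
    and kernel: "\<forall>x<d. \<forall>y<d. L $$ (x, y) = (\<Sum>i<d. of_real (eigs_desc L ! i) * z i x * cnj (z i y))"
    by (rule hermitian_spectral[OF lift_carrier lift_hermitian])
  have "\<exists>f. i < d \<longrightarrow> 0 < eigs_desc L ! i \<longrightarrow> (\<forall>x<d. z i x = symvec N n f x)" for i
  proof -
    obtain g where g: "\<forall>x<d. act d (\<lambda>x y. L $$ (x, y)) (z i) x = symvec N n g x"
      using act_lift_range by blast
    have "z i x = symvec N n (\<lambda>X. of_real (1 / eigs_desc L ! i) * g X) x"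
      if "i < d" "0 < eigs_desc L ! i" "x < d" for x
    proof -
      have "of_real (eigs_desc L ! i) * z i x = symvec N n g x"
        using g that(3) act_eigenvector[OF kernel z that(1,3)] by simp
      then show ?thesis using that(2) unfolding symvec_scale by (simp add: field_simps)
    qed
    then show ?thesis by blast
  qed
  then obtain f where f: "\<And>i x. i < d \<Longrightarrow> 0 < eigs_desc L ! i \<Longrightarrow> x < d \<Longrightarrow> z i x = symvec N n (f i) x"
    by metis
  have "orthonormal mset (words N n) r f" if "r \<le> d" "\<forall>i<r. 0 < eigs_desc L ! i" for r
  proof -
    have "orthonormal id {..<d} r z \<longleftrightarrow> orthonormal id {..<d} r (\<lambda>i. symvec N n (f i))"
      by (rule orthonormal_cong) (use f that in auto)
    then show ?thesis using orthonormal_mono[OF z that(1)] orthonormal_symvec[OF N] by blast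
  qed
  moreover have "eigs_desc L ! i = C * (\<Sum>l<D. nsq mset (words N k) (contract N M (\<phi> l) (f i)))"
    if "i < d" "0 < eigs_desc L ! i" for i
  proof -
    have "complex_of_real (eigs_desc L ! i) = qform d L (z i)"
      by (simp add: qform_eigenvector[OF kernel z that(1)])
    also have "\<dots> = qform d L (symvec N n (f i))" by (rule qform_cong) (use f that in auto)
    finally show ?thesis unfolding qform_lift_symvec of_real_eq_iff .
  qed
  ultimately show ?thesis by blast
qed

lemma sum_nsq_contract_le:
  assumes "orthonormal mset (words N n) r f"
  shows "(\<Sum>i<r. \<Sum>l<D. nsq mset (words N k) (contract N M (\<phi> l) (f i))) \<le> tr * kyfan N n M r"
proof -
  have "(\<Sum>i<r. \<Sum>l<D. nsq mset (words N k) (contract N M (\<phi> l) (f i)))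
     = (\<Sum>l<D. \<Sum>i<r. nsq mset (words N (n - M)) (contract N M (\<phi> l) (f i)))"
    by (subst sum.swap) simp
  also have "\<dots> \<le> (\<Sum>l<D. nsq mset (words N M) (\<phi> l) * kyfan N n M r)"
    by (intro sum_mono kyfan_upper[OF N _ assms]) simp
  finally show ?thesis by (simp add: tr_def sum_distrib_right)
qed

text \<open>The positive entries among the first q form an initial segment of some length r, and r
  is at most \<open>sdim N n\<close> because their eigenvectors are symmetric and
  orthonormal.\<close>

lemma sum_take_eigs_le:
  "sum_list (take q (eigs_desc L)) \<le> C * tr * kyfan N n M (min q (sdim N n))"
proof -
  obtain f where on: "\<And>r. r \<le> d \<Longrightarrow> (\<forall>i<r. 0 < eigs_desc L ! i) \<Longrightarrow> orthonormal mset (words N n) r f"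
    and eig: "\<And>i. i < d \<Longrightarrow> 0 < eigs_desc L ! i \<Longrightarrow>
        eigs_desc L ! i = C * (\<Sum>l<D. nsq mset (words N k) (contract N M (\<phi> l) (f i)))"
    using ex_symmetric_eigenframe by blast
  define A where "A = {i \<in> {..<min q d}. 0 < eigs_desc L ! i}"
  define r where "r = card A"
  have "i \<in> A" if "j \<in> A" "i \<le> j" for i j
    using that eigs_desc_antimono[of i j L] length_eigs by (auto simp: A_def)
  moreover have "finite A" by (simp add: A_def)
  ultimately have A: "i \<in> A \<longleftrightarrow> i < r" for i
    unfolding r_def by (rule down_closed_eq_lessThan[rotated])
  then have "A = {..<r}" by auto
  have "card A \<le> card {..<min q d}" by (rule card_mono) (auto simp: A_def)
  then have rq: "r \<le> min q d" by (simp add: r_def)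
  have pos: "\<forall>i<r. 0 < eigs_desc L ! i"
  proof (intro allI impI)
    fix i assume "i < r"
    then have "i \<in> A" by (simp add: A)
    then show "0 < eigs_desc L ! i" by (simp add: A_def)
  qed
  have onr: "orthonormal mset (words N n) r f" using on rq pos by simp
  have "sum_list (take q (eigs_desc L)) = (\<Sum>i<min q d. eigs_desc L ! i)"
    by (rule sum_list_take_eigs[OF length_eigs])
  also have "\<dots> = (\<Sum>i\<in>A. eigs_desc L ! i)"
    using eigs_nonneg by (intro sum.mono_neutral_right) (force simp: A_def)+
  also have "\<dots> = (\<Sum>i<r. C * (\<Sum>l<D. nsq mset (words N k) (contract N M (\<phi> l) (f i))))"
    unfolding \<open>A = {..<r}\<close> using eig pos rq by (intro sum.cong) auto
  also have "\<dots> \<le> C * (tr * kyfan N n M r)"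
    unfolding sum_distrib_left[symmetric] using sum_nsq_contract_le[OF onr] C_pos by simp
  also have "\<dots> \<le> C * (tr * kyfan N n M (min q (sdim N n)))"
    using orthonormal_le_sdim[OF N onr] rq C_pos tr_nonneg
    by (intro mult_left_mono kyfan_mono) auto
  finally show ?thesis by (simp add: mult.assoc)
qed

lemma frame_le_sum_take_eigs:
  assumes f: "orthonormal mset (words N n) r f" and "r \<le> q"
  shows "C * (\<Sum>i<r. \<Sum>l<D. nsq mset (words N k) (contract N M (\<phi> l) (f i))) \<le> sum_list (take q (eigs_desc L))"
proof -
  have "(\<Sum>i<r. Re (qform d L (symvec N n (f i)))) \<le> sum_list (take q (eigs_desc L))"
    using f by (intro Ky_Fan_le lift_carrier lift_hermitian eigs_nonneg assms(2))
      (simp_all add: orthonormal_symvec[OF N])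
  then show ?thesis unfolding qform_lift_symvec by (simp add: sum_distrib_left)
qed

lemma sum_eigs: "sum_list (eigs_desc L) = C * tr * kyfan N n M (sdim N n)"
proof (rule antisym)
  have "sum_list (eigs_desc L) \<le> C * tr * kyfan N n M (min d (sdim N n))"
    using sum_take_eigs_le[of d] length_eigs by simp
  also have "\<dots> \<le> C * tr * kyfan N n M (sdim N n)"
    using C_pos tr_nonneg by (intro mult_left_mono kyfan_mono) auto
  finally show "sum_list (eigs_desc L) \<le> C * tr * kyfan N n M (sdim N n)" .
next
  have "(\<Sum>i<sdim N n. \<Sum>l<D. nsq mset (words N k) (contract N M (\<phi> l) (occ N n i)))
     = (\<Sum>l<D. \<Sum>i<sdim N n. nsq mset (words N (n - M)) (contract N M (\<phi> l) (occ N n i)))"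
    by (subst sum.swap) simp
  also have "\<dots> = tr * kyfan N n M (sdim N n)"
    by (simp only: kyfan_trace[OF N le_add2] tr_def sum_distrib_right)
  finally have "C * tr * kyfan N n M (sdim N n) = C * (\<Sum>i<sdim N n. \<Sum>l<D. nsq mset (words N k) (contract N M (\<phi> l) (occ N n i)))"
    by simp
  \<comment> \<open>The maximum makes \<open>take\<close> return the whole list and bounds the
    length of the frame at the same time.\<close>
  also have "\<dots> \<le> sum_list (take (max d (sdim N n)) (eigs_desc L))"
    by (rule frame_le_sum_take_eigs[OF orthonormal_occ[OF N]]) simp
  also have "\<dots> = sum_list (eigs_desc L)" by (simp add: length_eigs)
  finally show "C * tr * kyfan N n M (sdim N n) \<le> sum_list (eigs_desc L)" .
qed

lemma product_of_top_eigenvalue: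
  assumes k: "0 < k" and top: "C * tr \<le> eigs_desc L ! 0"
  shows "\<exists>w. (\<Sum>x<N. (cmod (w x))\<^sup>2) = 1 \<and> (\<forall>l<D. \<exists>c. \<forall>A\<in>msets N M. \<phi> l A = c * prodf w A)"
proof -
  have "\<exists>v. nsq mset (words N (M + k)) v = 1 \<and> tr \<le> (\<Sum>l<D. nsq mset (words N k) (contract N M (\<phi> l) v))"
  \<comment> \<open>With trace zero the top eigenvalue need not yield a symmetric eigenvector, but
    then any unit vector v satisfies the inequality.\<close>
  proof (cases "tr = 0")
    case True
    then show ?thesis
      using orthonormal_nsq[OF orthonormal_occ[OF N] sdim_pos[OF N], of "M + k"]
      by (intro exI[of _ "occ N (M + k) 0"]) (simp add: sum_nonneg)
  next
    case False
    then have "0 < C * tr" using tr_nonneg C_pos by simp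
    then have pos: "0 < eigs_desc L ! 0" using top by linarith
    have d: "0 < d" using N by simp
    obtain f where "orthonormal mset (words N n) 1 f"
      and "eigs_desc L ! 0 = C * (\<Sum>l<D. nsq mset (words N k) (contract N M (\<phi> l) (f 0)))"
      using ex_symmetric_eigenframe pos d by (metis One_nat_def Suc_leI less_one)
    then show ?thesis
      using top C_pos orthonormal_nsq[of mset "words N n" 1 f 0]
      by (intro exI[of _ "f 0"]) (simp add: add.commute)
  qed
  then obtain v where "nsq mset (words N (M + k)) v = 1" "tr \<le> (\<Sum>l<D. nsq mset (words N k) (contract N M (\<phi> l) v))"
    by blast
  then show ?thesis
    by (intro coherent_of_maximal[OF N k]) (simp_all add: tr_def)
qed

end

section \<open>Transfer to the operators of the statement\<close>

lemma mat_adjoint_index: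
  assumes "A \<in> carrier_mat d d" "x < d" "y < d"
  shows "mat_adjoint A $$ (x, y) = cnj ((A :: complex mat) $$ (y, x))"
  using assms by (simp add: mat_adjoint_def mat_of_rows_def)

text \<open>The eigenvectors are scaled by the square roots of the eigenvalues. Those with nonzero
  eigenvalue are symmetric because \<Gamma> = P \<Gamma> P maps into the symmetric subspace; the
  others are scaled to zero.\<close>

lemma psd_symmetric_factored:
  assumes N: "1 \<le> N" and psd: "psd (N ^ M) \<Gamma>" and sym: "sym_proj N M * \<Gamma> * sym_proj N M = \<Gamma>"
  shows "\<exists>\<phi>. factored N M (N ^ M) \<phi> \<Gamma>"
proof -
  let ?d = "N ^ M"
  have carr: "\<Gamma> \<in> carrier_mat ?d ?d" using psd by (simp add: psd_def)
  have herm: "hermitian ?d (\<lambda>x y. \<Gamma> $$ (x, y))"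
    unfolding hermitian_def
  proof (intro allI impI)
    fix x y assume "x < ?d" "y < ?d"
    then show "\<Gamma> $$ (y, x) = cnj (\<Gamma> $$ (x, y))"
      using mat_adjoint_index[OF carr, of y x] psd by (simp add: psd_def)
  qed
  obtain z where z: "orthonormal id {..<?d} ?d z"
    and kernel: "\<forall>x<?d. \<forall>y<?d. \<Gamma> $$ (x, y) = (\<Sum>i<?d. of_real (eigs_desc \<Gamma> ! i) * z i x * cnj (z i y))"
    by (rule hermitian_spectral[OF carr herm])
  let ?l = "(!) (eigs_desc \<Gamma>)"
  have nonneg: "0 \<le> ?l i" if "i < ?d" for i
  proof -
    have "conjugate (vec ?d (z i)) \<bullet> (\<Gamma> *\<^sub>v vec ?d (z i)) = qform ?d \<Gamma> (z i)"
      using carr by (simp add: qform_def scalar_prod_def lessThan_atLeast0 sum_distrib_left mult.assoc)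
    moreover have "vec ?d (z i) \<in> carrier_vec ?d" by simp
    ultimately have "0 \<le> Re (qform ?d \<Gamma> (z i))" using psd unfolding psd_def by metis
    then show ?thesis by (simp add: qform_eigenvector[OF kernel z that])
  qed
  have "\<exists>f. i < ?d \<longrightarrow> (\<forall>x<?d. of_real (sqrt (?l i)) * z i x = symvec N M f x)" for i
  proof (cases "?l i = 0")
    case True
    then show ?thesis by (intro exI[of _ "\<lambda>_. 0"]) (simp add: symvec_def)
  next
    case False
    let ?P = "act ?d (\<lambda>x y. sym_proj N M $$ (x, y))"
    obtain f where f: "\<forall>x<?d. ?P (act ?d (\<lambda>x y. \<Gamma> $$ (x, y)) (?P (z i))) x = symvec N M f x"
      using act_sym_proj_range by blast
    have "of_real (sqrt (?l i)) * z i x = symvec N M (\<lambda>X. of_real (sqrt (?l i) / ?l i) * f X) x"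
      if "i < ?d" "x < ?d" for x
    proof -
      have "of_real (?l i) * z i x = symvec N M f x"
        using act_eigenvector[OF kernel z that] f that(2)
          act_sandwich[OF sym_proj_carrier carr that(2), of "z i"] by (simp add: sym)
      then show ?thesis using False unfolding symvec_scale by (simp add: field_simps)
    qed
    then show ?thesis by blast
  qed
  then obtain \<phi> where \<phi>: "\<And>i x. i < ?d \<Longrightarrow> x < ?d \<Longrightarrow> of_real (sqrt (?l i)) * z i x = symvec N M (\<phi> i) x"
    by metis
  have "\<Gamma> $$ (x, y) = (\<Sum>i<?d. symvec N M (\<phi> i) x * cnj (symvec N M (\<phi> i) y))"
    if "x < ?d" "y < ?d" for x y
  proof -
    have "of_real (?l i) * z i x * cnj (z i y) = symvec N M (\<phi> i) x * cnj (symvec N M (\<phi> i) y)"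
      if "i < ?d" for i
    proof -
      have "complex_of_real (?l i) = of_real (sqrt (?l i)) * of_real (sqrt (?l i))"
        using nonneg[OF that] by (simp flip: of_real_mult)
      then show ?thesis
        using \<phi>[OF that \<open>x < ?d\<close>, symmetric] \<phi>[OF that \<open>y < ?d\<close>, symmetric] by (simp add: mult_ac)
    qed
    then show ?thesis using kernel that by simp
  qed
  then show ?thesis using carr by (intro exI[of _ \<phi>]) (simp add: factored_def)
qed

lemma tensor_pow_index:
  assumes "i < N ^ M"
  shows "tensor_pow N M u $ i = symvec N M (prodf (\<lambda>x. u $ x)) i"
proof -
  have "(\<Prod>t<M. u $ dig N M i t) = prod_list (map (\<lambda>x. u $ x) (dec N M i))"
    by (simp add: dec_def prod.list_conv_set_nth lessThan_atLeast0)
  then show ?thesis using assms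
    by (simp add: tensor_pow_def symvec_def prodf_def flip: mset_map prod_mset_prod_list)
qed

lemma ket_bra_tensor_pow_index:
  assumes "x < N ^ M" "y < N ^ M"
  shows "ket_bra (tensor_pow N M u) $$ (x, y) =
    symvec N M (prodf (\<lambda>x. u $ x)) x * cnj (symvec N M (prodf (\<lambda>x. u $ x)) y)"
proof -
  have "dim_vec (tensor_pow N M u) = N ^ M" by (simp add: tensor_pow_def)
  then show ?thesis using assms by (simp add: ket_bra_def tensor_pow_index)
qed

lemma ket_bra_tensor_pow_carrier: "ket_bra (tensor_pow N M u) \<in> carrier_mat (N ^ M) (N ^ M)"
  by (simp add: ket_bra_def tensor_pow_def)

text \<open>Moves the trace inside, so that the coherent side is again a lift and the locale applies
  to it.\<close>

lemma lift_op_smult: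
  assumes N: "1 \<le> N" and A: "A \<in> carrier_mat (N ^ M) (N ^ M)"
  shows "c \<cdot>\<^sub>m lift_op N M k A = lift_op N M k (c \<cdot>\<^sub>m A)"
proof -
  have "i mod N ^ M < N ^ M" for i using N by simp
  then have T: "id_tensor N M k (c \<cdot>\<^sub>m A) = c \<cdot>\<^sub>m id_tensor N M k A"
    using A by (intro eq_matI) (auto simp: id_tensor_def)
  have carr: "id_tensor N M k A \<in> carrier_mat (N ^ (M + k)) (N ^ (M + k))"
    using id_tensor_carrier[of N M k A] by (simp add: add.commute)
  let ?P = "sym_proj N (M + k)"
  have "?P * (c \<cdot>\<^sub>m id_tensor N M k A) * ?P = c \<cdot>\<^sub>m (?P * id_tensor N M k A * ?P)"
    using mult_smult_distrib[OF sym_proj_carrier carr, of c]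
      mult_smult_assoc_mat[OF mult_carrier_mat[OF sym_proj_carrier carr] sym_proj_carrier, of c] by simp
  moreover have "c \<cdot>\<^sub>m (a \<cdot>\<^sub>m X) = a \<cdot>\<^sub>m (c \<cdot>\<^sub>m X)" for a and X :: "complex mat"
    by (intro eq_matI) auto
  ultimately show ?thesis by (simp add: lift_op_def T)
qed

theorem theorem3:
  fixes N M k :: nat and \<Gamma> :: "complex mat" and u :: "complex vec"
  assumes "N \<ge> 2" and "M \<ge> 1"
    and "psd (N ^ M) \<Gamma>"
    and "sym_proj N M * \<Gamma> * sym_proj N M = \<Gamma>"
    and "unit_cvec N u"
  shows "majorizes (eigs_desc (mtrace \<Gamma> \<cdot>\<^sub>m lift_op N M k (ket_bra (tensor_pow N M u))))
                   (eigs_desc (lift_op N M k \<Gamma>)) \<and>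
         (M \<ge> 2 \<longrightarrow> k > 0 \<longrightarrow>
         eigs_desc (mtrace \<Gamma> \<cdot>\<^sub>m lift_op N M k (ket_bra (tensor_pow N M u)))
           = eigs_desc (lift_op N M k \<Gamma>) \<longrightarrow>
         (\<exists>w. unit_cvec N w \<and> \<Gamma> = mtrace \<Gamma> \<cdot>\<^sub>m ket_bra (tensor_pow N M w)))"
proof -
  have N: "1 \<le> N" using assms(1) by simp
  obtain \<phi> where \<phi>: "factored N M (N ^ M) \<phi> \<Gamma>"
    using psd_symmetric_factored[OF N assms(3,4)] by blast
  interpret A: lifted N M k "N ^ M" \<phi> \<Gamma> by standard (use N \<phi> in auto)
  have tr: "mtrace \<Gamma> = of_real A.tr"
    using factored_trace[OF N \<phi>] by (simp add: A.tr_def)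
  \<comment> \<open>The square root of the trace makes \<psi> a rank one factor of \<Gamma>', with
    the same trace as \<Gamma>.\<close>
  define \<psi> where "\<psi> = (\<lambda>(_::nat) X. of_real (sqrt A.tr) * prodf (\<lambda>x. u $ x) X)"
  define \<Gamma>' where "\<Gamma>' = mtrace \<Gamma> \<cdot>\<^sub>m ket_bra (tensor_pow N M u)"
  have sq: "complex_of_real A.tr = of_real (sqrt A.tr) * of_real (sqrt A.tr)"
    using A.tr_nonneg by (simp flip: of_real_mult)
  have "symvec N M (\<psi> l) x = of_real (sqrt A.tr) * symvec N M (prodf (\<lambda>x. u $ x)) x" for l x
    unfolding \<psi>_def by (rule symvec_scale)
  then have \<psi>: "factored N M 1 \<psi> \<Gamma>'"
    using ket_bra_tensor_pow_carrier[of N M u]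
    by (simp add: factored_def \<Gamma>'_def tr sq ket_bra_tensor_pow_index mult_ac)
  interpret B: lifted N M k 1 \<psi> \<Gamma>' by standard (use N \<psi> in auto)
  have unit: "(\<Sum>x<N. (cmod (u $ x))\<^sup>2) = 1" using assms(5) by (simp add: unit_cvec_def)
  have trB: "B.tr = A.tr"
    unfolding B.tr_def using A.tr_nonneg by (simp add: \<psi>_def nsq_scale nsq_prodf[OF N unit])
  have eq: "mtrace \<Gamma> \<cdot>\<^sub>m lift_op N M k (ket_bra (tensor_pow N M u)) = lift_op N M k \<Gamma>'"
    unfolding \<Gamma>'_def by (rule lift_op_smult[OF N ket_bra_tensor_pow_carrier])
  \<comment> \<open>The value \<open>kyfan\<close>, scaled by prefactor and trace, separates the two
    sides: it bounds the partial sums for \<Gamma> from above and the coherent ones from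
    below.\<close>
  have lower: "A.C * A.tr * kyfan N (k + M) M (min q (sdim N (k + M))) \<le> sum_list (take q (eigs_desc (lift_op N M k \<Gamma>')))" for q
  proof -
    let ?r = "min q (sdim N (k + M))"
    obtain v where v: "orthonormal mset (words N (k + M)) ?r v"
      "(\<Sum>i<?r. nsq mset (words N (k + M - M)) (contract N M (prodf (\<lambda>x. u $ x)) (v i))) = kyfan N (k + M) M ?r"
      using coherent_frame[OF N unit, of M "k + M" ?r] by auto
    have "contract N M (\<psi> l) (v i) = (\<lambda>B. cnj (of_real (sqrt A.tr)) * contract N M (prodf (\<lambda>x. u $ x)) (v i) B)" for l i
      by (simp add: fun_eq_iff \<psi>_def contract_scale_left)
    then have "(\<Sum>i<?r. \<Sum>l<1. nsq mset (words N k) (contract N M (\<psi> l) (v i))) = A.tr * kyfan N (k + M) M ?r"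
      using v(2) A.tr_nonneg by (simp add: nsq_scale sum_distrib_left[symmetric])
    then show ?thesis
      using B.frame_le_sum_take_eigs[OF v(1), of q] by (simp add: A.C_def B.C_def mult.assoc)
  qed
  have "majorizes (eigs_desc (lift_op N M k \<Gamma>')) (eigs_desc (lift_op N M k \<Gamma>))"
    unfolding majorizes_def
  proof (intro conjI ballI)
    show "length (eigs_desc (lift_op N M k \<Gamma>')) = length (eigs_desc (lift_op N M k \<Gamma>))"
      by (simp add: A.length_eigs B.length_eigs)
    show "sum_list (eigs_desc (lift_op N M k \<Gamma>')) = sum_list (eigs_desc (lift_op N M k \<Gamma>))"
      unfolding A.sum_eigs B.sum_eigs trB A.C_def B.C_def ..
    show "sum_list (take q (eigs_desc (lift_op N M k \<Gamma>))) \<le> sum_list (take q (eigs_desc (lift_op N M k \<Gamma>')))" for q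
      using A.sum_take_eigs_le[of q] lower[of q] by linarith
  qed
  moreover have "\<exists>w. unit_cvec N w \<and> \<Gamma> = mtrace \<Gamma> \<cdot>\<^sub>m ket_bra (tensor_pow N M w)"
    if k: "0 < k" and same: "eigs_desc (lift_op N M k \<Gamma>') = eigs_desc (lift_op N M k \<Gamma>)"
  proof -
    \<comment> \<open>Only the first entries matter here: \<open>kyfan\<close> is 1 for a single
      level, so equal lists make the top eigenvalue for \<Gamma> reach the prefactor times the
      trace.\<close>
    have "min 1 (sdim N (k + M)) = 1" using sdim_pos[OF N, of "k + M"] by simp
    moreover have "sum_list (take 1 (eigs_desc (lift_op N M k \<Gamma>))) = eigs_desc (lift_op N M k \<Gamma>) ! 0"
      using A.length_eigs N by (simp add: take_Suc hd_conv_nth flip: length_greater_0_conv)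
    ultimately have "A.C * A.tr \<le> eigs_desc (lift_op N M k \<Gamma>) ! 0"
      using lower[of 1] kyfan_1[OF N, of M "k + M"] same by simp
    from A.product_of_top_eigenvalue[OF k this]
    obtain w where w: "(\<Sum>x<N. (cmod (w x))\<^sup>2) = 1" "\<forall>l<N ^ M. \<exists>c. \<forall>X\<in>msets N M. \<phi> l X = c * prodf w X"
      by blast
    then obtain c where c: "\<And>l X. l < N ^ M \<Longrightarrow> X \<in> msets N M \<Longrightarrow> \<phi> l X = c l * prodf w X"
      by metis
    have in_msets: "mset (dec N M x) \<in> msets N M" if "x < N ^ M" for x
      using bij_dec[OF N, of M] that by (auto simp: msets_def bij_betw_def)
    have \<phi>x: "symvec N M (\<phi> l) x = c l * symvec N M (prodf w) x" if "l < N ^ M" "x < N ^ M" for l x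
      using c[OF that(1) in_msets[OF that(2)]] by (simp add: symvec_def)
    have "nsq mset (words N M) (\<phi> l) = (cmod (c l))\<^sup>2" if "l < N ^ M" for l
    proof -
      have "nsq mset (words N M) (\<phi> l) = nsq mset (words N M) (\<lambda>X. c l * prodf w X)"
        unfolding nsq_def using c[OF that] by (intro sum.cong) (auto simp: msets_def)
      then show ?thesis by (simp add: nsq_scale nsq_prodf[OF N w(1)])
    qed
    \<comment> \<open>All \<phi> l are multiples of one unit product state, so \<Gamma> is a
      multiple of its projection, and the trace identifies the factor.\<close>
    then have trc: "A.tr = (\<Sum>l<N ^ M. (cmod (c l))\<^sup>2)" by (simp add: A.tr_def)
    have entry: "\<Gamma> $$ (x, y) = of_real A.tr * (symvec N M (prodf w) x * cnj (symvec N M (prodf w) y))"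
      if "x < N ^ M" "y < N ^ M" for x y
    proof -
      have "\<Gamma> $$ (x, y) = (\<Sum>l<N ^ M. (c l * cnj (c l)) * (symvec N M (prodf w) x * cnj (symvec N M (prodf w) y)))"
        using \<phi> that by (simp add: factored_def \<phi>x mult_ac)
      then show ?thesis
        unfolding trc of_real_sum complex_norm_square sum_distrib_right .
    qed
    define w' where "w' = vec N w"
    have "prodf w X = prodf (\<lambda>x. w' $ x) X" if "X \<in> msets N M" for X
      unfolding prodf_def using that
      by (intro arg_cong[where f = prod_mset] image_mset_cong) (auto simp: in_msets_iff w'_def)
    then have sv: "symvec N M (prodf w) x = symvec N M (prodf (\<lambda>x. w' $ x)) x" if "x < N ^ M" for x
      using in_msets[OF that] by (simp add: symvec_def)
    have "\<Gamma> = mtrace \<Gamma> \<cdot>\<^sub>m ket_bra (tensor_pow N M w')"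
      using ket_bra_tensor_pow_carrier[of N M w'] \<phi>
      by (intro eq_matI) (auto simp: factored_def tr entry sv ket_bra_tensor_pow_index)
    moreover have "unit_cvec N w'" using w(1) by (simp add: unit_cvec_def w'_def)
    ultimately show ?thesis by blast
  qed
  ultimately show ?thesis unfolding eq by blast
qed

end
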